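(* Let $w\in\mathfrak S_n$ be a $321$-avoiding permutation. Then the Temperley-Lieb immanant $\operatorname{Imm}_w$ is a \%-immanant up to sign (i.e. $\operatorname{Imm}_w=\pm\operatorname{Imm}^{\%}_{\lambda/\mu}$ for some skew shape $\lambda/\mu$) if and only if $w$ avoids both $1324$ and $2143$. In that case, $\operatorname{Imm}_w=\operatorname{sgn}(w)\operatorname{Imm}^{\%}_w$.
   Context: Notation. $[n]=\{1,\dots,n\}$; $\mathfrak S_n$ is the symmetric group on $[n]$ with product $(v\cdot w)(i)=v(w(i))$; $s_i=(i,i+1)$ for $1\le i\le n-1$. Permutations and patterns are written in one-line notation. $x_{i,j}$ ($1\le i,j\le n$) are $n^2$ commuting variables, and for $u\in\mathfrak S_n$ put $x_u=\prod_{i=1}^n x_{i,u(i)}$. Pattern avoidance. For $w\in\mathfrak S_n$ and $I\subset[n]$, $w|_I\in\mathfrak S_{|I|}$ is the permutation such that $w$ maps the $i$-th smallest element of $I$ to the $w|_I(i)$-th smallest element of $w(I)$. $w$ avoids $v\in\mathfrak S_m$ if there is no $I\subset[n]$ with $|I|=m$ and $w|_I=v$. Temperley-Lieb immanants. $TL_n(2)$ is the unital associative $\mathbb C$-algebra generated by $t_1,\dots,t_{n-1}$ with relations $t_i^2=2t_i$, $t_it_j=t_jt_i$ if $|i-j|\ge2$, and $t_it_jt_i=t_i$ if $|i-j|=1$. Let $\theta:\mathbb C[\mathfrak S_n]\to TL_n(2)$ be the $\mathbb C$-algebra homomorphism with $\theta(s_i)=t_i-1$. For a $321$-avoiding $w\in\mathfrak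 S_n$ with reduced word $s_{i_1}\cdots s_{i_k}$, put $\beta(w)=t_{i_1}\cdots t_{i_k}$; this does not depend on the reduced word, and the $\beta(w)$, over $321$-avoiding $w\in\mathfrak S_n$, form a basis of $TL_n(2)$. For $u\in\mathfrak S_n$ let $f_w(u)$ be the coefficient of $\beta(w)$ in the expansion of $\theta(u)$ in this basis. The Temperley-Lieb immanant of a $321$-avoiding $w$ is $\operatorname{Imm}_w=\sum_{u\in\mathfrak S_n}f_w(u)x_u$. \%-immanants. A skew shape $\lambda/\mu$ (in the $n\times n$ square) is given by non-increasing sequences of non-negative integers $\lambda=(\lambda_1,\dots,\lambda_n)$, $\mu=(\mu_1,\dots,\mu_n)$ with $\mu_i\le\lambda_i\le n$. A permutation $\sigma\in\mathfrak S_n$ lies in $\lambda/\mu$ if $\mu_i<\sigma(i)\le\lambda_i$ for all $1\le i\le n$. The \%-immanant of $\lambda/\mu$ is $\operatorname{Imm}^{\%}_{\lambda/\mu}=\sum_{\sigma}\operatorname{sgn}(\sigma)x_\sigma$, summed over all $\sigma\in\mathfrak S_n$ lying in $\lambda/\mu$. For $w\in\mathfrak S_n$ let $m_w(i)=\min w(\{1,\dots,i\})$ and $M_w(i)=\max w(\{i,\dots,n\})$; then $\operatorname{Imm}^{\%}_w:=\operatorname{Imm}^{\%}_{\lambda/\mu}$ with $\mu_i=m_w(i)-1$ and $\lambda_i=M_w(i)$ for $1\le i\le n$. *)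

theory Defs
  imports
    Complex_Main
    "HOL-Library.Poly_Mapping"
    "HOL-Library.FuncSet"
    "HOL-Combinatorics.Permutations"
    "HOL-Algebra.QuotRing"
    "HOL-Algebra.Module"
begin

section \<open>Permutations, reduced words and patterns\<close>

text \<open>
  An element of the symmetric group on [n] is a function \<open>w\<close> with \<open>w permutes {1..n}\<close>; the
  product is \<open>(\<circ>)\<close>.
\<close>

definition simple_refl :: "nat \<Rightarrow> nat \<Rightarrow> nat" where
  "simple_refl i = transpose i (Suc i)"

definition word_perm :: "nat list \<Rightarrow> nat \<Rightarrow> nat" where
  "word_perm is = foldr (\<lambda>i v. simple_refl i \<circ> v) is id"

definition reduced_word :: "nat \<Rightarrow> (nat \<Rightarrow> nat) \<Rightarrow> nat list \<Rightarrow> bool" where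
  "reduced_word n w is \<longleftrightarrow>
     set is \<subseteq> {1..n-1} \<and> word_perm is = w \<and>
     (\<forall>js. set js \<subseteq> {1..n-1} \<and> word_perm js = w \<longrightarrow> length is \<le> length js)"

definition one_line :: "nat list \<Rightarrow> nat \<Rightarrow> nat" where
  "one_line xs i = (if i \<in> {1..length xs} then xs ! (i - 1) else i)"

definition kth_smallest :: "nat set \<Rightarrow> nat \<Rightarrow> nat" where
  "kth_smallest I k = sorted_list_of_set I ! (k - 1)"  \<comment> \<open>for \<open>1 \<le> k \<le> card I\<close>\<close>

text \<open>\<open>restricts_to w I v\<close> says that \<open>v\<close> is the permutation \<open>w|\<^sub>I\<close> of \<open>{1..card I}\<close>.\<close>

definition restricts_to :: "(nat \<Rightarrow> nat) \<Rightarrow> nat set \<Rightarrow> (nat \<Rightarrow> nat) \<Rightarrow> bool" where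
  "restricts_to w I v \<longleftrightarrow>
     v permutes {1..card I} \<and>
     (\<forall>i\<in>{1..card I}. w (kth_smallest I i) = kth_smallest (w ` I) (v i))"

definition avoids :: "nat \<Rightarrow> (nat \<Rightarrow> nat) \<Rightarrow> nat list \<Rightarrow> bool" where
  "avoids n w xs \<longleftrightarrow>
     \<not> (\<exists>I. I \<subseteq> {1..n} \<and> card I = length xs \<and> restricts_to w I (one_line xs))"

definition perms_avoiding_321 :: "nat \<Rightarrow> (nat \<Rightarrow> nat) set" where
  "perms_avoiding_321 n = {w. w permutes {1..n} \<and> avoids n w [3,2,1]}"


section \<open>The Temperley--Lieb algebra\<close>

text \<open>
  The free associative \<open>\<complex>\<close>-algebra is the monoid algebra of the free monoid. The latter needs a type
  of its own, written additively, because the convolution product on \<^typ>\<open>'a \<Rightarrow>\<^sub>0 'b\<close> is taken with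
  respect to the (possibly noncommutative) addition of \<^typ>\<open>'a\<close>.
\<close>

datatype 'a free_mon = Free_Mon (letters: "'a list")

instantiation free_mon :: (type) monoid_add
begin

definition zero_free_mon :: "'a free_mon" where
  "0 = Free_Mon []"

definition plus_free_mon :: "'a free_mon \<Rightarrow> 'a free_mon \<Rightarrow> 'a free_mon" where
  "a + b = Free_Mon (letters a @ letters b)"

instance
  by standard (simp_all add: zero_free_mon_def plus_free_mon_def)

end

type_synonym free_elt = "nat free_mon \<Rightarrow>\<^sub>0 complex"

definition free_gen :: "nat \<Rightarrow> free_elt" where
  "free_gen i = Poly_Mapping.single (Free_Mon [i]) 1"

text \<open>
  Records of type \<open>module\<close> are used for the signature of an algebra; the locale \<open>algebra\<close> of the
  library does not apply, as it requires commutativity.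
\<close>

definition free_algebra :: "nat set \<Rightarrow> (complex, free_elt) module" where
  "free_algebra S =
     \<lparr>carrier = {a. \<forall>m\<in>Poly_Mapping.keys a. set (letters m) \<subseteq> S},
      mult = (*), one = 1, zero = 0, add = (+),
      smult = (\<lambda>c a. Poly_Mapping.single 0 c * a)\<rparr>"

definition TL_relations :: "nat \<Rightarrow> free_elt set" where
  "TL_relations n =
     {free_gen i * free_gen i - 2 * free_gen i | i. i \<in> {1..n-1}} \<union>
     {free_gen i * free_gen j - free_gen j * free_gen i | i j.
        i \<in> {1..n-1} \<and> j \<in> {1..n-1} \<and> \<bar>int i - int j\<bar> \<ge> 2} \<union>
     {free_gen i * free_gen j * free_gen i - free_gen i | i j.
        i \<in> {1..n-1} \<and> j \<in> {1..n-1} \<and> \<bar>int i - int j\<bar> = 1}"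

definition TL_ideal :: "nat \<Rightarrow> free_elt set" where
  "TL_ideal n = genideal (free_algebra {1..n-1}) (TL_relations n)"

text \<open>The scalar action on the quotient is multiplication by the coset of a constant.\<close>

definition TL :: "nat \<Rightarrow> (complex, free_elt set) module" where
  "TL n =
     (let F = free_algebra {1..n-1}; Q = F Quot TL_ideal n in
      \<lparr>carrier = carrier Q, mult = mult Q, one = one Q, zero = zero Q, add = add Q,
       smult = (\<lambda>c X. (TL_ideal n +>\<^bsub>F\<^esub> Poly_Mapping.single 0 c) \<otimes>\<^bsub>Q\<^esub> X)\<rparr>)"

definition TL_gen :: "nat \<Rightarrow> nat \<Rightarrow> free_elt set" where
  "TL_gen n i = TL_ideal n +>\<^bsub>free_algebra {1..n-1}\<^esub> free_gen i"

definition TL_word :: "nat \<Rightarrow> nat list \<Rightarrow> free_elt set" where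
  "TL_word n is = foldr (\<lambda>i X. TL_gen n i \<otimes>\<^bsub>TL n\<^esub> X) is \<one>\<^bsub>TL n\<^esub>"

definition TL_basis :: "nat \<Rightarrow> (nat \<Rightarrow> nat) \<Rightarrow> free_elt set" where
  "TL_basis n w = TL_word n (SOME is. reduced_word n w is)"


section \<open>The group algebra of the symmetric group and the homomorphism \<open>\<theta>\<close>\<close>

definition perm_algebra :: "nat \<Rightarrow> (complex, (nat \<Rightarrow> nat) \<Rightarrow> complex) module" where
  "perm_algebra n =
     \<lparr>carrier = {a. \<forall>u. \<not> u permutes {1..n} \<longrightarrow> a u = 0},
      mult = (\<lambda>a b u. \<Sum>(v, w) | v permutes {1..n} \<and> w permutes {1..n} \<and> v \<circ> w = u. a v * b w),
      one = (\<lambda>u. if u = id then 1 else 0),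
      zero = (\<lambda>u. 0),
      add = (\<lambda>a b u. a u + b u),
      smult = (\<lambda>c a u. c * a u)\<rparr>"

definition perm_elt :: "(nat \<Rightarrow> nat) \<Rightarrow> (nat \<Rightarrow> nat) \<Rightarrow> complex" where
  "perm_elt w = (\<lambda>u. if u = w then 1 else 0)"

text \<open>\<^const>\<open>ring_hom\<close> includes preservation of the unit.\<close>

definition alg_hom :: "(complex, 'a) module \<Rightarrow> (complex, 'b) module \<Rightarrow> ('a \<Rightarrow> 'b) set" where
  "alg_hom A B =
     {h \<in> ring_hom A B. \<forall>c. \<forall>a\<in>carrier A. h (c \<odot>\<^bsub>A\<^esub> a) = c \<odot>\<^bsub>B\<^esub> h a}"

text \<open>Extensionality makes \<open>\<theta>\<close> unique as a HOL function, so that \<open>THE\<close> picks it out.\<close>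

definition theta :: "nat \<Rightarrow> ((nat \<Rightarrow> nat) \<Rightarrow> complex) \<Rightarrow> free_elt set" where
  "theta n = (THE h.
     h \<in> extensional (carrier (perm_algebra n)) \<and>
     h \<in> alg_hom (perm_algebra n) (TL n) \<and>
     (\<forall>i\<in>{1..n-1}. h (perm_elt (simple_refl i)) = TL_gen n i \<ominus>\<^bsub>TL n\<^esub> \<one>\<^bsub>TL n\<^esub>))"

text \<open>\<open>TL_coords n X w\<close> is the coefficient of \<open>\<beta>(w)\<close> in the expansion of \<open>X\<close>.\<close>

definition TL_coords :: "nat \<Rightarrow> free_elt set \<Rightarrow> (nat \<Rightarrow> nat) \<Rightarrow> complex" where
  "TL_coords n X = (THE f.
     f \<in> extensional (perms_avoiding_321 n) \<and>
     X = (\<Oplus>\<^bsub>TL n\<^esub>w\<in>perms_avoiding_321 n. f w \<odot>\<^bsub>TL n\<^esub> TL_basis n w))"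

definition TL_coeff :: "nat \<Rightarrow> (nat \<Rightarrow> nat) \<Rightarrow> (nat \<Rightarrow> nat) \<Rightarrow> complex" where
  "TL_coeff n w u = TL_coords n (theta n (perm_elt u)) w"


section \<open>Immanants\<close>

text \<open>
  Polynomials with complex coefficients in commuting variables \<open>x\<^sub>i\<^sub>,\<^sub>j\<close>: a monomial is a finitely
  supported map from pairs of indices to exponents.
\<close>

type_synonym matrix_poly = "((nat \<times> nat) \<Rightarrow>\<^sub>0 nat) \<Rightarrow>\<^sub>0 complex"

definition const_poly :: "complex \<Rightarrow> matrix_poly" where
  "const_poly c = Poly_Mapping.single 0 c"

definition var :: "nat \<Rightarrow> nat \<Rightarrow> matrix_poly" where
  "var i j = Poly_Mapping.single (Poly_Mapping.single (i, j) 1) 1"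

definition perm_monom :: "nat \<Rightarrow> (nat \<Rightarrow> nat) \<Rightarrow> matrix_poly" where
  "perm_monom n u = (\<Prod>i\<in>{1..n}. var i (u i))"

definition TL_immanant :: "nat \<Rightarrow> (nat \<Rightarrow> nat) \<Rightarrow> matrix_poly" where
  "TL_immanant n w =
     (\<Sum>u | u permutes {1..n}. const_poly (TL_coeff n w u) * perm_monom n u)"

text \<open>A skew shape lambda over mu is written \<open>la\<close>, \<open>mu\<close>; only the values on \<open>{1..n}\<close> matter.\<close>

definition skew_shape :: "nat \<Rightarrow> (nat \<Rightarrow> nat) \<Rightarrow> (nat \<Rightarrow> nat) \<Rightarrow> bool" where
  "skew_shape n la mu \<longleftrightarrow>
     antimono_on {1..n} la \<and> antimono_on {1..n} mu \<and> (\<forall>i\<in>{1..n}. mu i \<le> la i \<and> la i \<le> n)"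

definition lies_in :: "nat \<Rightarrow> (nat \<Rightarrow> nat) \<Rightarrow> (nat \<Rightarrow> nat) \<Rightarrow> (nat \<Rightarrow> nat) \<Rightarrow> bool" where
  "lies_in n \<sigma> la mu \<longleftrightarrow> (\<forall>i\<in>{1..n}. mu i < \<sigma> i \<and> \<sigma> i \<le> la i)"

definition percent_immanant :: "nat \<Rightarrow> (nat \<Rightarrow> nat) \<Rightarrow> (nat \<Rightarrow> nat) \<Rightarrow> matrix_poly" where
  "percent_immanant n la mu =
     (\<Sum>\<sigma> | \<sigma> permutes {1..n} \<and> lies_in n \<sigma> la mu. of_int (sign \<sigma>) * perm_monom n \<sigma>)"

definition percent_immanant_perm :: "nat \<Rightarrow> (nat \<Rightarrow> nat) \<Rightarrow> matrix_poly" where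
  "percent_immanant_perm n w =
     percent_immanant n (\<lambda>i. Max (w ` {i..n})) (\<lambda>i. Min (w ` {1..i}) - 1)"

definition percent_immanant_up_to_sign :: "nat \<Rightarrow> matrix_poly \<Rightarrow> bool" where
  "percent_immanant_up_to_sign n p \<longleftrightarrow>
     (\<exists>la mu. skew_shape n la mu \<and> (p = percent_immanant n la mu \<or> p = - percent_immanant n la mu))"

end

theory Submission
  imports Defs
begin

text \<open>
  Linear functionals on the Temperley-Lieb algebra correspond, via \<open>\<theta>\<close>, to functions \<open>g\<close> on the
  symmetric group with \<open>\<Sum>\<^sub>v g (a v b) = 0\<close>, where \<open>v\<close> ranges over the permutations of three letters;
  the functional of \<open>g\<close> sends \<open>t\<^sub>i\<^sub>1 \<dots> t\<^sub>i\<^sub>k\<close> to the sum of \<open>g\<close> over the products of all subwords.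
  Signed indicator functions of conditions on \<open>u ` J\<close> are of this kind, and for \<open>J\<close> the set of
  left-to-right maxima of \<open>w\<close> and the condition \<open>u ` J = w ` J\<close> they are triangular with respect to the
  \<open>\<beta>(w)\<close>. This gives the basis and \<open>\<theta>\<close>, shows \<open>f\<^sub>w(w) = 1\<close>, and shows that \<open>f\<^sub>w(u) = 0\<close> if \<open>u \<noteq> w\<close> is
  not above \<open>w\<close>.

  If \<open>w\<close> avoids 321, 1324 and 2143, then \<open>w\<close> or its inverse is Grassmannian, and its shape consists of
  the \<open>u\<close> with \<open>{q' + 1..n} \<subseteq> u ` {1..p} \<subseteq> {q + 1..n}\<close>. The functional of the signed indicator of
  this set vanishes on \<open>\<beta>(v)\<close> unless all left descents of \<open>v\<close> are \<open>q\<close> or \<open>q'\<close> and its only right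
  descent is \<open>p\<close>, which leaves \<open>v = w\<close>. Conversely, if \<open>Imm\<^sub>w\<close> is a signed indicator of a shape, the
  shape contains \<open>w\<close>; a pattern 1324 puts a smaller permutation into it, and a pattern 2143 produces
  a nonvanishing sum over the permutations of three letters.
\<close>

text \<open>Both \<open>theta\<close> and \<open>TL_coords\<close> are definite descriptions, so
  nothing about them is available before existence and uniqueness are proved, that is, before the
  \<beta>(w) are known to be a basis. Spanning is a rewriting argument on words. For independence,
  which needs a model of the algebra, \<open>TL_functions\<close> supplies enough functionals: t_i
  is the image of 1 + s_i, and t_i t_j t_i - t_i is the image of the symmetrizer of three letters,
  so functions killing symmetrizers descend to the quotient. Spanning and independence together show
  that \<open>TL_ideal\<close> is exactly the common kernel of these functionals
  (\<open>TL_ideal_eq_annihilator\<close>). Equality of classes can then be tested by functionals;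
  in particular \<theta> is built from arbitrarily chosen reduced words and its multiplicativity is
  read off from values of functions on the group. Triangularity is measured by the number
  \<open>weight\<close>, which grows strictly along the Bruhat order; a heaviest index therefore
  always exists in a finite set.\<close>

unbundle no m_inv_syntax
declare One_nat_def [simp del]

section \<open>Simple reflections and products of words\<close>

lemma simple_refl_permutes: "i \<in> {1..n-1} \<Longrightarrow> simple_refl i permutes {1..n}"
  unfolding simple_refl_def by (rule permutes_swap_id) auto

lemma simple_refl_involutive [simp]: "simple_refl i \<circ> simple_refl i = id"
  by (simp add: simple_refl_def)

lemma simple_refl_cancel [simp]: "simple_refl i \<circ> (simple_refl i \<circ> w) = w"
  by (simp add: o_assoc)

lemma simple_refl_apply [simp]:
  "simple_refl i i = Suc i" "simple_refl i (Suc i) = i"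
  "k \<noteq> i \<Longrightarrow> k \<noteq> Suc i \<Longrightarrow> simple_refl i k = k"
  by (auto simp: simple_refl_def)

lemma inv_simple_refl_comp:
  assumes "w permutes S"
  shows "inv (simple_refl i \<circ> w) = inv w \<circ> simple_refl i"
  using assms by (simp add: o_inv_distrib permutes_bij simple_refl_def)

lemma simple_refl_comp_permutes:
  "i \<in> {1..n-1} \<Longrightarrow> w permutes {1..n} \<Longrightarrow> simple_refl i \<circ> w permutes {1..n}"
  by (rule permutes_compose[OF _ simple_refl_permutes])

lemma simple_refl_commute:
  "\<bar>int i - int j\<bar> \<ge> 2 \<Longrightarrow> simple_refl i \<circ> simple_refl j = simple_refl j \<circ> simple_refl i"
  by (auto simp: fun_eq_iff simple_refl_def transpose_def)

lemma simple_refl_braid: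
  "\<bar>int i - int j\<bar> = 1 \<Longrightarrow>
    simple_refl i \<circ> simple_refl j \<circ> simple_refl i = simple_refl j \<circ> simple_refl i \<circ> simple_refl j"
  by (auto simp: fun_eq_iff simple_refl_def transpose_def)

lemma word_perm_Nil [simp]: "word_perm [] = id"
  by (simp add: word_perm_def)

lemma word_perm_Cons: "word_perm (i # is) = simple_refl i \<circ> word_perm is"
  by (simp add: word_perm_def)

lemma word_perm_append: "word_perm (is @ js) = word_perm is \<circ> word_perm js"
  by (induction "is") (simp_all add: o_assoc word_perm_Cons)

lemma word_perm_permutes: "set is \<subseteq> {1..n-1} \<Longrightarrow> word_perm is permutes {1..n}"
proof (induction "is")
  case (Cons i "is")
  then show ?case unfolding word_perm_Cons by (intro simple_refl_comp_permutes) simp_all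
qed (simp add: permutes_id)

lemma word_perm_rev:
  "word_perm (rev is) = inv (word_perm is)"
proof -
  have "word_perm (rev is) \<circ> word_perm is = id" for "is"
  proof (induction "is")
    case (Cons i "is")
    have "word_perm (rev (i # is)) \<circ> word_perm (i # is)
        = word_perm (rev is) \<circ> (simple_refl i \<circ> simple_refl i \<circ> word_perm is)"
      unfolding rev.simps word_perm_append word_perm_Cons word_perm_Nil by (simp only: o_assoc comp_id)
    then show ?case using Cons by simp
  qed simp
  from this[of "is"] this[of "rev is"] show ?thesis
    by (intro inv_unique_comp[symmetric]) auto
qed

lemma sign_simple_refl_comp:
  assumes "w permutes {1..n}"
  shows "sign (simple_refl i \<circ> w) = - sign w"
proof -
  have "permutation w" using assms by (auto simp: permutation_permutes)
  then have "sign (simple_refl i \<circ> w) = sign (simple_refl i) * sign w"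
    unfolding simple_refl_def by (intro sign_compose) (auto simp: permutation_swap_id)
  then show ?thesis by (simp add: simple_refl_def sign_swap_id)
qed

section \<open>Inversions and reduced words\<close>

definition inversions :: "nat \<Rightarrow> (nat \<Rightarrow> nat) \<Rightarrow> (nat \<times> nat) set" where
  "inversions n w = {(a, b). a \<in> {1..n} \<and> b \<in> {1..n} \<and> a < b \<and> w b < w a}"

lemma finite_inversions [simp]: "finite (inversions n w)"
  by (rule finite_subset[of _ "{1..n} \<times> {1..n}"]) (auto simp: inversions_def)

lemma simple_refl_less_iff:
  "p \<noteq> q \<Longrightarrow> {p, q} \<noteq> {i, Suc i} \<Longrightarrow> simple_refl i p < simple_refl i q \<longleftrightarrow> p < q"
  by (auto simp: simple_refl_def transpose_def)

text \<open>Left multiplication by s_i exchanges the values i and i + 1 and preserves the order of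
  every other pair of values. Hence only the pair of positions carrying these two values changes its
  status.\<close>

lemma inversions_simple_refl:
  assumes w: "w permutes {1..n}" and i: "i \<in> {1..n-1}" and less: "inv w i < inv w (Suc i)"
  shows "inversions n (simple_refl i \<circ> w) = insert (inv w i, inv w (Suc i)) (inversions n w)"
    and "(inv w i, inv w (Suc i)) \<notin> inversions n w"
proof -
  let ?a = "inv w i" and ?b = "inv w (Suc i)"
  have wa: "w ?a = i" and wb: "w ?b = Suc i" by (rule permutes_inverses(1)[OF w])+
  have mem: "?a \<in> {1..n}" "?b \<in> {1..n}"
    using i by (simp_all only: permutes_in_image[OF permutes_inv[OF w]]) auto
  show "(?a, ?b) \<notin> inversions n w" by (auto simp: inversions_def wa wb)
  have iff: "simple_refl i (w q) < simple_refl i (w p) \<longleftrightarrow> w q < w p"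
    if "p < q" "(p, q) \<noteq> (?a, ?b)" for p q
  proof (rule simple_refl_less_iff)
    show "w q \<noteq> w p" using that inj_eq[OF permutes_inj[OF w], of q p] by simp
    show "{w q, w p} \<noteq> {i, Suc i}"
    proof
      assume "{w q, w p} = {i, Suc i}"
      then have "w q = i \<and> w p = Suc i \<or> w q = Suc i \<and> w p = i" by (auto simp: doubleton_eq_iff)
      then have "inv w (w q) = ?a \<and> inv w (w p) = ?b \<or> inv w (w q) = ?b \<and> inv w (w p) = ?a"
        by (elim disjE conjE) simp_all
      then have "q = ?a \<and> p = ?b \<or> q = ?b \<and> p = ?a"
        unfolding permutes_inverses(2)[OF w] .
      with that less show False by auto
    qed
  qed
  have "(p, q) \<in> inversions n (simple_refl i \<circ> w) \<longleftrightarrow> (p, q) \<in> insert (?a, ?b) (inversions n w)" for p q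
  proof (cases "(p, q) = (?a, ?b)")
    case True
    then show ?thesis using mem less by (simp add: inversions_def wa wb)
  next
    case False
    with iff[of p q] show ?thesis by (auto simp: inversions_def)
  qed
  then show "inversions n (simple_refl i \<circ> w) = insert (?a, ?b) (inversions n w)" by auto
qed

definition perm_length :: "nat \<Rightarrow> (nat \<Rightarrow> nat) \<Rightarrow> nat" where
  "perm_length n w = card (inversions n w)"

lemma perm_length_ascent:
  assumes "w permutes {1..n}" "i \<in> {1..n-1}" "inv w i < inv w (Suc i)"
  shows "perm_length n (simple_refl i \<circ> w) = Suc (perm_length n w)"
  unfolding perm_length_def inversions_simple_refl(1)[OF assms]
  by (rule card_insert_disjoint[OF finite_inversions inversions_simple_refl(2)[OF assms]])

lemma inv_simple_refl_comp_apply: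
  assumes "w permutes {1..n}"
  shows "inv (simple_refl i \<circ> w) i = inv w (Suc i)" "inv (simple_refl i \<circ> w) (Suc i) = inv w i"
  by (simp_all add: inv_simple_refl_comp[OF assms])

lemma perm_length_descent:
  assumes "w permutes {1..n}" "i \<in> {1..n-1}" "inv w (Suc i) < inv w i"
  shows "perm_length n w = Suc (perm_length n (simple_refl i \<circ> w))"
  using perm_length_ascent[OF simple_refl_comp_permutes[OF assms(2,1)] assms(2)] assms(3)
  unfolding inv_simple_refl_comp_apply[OF assms(1)] by simp

lemma inversions_descent_subset:
  assumes "w permutes {1..n}" "i \<in> {1..n-1}" "inv w (Suc i) < inv w i"
  shows "inversions n (simple_refl i \<circ> w) \<subseteq> inversions n w"
  using inversions_simple_refl(1)[OF simple_refl_comp_permutes[OF assms(2,1)] assms(2)] assms(3)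
  unfolding inv_simple_refl_comp_apply[OF assms(1)] by auto

lemma inv_neq_inv_Suc:
  assumes "w permutes {1..n}"
  shows "inv w i \<noteq> inv w (Suc i)"
  using inj_eq[OF permutes_inj[OF permutes_inv[OF assms]], of i "Suc i"] by simp

lemma perm_length_id [simp]: "perm_length n id = 0"
proof -
  have "inversions n id = {}" by (auto simp: inversions_def)
  then show ?thesis by (simp add: perm_length_def)
qed

lemma perm_length_word_perm_le:
  "set is \<subseteq> {1..n-1} \<Longrightarrow> perm_length n (word_perm is) \<le> length is"
proof (induction "is")
  case (Cons i "is")
  then have p: "word_perm is permutes {1..n}" and i: "i \<in> {1..n-1}"
    using word_perm_permutes[of "is" n] by simp_all
  consider "inv (word_perm is) i < inv (word_perm is) (Suc i)"
    | "inv (word_perm is) (Suc i) < inv (word_perm is) i"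
    using inv_neq_inv_Suc[OF p, of i] by linarith
  then have "perm_length n (simple_refl i \<circ> word_perm is) \<le> Suc (perm_length n (word_perm is))"
    using perm_length_ascent[OF p i] perm_length_descent[OF p i] by cases linarith+
  moreover have "perm_length n (word_perm is) \<le> length is" using Cons by simp
  ultimately show ?case unfolding word_perm_Cons length_Cons by linarith
qed simp

lemma exists_descent:
  fixes f :: "nat \<Rightarrow> nat"
  assumes "a < b" "f b < f a"
  shows "\<exists>j. a \<le> j \<and> j < b \<and> f (Suc j) < f j"
proof (rule ccontr)
  assume "\<not> ?thesis"
  then have *: "f j \<le> f (Suc j)" if "a \<le> j" "j < b" for j using that by (meson not_le)
  have "f a \<le> f (a + k)" if "a + k \<le> b" for k
    using that
  proof (induction k)
    case (Suc k)
    then show ?case using *[of "a + k"] by simp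
  qed simp
  from this[of "b - a"] assms show False by simp
qed

text \<open>Both maps carry the sorted list of \<open>A\<close> to the sorted list of the common
  image.\<close>

lemma eq_on_if_strict_mono_on:
  fixes f g :: "nat \<Rightarrow> nat"
  assumes "finite A" "strict_mono_on A f" "strict_mono_on A g" "f ` A = g ` A" "x \<in> A"
  shows "f x = g x"
proof -
  have *: "map h (sorted_list_of_set A) = sorted_list_of_set (h ` A)"
    if h: "strict_mono_on A h" for h :: "nat \<Rightarrow> nat"
  proof (rule sorted_distinct_set_unique)
    show "distinct (map h (sorted_list_of_set A))"
      using assms(1) h by (simp add: distinct_map strict_mono_on_imp_inj_on)
    show "sorted (map h (sorted_list_of_set A))"
      unfolding sorted_map
      by (rule sorted_wrt_mono_rel[OF _ sorted_sorted_list_of_set])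
        (use assms(1) h in \<open>auto intro: monotone_onD[OF strict_mono_on_imp_mono_on]\<close>)
  qed (use assms(1) in auto)
  have "map f (sorted_list_of_set A) = map g (sorted_list_of_set A)"
    by (simp add: * assms)
  then show ?thesis using assms(1,5) by auto
qed

lemma strict_mono_on_if_no_inversion:
  assumes w: "w permutes {1..n}" and "\<And>a b. a \<in> A \<Longrightarrow> b \<in> A \<Longrightarrow> (a, b) \<notin> inversions n w" "A \<subseteq> {1..n}"
  shows "strict_mono_on A w"
proof (rule strict_mono_onI)
  fix a b assume "a \<in> A" "b \<in> A" "a < b"
  then have "\<not> w b < w a" using assms(2)[of a b] assms(3) by (auto simp: inversions_def)
  moreover have "w a \<noteq> w b" using \<open>a < b\<close> inj_eq[OF permutes_inj[OF w], of a b] by simp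
  ultimately show "w a < w b" by simp
qed

lemma strict_mono_permutes_eq_id:
  fixes w :: "nat \<Rightarrow> nat"
  assumes "w permutes {1..n}" "strict_mono_on {1..n} w"
  shows "w = id"
proof
  fix x :: nat
  show "w x = id x"
  proof (cases "x \<in> {1..n}")
    case True
    show ?thesis
      by (rule eq_on_if_strict_mono_on[of "{1..n}"])
        (use assms True in \<open>auto simp: permutes_image strict_mono_on_def\<close>)
  next
    case False then show ?thesis using assms by (simp add: permutes_not_in)
  qed
qed

lemma exists_left_descent:
  assumes w: "w permutes {1..n}" and "w \<noteq> id"
  shows "\<exists>i\<in>{1..n-1}. inv w (Suc i) < inv w i"
proof -
  have "\<not> strict_mono_on {1..n} (inv w)"
    using strict_mono_permutes_eq_id[OF permutes_inv[OF w]] assms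
    by (metis inv_id permutes_inv_inv)
  then obtain a b where ab: "(a, b) \<in> inversions n (inv w)"
    using strict_mono_on_if_no_inversion[OF permutes_inv[OF w], of "{1..n}"] by blast
  then obtain j where "a \<le> j" "j < b" "inv w (Suc j) < inv w j"
    using exists_descent[of a b "inv w"] by (auto simp: inversions_def)
  then show ?thesis using ab by (intro bexI[of _ j]) (auto simp: inversions_def)
qed

lemma exists_word_of_perm_length:
  assumes "w permutes {1..n}"
  shows "\<exists>is. set is \<subseteq> {1..n-1} \<and> word_perm is = w \<and> length is = perm_length n w"
  using assms
proof (induction "perm_length n w" arbitrary: w)
  case 0
  then have "w = id" using exists_left_descent perm_length_descent by (metis nat.distinct(1))
  then show ?case using 0 by (intro exI[of _ "[]"]) auto
next
  case (Suc k)
  then have "w \<noteq> id" by auto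
  then obtain i where i: "i \<in> {1..n-1}" "inv w (Suc i) < inv w i"
    using exists_left_descent Suc by blast
  then have "perm_length n (simple_refl i \<circ> w) = k"
    using perm_length_descent[OF Suc(3)] Suc(2) by auto
  then obtain "is" where "is": "set is \<subseteq> {1..n-1}" "word_perm is = simple_refl i \<circ> w" "length is = k"
    using Suc(1)[OF _ simple_refl_comp_permutes[OF i(1) Suc(3)]] by blast
  have "set (i # is) \<subseteq> {1..n-1}" "length (i # is) = perm_length n w" "word_perm (i # is) = w"
    using i(1) "is"(1,3) Suc(2) by (simp_all add: "is"(2) word_perm_Cons)
  then show ?case by (intro exI[of _ "i # is"] conjI)
qed

text \<open>Minimality over all words becomes a count: a letter changes the number of inversions by
  one, and removing left descents down to the identity attains the bound.\<close>

lemma reduced_word_iff: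
  assumes "w permutes {1..n}"
  shows "reduced_word n w is \<longleftrightarrow>
    set is \<subseteq> {1..n-1} \<and> word_perm is = w \<and> length is = perm_length n w"
proof
  assume red: "reduced_word n w is"
  then have "length is \<le> perm_length n w"
    using exists_word_of_perm_length[OF assms] unfolding reduced_word_def by metis
  then show "set is \<subseteq> {1..n-1} \<and> word_perm is = w \<and> length is = perm_length n w"
    using red perm_length_word_perm_le[of "is" n] by (auto simp: reduced_word_def)
next
  assume *: "set is \<subseteq> {1..n-1} \<and> word_perm is = w \<and> length is = perm_length n w"
  have "length is \<le> length js" if "set js \<subseteq> {1..n-1} \<and> word_perm js = w" for js
    using perm_length_word_perm_le[of js n] that * by simp
  with * show "reduced_word n w is" unfolding reduced_word_def by blast
qed

lemma exists_reduced_word: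
  "w permutes {1..n} \<Longrightarrow> \<exists>is. reduced_word n w is"
  using exists_word_of_perm_length[of w n] by (simp add: reduced_word_iff)

lemma reduced_wordD:
  assumes "reduced_word n w is"
  shows "set is \<subseteq> {1..n-1}" "word_perm is = w" "w permutes {1..n}"
  using assms word_perm_permutes[of "is" n] unfolding reduced_word_def by blast+

text \<open>The recursion behind all inductions over reduced words: the first letters of reduced
  words are left descents.\<close>

lemma reduced_word_Cons_iff:
  assumes w: "w permutes {1..n}"
  shows "reduced_word n w (i # is) \<longleftrightarrow>
    i \<in> {1..n-1} \<and> inv w (Suc i) < inv w i \<and> reduced_word n (simple_refl i \<circ> w) is"
proof (cases "i \<in> {1..n-1}")
  case i: True
  have eq: "simple_refl i \<circ> word_perm is = w \<longleftrightarrow> word_perm is = simple_refl i \<circ> w"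
    using simple_refl_cancel[of i w] simple_refl_cancel[of i "word_perm is"] by auto
  show ?thesis
  proof (cases "inv w (Suc i) < inv w i")
    case True
    show ?thesis
      unfolding reduced_word_iff[OF w] reduced_word_iff[OF simple_refl_comp_permutes[OF i w]] word_perm_Cons
      using eq perm_length_descent[OF w i True] i True by auto
  next
    case False
    then have "inv w i < inv w (Suc i)" using inv_neq_inv_Suc[OF w, of i] by simp
    from perm_length_ascent[OF w i this] have "perm_length n (simple_refl i \<circ> w) = Suc (perm_length n w)" .
    then have "\<not> reduced_word n w (i # is)"
      unfolding reduced_word_iff[OF w] using perm_length_word_perm_le[of "is" n] eq
      by (auto simp: word_perm_Cons)
    with False show ?thesis by blast
  qed
qed (auto simp: reduced_word_def)

lemma reduced_word_rev:
  assumes "reduced_word n w is"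
  shows "reduced_word n (inv w) (rev is)"
  unfolding reduced_word_def
proof (intro conjI allI impI)
  fix js assume "set js \<subseteq> {1..n-1} \<and> word_perm js = inv w"
  then have "set (rev js) \<subseteq> {1..n-1} \<and> word_perm (rev js) = w"
    using permutes_inv_inv[OF reduced_wordD(3)[OF assms]] by (simp add: word_perm_rev)
  then have "length is \<le> length (rev js)" using assms unfolding reduced_word_def by blast
  then show "length (rev is) \<le> length js" by simp
qed (use assms in \<open>auto simp: reduced_word_def word_perm_rev\<close>)

lemma exists_reduced_word_Cons:
  assumes "w permutes {1..n}" "i \<in> {1..n-1}" "inv w (Suc i) < inv w i"
  shows "\<exists>is. reduced_word n w (i # is)"
  unfolding reduced_word_Cons_iff[OF assms(1)]
  using assms(2,3) exists_reduced_word[OF simple_refl_comp_permutes[OF assms(2,1)]] by blast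

lemma exists_reduced_word_snoc:
  assumes "w permutes {1..n}" "i \<in> {1..n-1}" "w (Suc i) < w i"
  shows "\<exists>is. reduced_word n w (is @ [i])"
proof -
  have eq: "inv (inv w) = w" using assms(1) by (rule permutes_inv_inv)
  obtain "is" where "reduced_word n (inv w) (i # is)"
    using exists_reduced_word_Cons[OF permutes_inv[OF assms(1)] assms(2)] assms(3) eq by auto
  from reduced_word_rev[OF this] eq have "reduced_word n w (rev is @ [i])" by simp
  then show ?thesis ..
qed

lemma descent_simple_refl_comp:
  assumes w: "w permutes {1..n}" and "\<bar>int i - int j\<bar> \<ge> 2"
  shows "inv (simple_refl i \<circ> w) j = inv w j" "inv (simple_refl i \<circ> w) (Suc j) = inv w (Suc j)"
  unfolding inv_simple_refl_comp[OF w] using assms(2) by simp_all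

section \<open>Patterns 321 and left descents\<close>

definition has_321 :: "nat \<Rightarrow> (nat \<Rightarrow> nat) \<Rightarrow> bool" where
  "has_321 n w \<longleftrightarrow> (\<exists>a b c. (a, b) \<in> inversions n w \<and> (b, c) \<in> inversions n w)"

text \<open>Removing a left descent shrinks the inversion set, and a pattern 321 is a chain of two
  inversions.\<close>

lemma has_321_descent:
  assumes "w permutes {1..n}" "i \<in> {1..n-1}" "inv w (Suc i) < inv w i"
    and "has_321 n (simple_refl i \<circ> w)"
  shows "has_321 n w"
  using inversions_descent_subset[OF assms(1-3)] assms(4) unfolding has_321_def by blast

text \<open>The pattern read by values instead of positions, which is how left descents present
  themselves.\<close>

lemma has_321I:
  assumes "w permutes {1..n}" "x < y" "y < z" "x \<in> {1..n}" "z \<in> {1..n}"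
    "inv w z < inv w y" "inv w y < inv w x"
  shows "has_321 n w"
proof -
  have "inv w t \<in> {1..n}" if "t \<in> {1..n}" for t
    using permutes_in_image[OF permutes_inv[OF assms(1)]] that by auto
  moreover have "y \<in> {1..n}" using assms by auto
  ultimately have "(inv w z, inv w y) \<in> inversions n w \<and> (inv w y, inv w x) \<in> inversions n w"
    using assms permutes_inverses(1)[OF assms(1)] unfolding inversions_def by simp
  then show ?thesis unfolding has_321_def by blast
qed

lemma has_321E:
  assumes "w permutes {1..n}" "has_321 n w"
  obtains x y z where "x < y" "y < z" "x \<in> {1..n}" "y \<in> {1..n}" "z \<in> {1..n}"
    "inv w z < inv w y" "inv w y < inv w x"
proof -
  obtain a b c where "(a, b) \<in> inversions n w" "(b, c) \<in> inversions n w"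
    using assms(2) has_321_def by auto
  then show thesis
    using permutes_in_image[OF assms(1), of a] permutes_in_image[OF assms(1), of b]
      permutes_in_image[OF assms(1), of c]
    by (intro that[of "w c" "w b" "w a"])
      (simp_all add: inversions_def permutes_inverses(2)[OF assms(1)])
qed

text \<open>The pattern 321 is its own inverse: the values of an occurrence are the positions of one
  in the inverse permutation.\<close>

lemma has_321_inv:
  assumes "w permutes {1..n}"
  shows "has_321 n (inv w) \<longleftrightarrow> has_321 n w"
proof -
  have "has_321 n (inv w)" if *: "w permutes {1..n}" "has_321 n w" for w :: "nat \<Rightarrow> nat"
  proof -
    obtain x y z where "x < y" "y < z" "x \<in> {1..n}" "y \<in> {1..n}" "z \<in> {1..n}"
      "inv w z < inv w y" "inv w y < inv w x" by (rule has_321E[OF *])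
    then have "(x, y) \<in> inversions n (inv w)" "(y, z) \<in> inversions n (inv w)"
      by (simp_all add: inversions_def)
    then show ?thesis unfolding has_321_def by blast
  qed
  from this[OF assms] this[OF permutes_inv[OF assms]] show ?thesis
    unfolding permutes_inv_inv[OF assms] by blast
qed

text \<open>Left descents at i and i + 1 would make the values i + 2, i + 1, i appear in this order,
  a pattern 321.\<close>

lemma descents_far_apart:
  assumes w: "w permutes {1..n}" and no: "\<not> has_321 n w"
    and "i \<in> {1..n-1}" "inv w (Suc i) < inv w i" "j \<in> {1..n-1}" "inv w (Suc j) < inv w j" "i \<noteq> j"
  shows "\<bar>int i - int j\<bar> \<ge> 2"
proof (rule ccontr)
  assume "\<not> ?thesis"
  then have "j = Suc i \<or> i = Suc j" using \<open>i \<noteq> j\<close> by linarith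
  then consider "j = Suc i" | "i = Suc j" by blast
  then show False
  proof cases
    case 1
    then have "Suc (Suc i) \<in> {1..n}" "i \<in> {1..n}" using assms(3,5) by auto
    then show False using 1 assms has_321I[OF w, of i "Suc i" "Suc (Suc i)"] by simp
  next
    case 2
    then have "Suc (Suc j) \<in> {1..n}" "j \<in> {1..n}" using assms(3,5) by auto
    then show False using 2 assms has_321I[OF w, of j "Suc j" "Suc (Suc j)"] by simp
  qed
qed

section \<open>The free algebra and the Temperley-Lieb ideal\<close>

abbreviation (input) scaled_word :: "complex \<Rightarrow> nat list \<Rightarrow> free_elt" where
  "scaled_word c is \<equiv> Poly_Mapping.single (Free_Mon is) c"

lemma scaled_word_mult:
  "scaled_word c is * scaled_word d js = scaled_word (c * d) (is @ js)"
  by (simp add: mult_single plus_free_mon_def)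

lemma free_gen_mult_scaled_word: "free_gen i * scaled_word c is = scaled_word c (i # is)"
  by (simp add: free_gen_def scaled_word_mult)

lemma const_mult_scaled_word: "Poly_Mapping.single 0 c * scaled_word d is = scaled_word (c * d) is"
  by (simp add: mult_single)

lemma free_algebra_simps [simp]:
  "mult (free_algebra S) = (*)" "one (free_algebra S) = 1"
  "zero (free_algebra S) = 0" "add (free_algebra S) = (+)"
  by (simp_all add: free_algebra_def)

lemma mem_free_algebra:
  "a \<in> carrier (free_algebra S) \<longleftrightarrow> (\<forall>m\<in>Poly_Mapping.keys a. set (letters m) \<subseteq> S)"
  by (simp add: free_algebra_def)

lemma free_algebra_closed:
  assumes "a \<in> carrier (free_algebra S)" "b \<in> carrier (free_algebra S)"
  shows "a + b \<in> carrier (free_algebra S)" "a * b \<in> carrier (free_algebra S)"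
    "- a \<in> carrier (free_algebra S)" "a - b \<in> carrier (free_algebra S)"
proof -
  show "a + b \<in> carrier (free_algebra S)"
    using assms keys_add[of a b] unfolding mem_free_algebra by blast
  show "a * b \<in> carrier (free_algebra S)"
    unfolding mem_free_algebra
  proof
    fix m assume "m \<in> Poly_Mapping.keys (a * b)"
    then obtain k l where "m = k + l" "k \<in> Poly_Mapping.keys a" "l \<in> Poly_Mapping.keys b"
      using keys_mult[of a b] by blast
    then show "set (letters m) \<subseteq> S"
      using assms unfolding mem_free_algebra by (simp add: plus_free_mon_def)
  qed
  show "- a \<in> carrier (free_algebra S)"
    using assms unfolding mem_free_algebra by (simp add: in_keys_iff)
  show "a - b \<in> carrier (free_algebra S)"
    using assms keys_diff[of a b] unfolding mem_free_algebra by blast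
qed

lemma free_algebra_one_zero [simp]:
  "1 \<in> carrier (free_algebra S)" "0 \<in> carrier (free_algebra S)"
  by (simp_all add: mem_free_algebra zero_free_mon_def)

lemma const_mem_free_algebra [simp]: "Poly_Mapping.single 0 c \<in> carrier (free_algebra S)"
  by (simp add: mem_free_algebra zero_free_mon_def)

lemma scaled_word_mem_free_algebra:
  "set is \<subseteq> S \<Longrightarrow> scaled_word c is \<in> carrier (free_algebra S)"
  by (simp add: mem_free_algebra)

lemma free_gen_mem_free_algebra: "i \<in> S \<Longrightarrow> free_gen i \<in> carrier (free_algebra S)"
  by (simp add: mem_free_algebra free_gen_def)

lemma ring_free_algebra: "ring (free_algebra S)"
proof (rule ringI)
  show "abelian_group (free_algebra S)"
  proof (rule abelian_groupI)
    fix x assume "x \<in> carrier (free_algebra S)"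
    then show "\<exists>y\<in>carrier (free_algebra S). y \<oplus>\<^bsub>free_algebra S\<^esub> x = \<zero>\<^bsub>free_algebra S\<^esub>"
      using free_algebra_closed(3)[of x S x] by (intro bexI[of _ "- x"]) simp_all
  qed (simp_all add: free_algebra_closed add.assoc add.commute)
  show "monoid (free_algebra S)"
    by (rule monoidI) (simp_all add: free_algebra_closed mult.assoc)
qed (simp_all add: algebra_simps)

lemma a_inv_free_algebra:
  assumes "x \<in> carrier (free_algebra S)"
  shows "\<ominus>\<^bsub>free_algebra S\<^esub> x = - x"
proof -
  interpret ring "free_algebra S" by (rule ring_free_algebra)
  show ?thesis by (rule minus_equality) (use assms free_algebra_closed in simp_all)
qed

lemma a_minus_free_algebra:
  "y \<in> carrier (free_algebra S) \<Longrightarrow> x \<ominus>\<^bsub>free_algebra S\<^esub> y = x - y"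
  by (simp add: a_minus_def a_inv_free_algebra)

lemma TL_relations_subset: "TL_relations n \<subseteq> carrier (free_algebra {1..n-1})"
proof -
  have *: "free_gen i \<in> carrier (free_algebra {1..n-1})" if "i \<in> {1..n-1}" for i
    using that by (rule free_gen_mem_free_algebra)
  have two: "2 \<in> carrier (free_algebra {1..n-1})"
    using const_mem_free_algebra[of 2] by simp
  show ?thesis unfolding TL_relations_def
    by (auto intro!: free_algebra_closed two *)
qed

lemma ideal_TL_ideal: "ideal (TL_ideal n) (free_algebra {1..n-1})"
  unfolding TL_ideal_def by (rule ring.genideal_ideal[OF ring_free_algebra TL_relations_subset])

lemma TL_relations_in_ideal: "TL_relations n \<subseteq> TL_ideal n"
  unfolding TL_ideal_def by (rule ring.genideal_self[OF ring_free_algebra TL_relations_subset])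

lemma TL_ideal_mult_left: "a \<in> TL_ideal n \<Longrightarrow> x \<in> carrier (free_algebra {1..n-1}) \<Longrightarrow> x * a \<in> TL_ideal n"
  using ideal.I_l_closed[OF ideal_TL_ideal, of a n x] by simp

lemma TL_ideal_mult_right: "a \<in> TL_ideal n \<Longrightarrow> x \<in> carrier (free_algebra {1..n-1}) \<Longrightarrow> a * x \<in> TL_ideal n"
  using ideal.I_r_closed[OF ideal_TL_ideal, of a n x] by simp

lemma TL_ideal_add: "a \<in> TL_ideal n \<Longrightarrow> b \<in> TL_ideal n \<Longrightarrow> a + b \<in> TL_ideal n"
  using additive_subgroup.a_closed[OF ideal.axioms(1)[OF ideal_TL_ideal], of a n b] by simp

lemma TL_ideal_zero [simp]: "0 \<in> TL_ideal n"
  using additive_subgroup.zero_closed[OF ideal.axioms(1)[OF ideal_TL_ideal], of n] by simp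

lemma TL_ideal_minus:
  assumes "a \<in> TL_ideal n" shows "- a \<in> TL_ideal n"
proof -
  have "scaled_word (-1) [] * a \<in> TL_ideal n"
    by (rule TL_ideal_mult_left[OF assms scaled_word_mem_free_algebra]) simp
  moreover have "scaled_word (-1) [] = (- 1 :: free_elt)"
    unfolding zero_free_mon_def[symmetric] by (simp add: single_uminus)
  ultimately show ?thesis by simp
qed

text \<open>\<open>word_cong n is c js\<close>: the monomial of \<open>is\<close> equals \<open>c\<close> times that of \<open>js\<close> in the
  Temperley-Lieb algebra.\<close>

definition word_cong :: "nat \<Rightarrow> nat list \<Rightarrow> complex \<Rightarrow> nat list \<Rightarrow> bool" where
  "word_cong n is c js \<longleftrightarrow> scaled_word 1 is - scaled_word c js \<in> TL_ideal n"

lemma word_cong_refl [simp]: "word_cong n is 1 is"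
  by (simp add: word_cong_def)

lemma word_cong_sym: "word_cong n is 1 js \<Longrightarrow> word_cong n js 1 is"
  unfolding word_cong_def using TL_ideal_minus[of "scaled_word 1 is - scaled_word 1 js" n] by simp

lemma word_cong_trans:
  assumes "word_cong n is c js" "word_cong n js d ks"
  shows "word_cong n is (c * d) ks"
proof -
  have "(scaled_word 1 is - scaled_word c js)
      + Poly_Mapping.single 0 c * (scaled_word 1 js - scaled_word d ks) \<in> TL_ideal n"
    using assms unfolding word_cong_def by (intro TL_ideal_add TL_ideal_mult_left) simp_all
  then show ?thesis
    by (simp add: word_cong_def right_diff_distrib const_mult_scaled_word)
qed

lemma word_cong_trans1:
  "word_cong n is 1 js \<Longrightarrow> word_cong n js c ks \<Longrightarrow> word_cong n is c ks"
  using word_cong_trans[where c = 1 and d = c] by fastforce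

lemma word_cong_Cons:
  assumes "word_cong n is c js" "i \<in> {1..n-1}"
  shows "word_cong n (i # is) c (i # js)"
  using TL_ideal_mult_left[OF assms(1)[unfolded word_cong_def] free_gen_mem_free_algebra[OF assms(2)]]
  by (simp add: word_cong_def right_diff_distrib free_gen_mult_scaled_word)

lemma word_cong_append:
  assumes "word_cong n is c js" "set ks \<subseteq> {1..n-1}"
  shows "word_cong n (is @ ks) c (js @ ks)"
  using TL_ideal_mult_right[OF assms(1)[unfolded word_cong_def] scaled_word_mem_free_algebra[OF assms(2), where c = 1]]
  by (simp add: word_cong_def left_diff_distrib scaled_word_mult)

lemma word_cong_square:
  assumes "i \<in> {1..n-1}" "set is \<subseteq> {1..n-1}"
  shows "word_cong n (i # i # is) 2 (i # is)"
proof -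
  have "2 * free_gen i = scaled_word 2 [i]"
    using const_mult_scaled_word[of 2 "[i]" 1] by (simp add: free_gen_def)
  moreover have "free_gen i * free_gen i - 2 * free_gen i \<in> TL_ideal n"
    using TL_relations_in_ideal[of n] assms(1) unfolding TL_relations_def by blast
  ultimately have "word_cong n [i, i] 2 [i]"
    unfolding word_cong_def by (simp add: free_gen_def scaled_word_mult)
  from word_cong_append[OF this assms(2)] show ?thesis by simp
qed

lemma word_cong_commute:
  assumes "i \<in> {1..n-1}" "j \<in> {1..n-1}" "\<bar>int i - int j\<bar> \<ge> 2" "set is \<subseteq> {1..n-1}"
  shows "word_cong n (i # j # is) 1 (j # i # is)"
proof -
  have "free_gen i * free_gen j - free_gen j * free_gen i \<in> TL_ideal n"
    using TL_relations_in_ideal[of n] assms(1-3) unfolding TL_relations_def by blast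
  then have "word_cong n [i, j] 1 [j, i]"
    unfolding word_cong_def by (simp add: free_gen_def scaled_word_mult)
  from word_cong_append[OF this assms(4)] show ?thesis by simp
qed

lemma word_cong_braid:
  assumes "i \<in> {1..n-1}" "j \<in> {1..n-1}" "\<bar>int i - int j\<bar> = 1" "set is \<subseteq> {1..n-1}"
  shows "word_cong n (i # j # i # is) 1 (i # is)"
proof -
  have "free_gen i * free_gen j * free_gen i - free_gen i \<in> TL_ideal n"
    using TL_relations_in_ideal[of n] assms(1-3) unfolding TL_relations_def by blast
  then have "word_cong n [i, j, i] 1 [i]"
    unfolding word_cong_def by (simp add: free_gen_def scaled_word_mult)
  from word_cong_append[OF this assms(4)] show ?thesis by simp
qed

text \<open>Two distinct left descents of a \<open>321\<close>-avoiding permutation are never adjacent, so they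
  commute; both words can be compared with one starting with the two descents.\<close>

lemma word_cong_reduced_words:
  assumes "reduced_word n w is" "reduced_word n w js" "\<not> has_321 n w"
  shows "word_cong n is 1 js"
  using assms
proof (induction "length is" arbitrary: w "is" js rule: less_induct)
  case less
  have w: "w permutes {1..n}" using reduced_wordD(3)[OF less(2)] .
  have len: "length js = length is"
    using less(2,3) by (simp add: reduced_word_iff[OF w])
  show ?case
  proof (cases "is")
    case Nil
    then show ?thesis using len by simp
  next
    case (Cons i as)
    with len obtain j bs where js: "js = j # bs" by (cases js) auto
    have i: "i \<in> {1..n-1}" "inv w (Suc i) < inv w i" "reduced_word n (simple_refl i \<circ> w) as"
      using less(2) unfolding Cons reduced_word_Cons_iff[OF w] by blast+
    have j: "j \<in> {1..n-1}" "inv w (Suc j) < inv w j" "reduced_word n (simple_refl j \<circ> w) bs"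
      using less(3) unfolding js reduced_word_Cons_iff[OF w] by blast+
    have wi: "simple_refl i \<circ> w permutes {1..n}" and wj: "simple_refl j \<circ> w permutes {1..n}"
      using simple_refl_comp_permutes[OF i(1) w] simple_refl_comp_permutes[OF j(1) w] .
    have no: "\<not> has_321 n (simple_refl i \<circ> w)" "\<not> has_321 n (simple_refl j \<circ> w)"
      using less(4) has_321_descent[OF w i(1,2)] has_321_descent[OF w j(1,2)] by blast+
    show ?thesis
    proof (cases "i = j")
      case True
      have "word_cong n as 1 bs"
        using less(1)[OF _ i(3) _ no(1)] j(3) True Cons by simp
      then show ?thesis using word_cong_Cons i(1) by (simp add: Cons js True[symmetric])
    next
      case False
      have far: "\<bar>int i - int j\<bar> \<ge> 2"
        by (rule descents_far_apart[OF w less(4) i(1,2) j(1,2) False])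
      then have far': "\<bar>int j - int i\<bar> \<ge> 2" by simp
      have dj: "inv (simple_refl i \<circ> w) (Suc j) < inv (simple_refl i \<circ> w) j"
        unfolding descent_simple_refl_comp[OF w far] by (rule j(2))
      have di: "inv (simple_refl j \<circ> w) (Suc i) < inv (simple_refl j \<circ> w) i"
        unfolding descent_simple_refl_comp[OF w far'] by (rule i(2))
      obtain cs where cs: "reduced_word n (simple_refl i \<circ> w) (j # cs)"
        using exists_reduced_word_Cons[OF wi j(1) dj] ..
      then have red: "reduced_word n (simple_refl j \<circ> (simple_refl i \<circ> w)) cs"
        unfolding reduced_word_Cons_iff[OF wi] by blast
      moreover have "simple_refl j \<circ> (simple_refl i \<circ> w) = simple_refl i \<circ> (simple_refl j \<circ> w)"
        unfolding o_assoc simple_refl_commute[OF far] ..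
      ultimately have cs': "reduced_word n (simple_refl j \<circ> w) (i # cs)"
        unfolding reduced_word_Cons_iff[OF wj] using i(1) di by simp
      have set: "set cs \<subseteq> {1..n-1}" using reduced_wordD(1)[OF red] .
      have "word_cong n as 1 (j # cs)"
        using less(1)[OF _ i(3) cs no(1)] Cons by simp
      then have 1: "word_cong n (i # as) 1 (i # j # cs)" by (rule word_cong_Cons[OF _ i(1)])
      have "length bs < length is" using len js by simp
      then have "word_cong n bs 1 (i # cs)"
        using less(1)[OF _ j(3) cs' no(2)] by simp
      then have "word_cong n (j # bs) 1 (j # i # cs)" by (rule word_cong_Cons[OF _ j(1)])
      then have 2: "word_cong n (j # i # cs) 1 (j # bs)" by (rule word_cong_sym)
      have "word_cong n (i # j # cs) 1 (j # i # cs)"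
        by (rule word_cong_commute[OF i(1) j(1) far set])
      from word_cong_trans1[OF 1 word_cong_trans1[OF this 2]] show ?thesis
        by (simp add: Cons js)
    qed
  qed
qed

text \<open>The assumption \<open>bad\<close> is the trace left in \<open>w\<close> by a pattern \<open>321\<close> of \<open>s\<^sub>i w\<close>. Left descents
  of \<open>w\<close> that commute with \<open>s\<^sub>i\<close> are peeled off until \<open>t\<^sub>i t\<^sub>j t\<^sub>i = t\<^sub>i\<close> applies.\<close>

lemma word_cong_shorten:
  assumes w: "w permutes {1..n}" and no: "\<not> has_321 n w" and red: "reduced_word n w is"
    and i: "i \<in> {1..n-1}" and asc: "inv w i < inv w (Suc i)"
    and bad: "(\<exists>c\<in>{1..n}. Suc i < c \<and> inv w c < inv w i) \<or> (\<exists>c\<in>{1..n}. c < i \<and> inv w (Suc i) < inv w c)"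
  shows "\<exists>js. set js \<subseteq> {1..n-1} \<and> length js \<le> length is \<and> word_cong n (i # is) 1 js"
  using assms
proof (induction "length is" arbitrary: w "is" rule: less_induct)
  case less
  note w = less(2) and no = less(3) and red = less(4) and i = less(5) and asc = less(6)
  have peel: ?case
    if j: "j \<in> {1..n-1}" "inv w (Suc j) < inv w j" and far: "\<bar>int i - int j\<bar> \<ge> 2"
      and bad: "let w' = simple_refl j \<circ> w in (\<exists>c\<in>{1..n}. Suc i < c \<and> inv w' c < inv w' i) \<or>
        (\<exists>c\<in>{1..n}. c < i \<and> inv w' (Suc i) < inv w' c)"
    for j
  proof -
    have far': "\<bar>int j - int i\<bar> \<ge> 2" using far by simp
    obtain as where as: "reduced_word n w (j # as)" using exists_reduced_word_Cons[OF w j] ..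
    then have red': "reduced_word n (simple_refl j \<circ> w) as"
      unfolding reduced_word_Cons_iff[OF w] by blast
    have len: "length is = Suc (length as)"
      using red as by (simp add: reduced_word_iff[OF w])
    have "\<exists>js. set js \<subseteq> {1..n-1} \<and> length js \<le> length as \<and> word_cong n (i # as) 1 js"
    proof (rule less(1)[OF _ simple_refl_comp_permutes[OF j(1) w] _ red' i])
      show "length as < length is" using len by simp
      show "\<not> has_321 n (simple_refl j \<circ> w)" using no has_321_descent[OF w j] by blast
      show "inv (simple_refl j \<circ> w) i < inv (simple_refl j \<circ> w) (Suc i)"
        unfolding descent_simple_refl_comp[OF w far'] by (rule asc)
    qed (use bad in \<open>unfold Let_def\<close>)
    then obtain js where js: "set js \<subseteq> {1..n-1}" "length js \<le> length as" "word_cong n (i # as) 1 js"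
      by blast
    have "word_cong n is 1 (j # as)" by (rule word_cong_reduced_words[OF red as no])
    then have 1: "word_cong n (i # is) 1 (i # j # as)" by (rule word_cong_Cons[OF _ i])
    have 2: "word_cong n (i # j # as) 1 (j # i # as)"
      by (rule word_cong_commute[OF i j(1) far reduced_wordD(1)[OF red']])
    have "word_cong n (i # is) 1 (j # js)"
      by (rule word_cong_trans1[OF word_cong_trans1[OF 1 2] word_cong_Cons[OF js(3) j(1)]])
    then show ?thesis using js j(1) len by (intro exI[of _ "j # js"]) simp
  qed
  \<comment> \<open>If i becomes a left descent after s_j is removed, \<open>w\<close> has a reduced
    word starting with j, i, and the prefixed letter i completes t_i t_j t_i.\<close>
  have contract: ?case
    if j: "j \<in> {1..n-1}" "\<bar>int i - int j\<bar> = 1" "inv w (Suc j) < inv w j"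
      and desc: "inv (simple_refl j \<circ> w) (Suc i) < inv (simple_refl j \<circ> w) i" for j
  proof -
    have w': "simple_refl j \<circ> w permutes {1..n}" by (rule simple_refl_comp_permutes[OF j(1) w])
    obtain as where as: "reduced_word n (simple_refl j \<circ> w) (i # as)"
      using exists_reduced_word_Cons[OF w' i desc] ..
    then have set: "set as \<subseteq> {1..n-1}" unfolding reduced_word_def by simp
    have red': "reduced_word n w (j # i # as)"
      unfolding reduced_word_Cons_iff[OF w] using j as by blast
    then have len: "length is = Suc (Suc (length as))"
      using red by (simp add: reduced_word_iff[OF w])
    have "word_cong n is 1 (j # i # as)" by (rule word_cong_reduced_words[OF red red' no])
    then have "word_cong n (i # is) 1 (i # j # i # as)" by (rule word_cong_Cons[OF _ i])
    from word_cong_trans1[OF this word_cong_braid[OF i j(1,2) set]]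
    show ?thesis using set i len by (intro exI[of _ "i # as"]) simp
  qed
  from less(7) consider
      c where "c \<in> {1..n}" "Suc i < c" "inv w c < inv w i"
    | c where "c \<in> {1..n}" "c < i" "inv w (Suc i) < inv w c" by blast
  then show ?case
  proof cases
    case 1
    show ?thesis
    \<comment> \<open>If i + 2 already precedes i, contract with j = i + 1. Otherwise c lies beyond
      i + 2 but precedes it in position, so there is a left descent j \<ge> i + 2, which commutes
      with s_i.\<close>
    proof (cases "inv w (Suc (Suc i)) < inv w i")
      case True
      have j: "Suc i \<in> {1..n-1}" using 1(1,2) by auto
      show ?thesis
      proof (rule contract[OF j])
        show "inv w (Suc (Suc i)) < inv w (Suc i)" using True asc by simp
        show "inv (simple_refl (Suc i) \<circ> w) (Suc i) < inv (simple_refl (Suc i) \<circ> w) i"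
          unfolding inv_simple_refl_comp[OF w] using True by simp
      qed simp
    next
      case False
      then have "c \<noteq> Suc (Suc i)" using 1(3) by auto
      then have "Suc (Suc i) < c" using 1(2) by simp
      moreover have "inv w c < inv w (Suc (Suc i))" using False 1(3) by simp
      ultimately obtain j where j: "Suc (Suc i) \<le> j" "j < c" "inv w (Suc j) < inv w j"
        using exists_descent[of "Suc (Suc i)" c "inv w"] by blast
      have jn: "j \<in> {1..n-1}" using j(1,2) 1(1) by auto
      \<comment> \<open>Removing s_j may move the witness c: if c = j + 1, it becomes j, which is
        still beyond i + 1.\<close>
      define d where "d = simple_refl j c"
      have d: "Suc i < d" "d \<in> {1..n}"
        using j(1,2) 1(1,2) by (auto simp: d_def simple_refl_def transpose_def)
      have "simple_refl j d = c" by (simp add: d_def simple_refl_def)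
      then have "inv (simple_refl j \<circ> w) d < inv (simple_refl j \<circ> w) i"
        unfolding inv_simple_refl_comp[OF w] using j(1) 1(3) by simp
      then show ?thesis using d j(1) by (intro peel[OF jn j(3)]) (auto simp: Let_def)
    qed
  next
    case 2
    then obtain h where h: "i = Suc h" by (cases i) auto
    show ?thesis
    proof (cases "inv w (Suc i) < inv w h")
      case True
      have j: "h \<in> {1..n-1}" using 2(1,2) i h by auto
      show ?thesis
      proof (rule contract[OF j])
        show "inv w (Suc h) < inv w h" using True asc h by simp
        show "inv (simple_refl h \<circ> w) (Suc i) < inv (simple_refl h \<circ> w) i"
          unfolding inv_simple_refl_comp[OF w] using True h by simp
      qed (use h in simp)
    next
      case False
      then have "c \<noteq> h" using 2(3) by auto
      then have "c < h" using 2(2) h by simp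
      moreover have "inv w h < inv w c" using False 2(3) by simp
      ultimately obtain j where j: "c \<le> j" "j < h" "inv w (Suc j) < inv w j"
        using exists_descent[of c h "inv w"] by blast
      have jn: "j \<in> {1..n-1}" using j(1,2) 2(1) i h by auto
      define d where "d = simple_refl j c"
      have d: "d < i" "d \<in> {1..n}"
        using j(1,2) 2(1,2) h i by (auto simp: d_def simple_refl_def transpose_def)
      have "simple_refl j d = c" by (simp add: d_def simple_refl_def)
      then have "inv (simple_refl j \<circ> w) (Suc i) < inv (simple_refl j \<circ> w) d"
        unfolding inv_simple_refl_comp[OF w] using j(2) h 2(3) by simp
      then show ?thesis using d j(2) h by (intro peel[OF jn j(3)]) (auto simp: Let_def)
    qed
  qed
qed

text \<open>A newly created pattern 321 must use the only new inversion, the one between the values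
  i and i + 1; its other link provides \<open>c\<close>. This establishes the assumption
  \<open>bad\<close> of \<open>word_cong_shorten\<close>.\<close>

lemma has_321_simple_refl_comp:
  assumes w: "w permutes {1..n}" and i: "i \<in> {1..n-1}" and asc: "inv w i < inv w (Suc i)"
    and no: "\<not> has_321 n w" and has: "has_321 n (simple_refl i \<circ> w)"
  shows "(\<exists>c\<in>{1..n}. Suc i < c \<and> inv w c < inv w i) \<or> (\<exists>c\<in>{1..n}. c < i \<and> inv w (Suc i) < inv w c)"
proof -
  let ?a = "inv w i" and ?b = "inv w (Suc i)"
  have wa: "w ?a = i" and wb: "w ?b = Suc i" by (rule permutes_inverses(1)[OF w])+
  have ab: "?a \<in> {1..n}" "?b \<in> {1..n}"
    using i by (simp_all only: permutes_in_image[OF permutes_inv[OF w]]) auto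
  have inv_w: "inv w (w x) = x" for x by (rule permutes_inverses(2)[OF w])
  have wn: "w x \<in> {1..n}" if "x \<in> {1..n}" for x using that by (simp only: permutes_in_image[OF w])
  obtain p q r where pqr: "(p, q) \<in> insert (?a, ?b) (inversions n w)" "(q, r) \<in> insert (?a, ?b) (inversions n w)"
    using has unfolding has_321_def inversions_simple_refl(1)[OF w i asc] by blast
  have "\<not> ((p, q) \<in> inversions n w \<and> (q, r) \<in> inversions n w)"
    using no unfolding has_321_def by blast
  then consider "(p, q) = (?a, ?b)" "(q, r) \<in> inversions n w"
    | "(p, q) \<in> inversions n w" "(q, r) = (?a, ?b)"
    using pqr asc by auto
  then show ?thesis
  proof cases
    case 1
    then have r: "r \<in> {1..n}" "?b < r" "w r < Suc i" by (auto simp: inversions_def wb)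
    have "w r \<noteq> i" using r(2) asc inv_w[of r] by auto
    then have "w r < i" "inv w (Suc i) < inv w (w r)" using r inv_w[of r] by auto
    then show ?thesis using wn[OF r(1)] by blast
  next
    case 2
    then have p: "p \<in> {1..n}" "p < ?a" "i < w p" by (auto simp: inversions_def wa)
    have "w p \<noteq> Suc i" using p(2) asc inv_w[of p] by auto
    then have "Suc i < w p" "inv w (w p) < inv w i" using p inv_w[of p] by auto
    then show ?thesis using wn[OF p(1)] by blast
  qed
qed

text \<open>By induction the tail of the word is a multiple of some \<beta>(w). Multiplying by t_i
  extends a reduced word, or meets a left descent and yields a factor 2, or creates a pattern 321
  and allows shortening. In the last two cases the new word is shorter than the given one and the
  induction hypothesis applies again.\<close>

lemma word_cong_321_avoiding:
  assumes "set is \<subseteq> {1..n-1}"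
  shows "\<exists>c w js. \<not> has_321 n w \<and> reduced_word n w js \<and> length js \<le> length is \<and> word_cong n is c js"
  using assms
proof (induction "length is" arbitrary: "is" rule: less_induct)
  case less
  show ?case
  proof (cases "is")
    case Nil
    have "\<not> has_321 n id" by (auto simp: has_321_def inversions_def)
    moreover have "reduced_word n id []" by (auto simp: reduced_word_def)
    ultimately show ?thesis unfolding Nil by (intro exI[of _ 1] exI[of _ id] exI[of _ "[]"]) simp
  next
    case (Cons i as)
    have i: "i \<in> {1..n-1}" and as: "set as \<subseteq> {1..n-1}" using less(2) Cons by simp_all
    obtain c w bs where w: "\<not> has_321 n w" "reduced_word n w bs" "length bs \<le> length as" "word_cong n as c bs"
      using less(1)[OF _ as] Cons by auto
    have perm: "w permutes {1..n}" and bs: "set bs \<subseteq> {1..n-1}"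
      using reduced_wordD[OF w(2)] by blast+
    have 1: "word_cong n is c (i # bs)" unfolding Cons by (rule word_cong_Cons[OF w(4) i])
    have shorter: ?thesis if js: "set js \<subseteq> {1..n-1}" "length js < length is" "word_cong n (i # bs) d js" for js d
    proof -
      obtain e v ks where "\<not> has_321 n v" "reduced_word n v ks" "length ks \<le> length js" "word_cong n js e ks"
        using less(1)[OF js(2,1)] by blast
      moreover from this(4) have "word_cong n is (c * (d * e)) ks"
        by (intro word_cong_trans[OF 1] word_cong_trans[OF js(3)])
      moreover have "length ks \<le> length is" using calculation(3) js(2) by simp
      ultimately show ?thesis by blast
    qed
    show ?thesis
    proof (cases "inv w i < inv w (Suc i)")
      case asc: True
      show ?thesis
      proof (cases "has_321 n (simple_refl i \<circ> w)")
        case True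
        obtain js where "set js \<subseteq> {1..n-1}" "length js \<le> length bs" "word_cong n (i # bs) 1 js"
          using word_cong_shorten[OF perm w(1,2) i asc has_321_simple_refl_comp[OF perm i asc w(1) True]]
          by blast
        then show ?thesis using shorter w(3) Cons by simp
      next
        case False
        have "reduced_word n (simple_refl i \<circ> w) (i # bs)"
          unfolding reduced_word_Cons_iff[OF simple_refl_comp_permutes[OF i perm]]
            inv_simple_refl_comp_apply[OF perm] simple_refl_cancel
          using i asc w(2) by blast
        moreover have "length (i # bs) \<le> length is" using w(3) Cons by simp
        ultimately show ?thesis using 1 False by blast
      qed
    next
      case False
      then have "inv w (Suc i) < inv w i" using inv_neq_inv_Suc[OF perm, of i] by simp
      then obtain cs where cs: "reduced_word n w (i # cs)" using exists_reduced_word_Cons[OF perm i] by blast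
      have set: "set (i # cs) \<subseteq> {1..n-1}" by (rule reduced_wordD(1)[OF cs])
      have len: "length (i # cs) = length bs"
        using cs w(2) by (simp add: reduced_word_iff[OF perm])
      have "word_cong n bs 1 (i # cs)" by (rule word_cong_reduced_words[OF w(2) cs w(1)])
      then have "word_cong n (i # bs) 1 (i # i # cs)" by (rule word_cong_Cons[OF _ i])
      moreover have "word_cong n (i # i # cs) 2 (i # cs)" using set i by (intro word_cong_square) simp_all
      ultimately have "word_cong n (i # bs) 2 (i # cs)" by (rule word_cong_trans1)
      then show ?thesis using shorter[OF set] w(3) Cons len by simp
    qed
  qed
qed

section \<open>Functions dual to the Temperley-Lieb algebra\<close>

text \<open>Since t_i is the image of 1 + s_i, a product of generators expands into one term for
  each choice of letters. Equal subwords chosen at different places are listed separately by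
  \<open>subseqs\<close>, as this expansion requires.\<close>

definition word_eval :: "((nat \<Rightarrow> nat) \<Rightarrow> complex) \<Rightarrow> nat list \<Rightarrow> complex" where
  "word_eval g is = (\<Sum>r\<leftarrow>subseqs is. g (word_perm r))"

lemma word_eval_Nil [simp]: "word_eval g [] = g id"
  by (simp add: word_eval_def)

lemma word_eval_Cons:
  "word_eval g (i # is) = word_eval (\<lambda>u. g u + g (simple_refl i \<circ> u)) is"
  by (simp add: word_eval_def Let_def sum_list_addf word_perm_Cons comp_def[of _ "Cons i"] add.commute)

text \<open>The action on \<open>g\<close> of the product of the factors 1 + s_i. It converts
  evaluation on a concatenation into evaluation on one of its two factors.\<close>

definition left_smear :: "nat list \<Rightarrow> ((nat \<Rightarrow> nat) \<Rightarrow> complex) \<Rightarrow> (nat \<Rightarrow> nat) \<Rightarrow> complex" where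
  "left_smear is g = (\<lambda>u. \<Sum>r\<leftarrow>subseqs is. g (word_perm r \<circ> u))"

definition right_smear :: "nat list \<Rightarrow> ((nat \<Rightarrow> nat) \<Rightarrow> complex) \<Rightarrow> (nat \<Rightarrow> nat) \<Rightarrow> complex" where
  "right_smear is g = (\<lambda>u. \<Sum>r\<leftarrow>subseqs is. g (u \<circ> word_perm r))"

lemma word_eval_append_left: "word_eval g (is @ js) = word_eval (left_smear is g) js"
proof (induction "is" arbitrary: g)
  case Nil
  then show ?case by (simp add: left_smear_def)
next
  case (Cons i "is")
  have "left_smear is (\<lambda>u. g u + g (simple_refl i \<circ> u)) = left_smear (i # is) g"
    by (simp add: left_smear_def Let_def sum_list_addf word_perm_Cons comp_def[of _ "Cons i"]
        add.commute comp_assoc)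
  then show ?case using Cons by (simp add: word_eval_Cons)
qed

lemma word_eval_append_right: "word_eval g (is @ js) = word_eval (right_smear js g) is"
proof (induction "is" arbitrary: g)
  case Nil
  then show ?case by (simp add: right_smear_def word_eval_def)
next
  case (Cons i "is")
  have "right_smear js (\<lambda>u. g u + g (simple_refl i \<circ> u))
      = (\<lambda>u. right_smear js g u + right_smear js g (simple_refl i \<circ> u))"
    by (simp add: right_smear_def sum_list_addf comp_assoc)
  then show ?case using Cons by (simp add: word_eval_Cons)
qed

text \<open>The functions on the symmetric group whose linear extension kills the two-sided ideal
  generated by the symmetrizers of three letters, which is the kernel of \<open>\<theta>\<close>.\<close>

definition TL_functions :: "nat \<Rightarrow> ((nat \<Rightarrow> nat) \<Rightarrow> complex) set" where
  "TL_functions n = {g. \<forall>T a b. T \<subseteq> {1..n} \<and> card T = 3 \<and> a permutes {1..n} \<and> b permutes {1..n} \<longrightarrow>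
     (\<Sum>v | v permutes T. g (a \<circ> v \<circ> b)) = 0}"

lemma TL_functionsI:
  assumes "\<And>T a b. T \<subseteq> {1..n} \<Longrightarrow> card T = 3 \<Longrightarrow> a permutes {1..n} \<Longrightarrow> b permutes {1..n} \<Longrightarrow>
    (\<Sum>v | v permutes T. g (a \<circ> v \<circ> b)) = 0"
  shows "g \<in> TL_functions n"
  using assms unfolding TL_functions_def by blast

lemma TL_functionsD:
  assumes "g \<in> TL_functions n" "T \<subseteq> {1..n}" "card T = 3" "a permutes {1..n}" "b permutes {1..n}"
  shows "(\<Sum>v | v permutes T. g (a \<circ> v \<circ> b)) = 0"
  using assms unfolding TL_functions_def by blast

lemma TL_functions_left:
  assumes "g \<in> TL_functions n" "c permutes {1..n}"
  shows "(\<lambda>u. g (c \<circ> u)) \<in> TL_functions n"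
proof (rule TL_functionsI)
  fix T and a b :: "nat \<Rightarrow> nat"
  assume *: "T \<subseteq> {1..n}" "card T = 3" "a permutes {1..n}" "b permutes {1..n}"
  show "(\<Sum>v | v permutes T. g (c \<circ> (a \<circ> v \<circ> b))) = 0"
    using TL_functionsD[OF assms(1) *(1,2) permutes_compose[OF *(3) assms(2)] *(4)]
    by (simp add: comp_assoc)
qed

lemma TL_functions_right:
  assumes "g \<in> TL_functions n" "c permutes {1..n}"
  shows "(\<lambda>u. g (u \<circ> c)) \<in> TL_functions n"
proof (rule TL_functionsI)
  fix T and a b :: "nat \<Rightarrow> nat"
  assume *: "T \<subseteq> {1..n}" "card T = 3" "a permutes {1..n}" "b permutes {1..n}"
  show "(\<Sum>v | v permutes T. g (a \<circ> v \<circ> b \<circ> c)) = 0"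
    using TL_functionsD[OF assms(1) *(1,2,3) permutes_compose[OF assms(2) *(4)]]
    by (simp add: comp_assoc)
qed

lemma TL_functions_sum_list:
  assumes "\<And>r. r \<in> set L \<Longrightarrow> h r \<in> TL_functions n"
  shows "(\<lambda>u. \<Sum>r\<leftarrow>L. h r u) \<in> TL_functions n"
proof (rule TL_functionsI)
  fix T and a b :: "nat \<Rightarrow> nat"
  assume *: "T \<subseteq> {1..n}" "card T = 3" "a permutes {1..n}" "b permutes {1..n}"
  show "(\<Sum>v | v permutes T. \<Sum>r\<leftarrow>L. h r (a \<circ> v \<circ> b)) = 0"
    using assms
  proof (induction L)
    case (Cons r L)
    have "(\<Sum>v | v permutes T. h r (a \<circ> v \<circ> b)) = 0"
      by (rule TL_functionsD[OF Cons(2) *]) simp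
    then show ?case using Cons by (simp add: sum.distrib del: comp_apply)
  qed simp
qed

lemma set_subseqs_subset: "r \<in> set (subseqs is) \<Longrightarrow> set r \<subseteq> set is"
  using subseqs_powset[of "is"] by blast

lemma word_perm_subseqs_permutes:
  "set is \<subseteq> {1..n-1} \<Longrightarrow> r \<in> set (subseqs is) \<Longrightarrow> word_perm r permutes {1..n}"
  by (rule word_perm_permutes) (use set_subseqs_subset[of r "is"] in blast)

lemma left_smear_TL_functions:
  assumes "g \<in> TL_functions n" "set is \<subseteq> {1..n-1}"
  shows "left_smear is g \<in> TL_functions n"
  unfolding left_smear_def
  by (intro TL_functions_sum_list TL_functions_left assms(1) word_perm_subseqs_permutes[OF assms(2)])

lemma right_smear_TL_functions:
  assumes "g \<in> TL_functions n" "set is \<subseteq> {1..n-1}"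
  shows "right_smear is g \<in> TL_functions n"
  unfolding right_smear_def
  by (intro TL_functions_sum_list TL_functions_right assms(1) word_perm_subseqs_permutes[OF assms(2)])

text \<open>Inversion exchanges the outer factors \<open>a\<close> and \<open>b\<close>, up to
  inverses, and only permutes the summands of the symmetrizer. This is what later reduces one case
  of the theorem to the inverse permutation.\<close>

lemma TL_functions_inv:
  assumes "g \<in> TL_functions n"
  shows "(\<lambda>u. g (inv u)) \<in> TL_functions n"
proof (rule TL_functionsI)
  fix T and a b :: "nat \<Rightarrow> nat"
  assume *: "T \<subseteq> {1..n}" "card T = 3" "a permutes {1..n}" "b permutes {1..n}"
  have eq: "g (inv (a \<circ> inv v \<circ> b)) = g (inv b \<circ> v \<circ> inv a)" if v: "v permutes T" for v
  proof -
    have "bij a" "bij b" "bij (inv v)" "bij v"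
      using *(3,4) v permutes_bij permutes_inv[OF v] by blast+
    then have "inv (a \<circ> inv v \<circ> b) = inv b \<circ> inv (inv v) \<circ> inv a"
      by (simp add: o_inv_distrib bij_comp comp_assoc)
    then show ?thesis by (simp add: permutes_inv_inv[OF v])
  qed
  have "(\<Sum>v | v permutes T. g (inv (a \<circ> v \<circ> b))) = (\<Sum>v | v permutes T. g (inv (a \<circ> inv v \<circ> b)))"
    by (rule sum_permutations_inverse)
  also have "\<dots> = (\<Sum>v | v permutes T. g (inv b \<circ> v \<circ> inv a))"
    by (rule sum.cong) (simp_all add: eq)
  also have "\<dots> = 0"
    by (rule TL_functionsD[OF assms *(1,2) permutes_inv[OF *(4)] permutes_inv[OF *(3)]])
  finally show "(\<Sum>v | v permutes T. g (inv (a \<circ> v \<circ> b))) = 0" .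
qed

text \<open>Two of any three positions have the same colour, and exchanging them flips the sign.\<close>

lemma sign_coloured_TL_functions:
  "(\<lambda>u. of_int (sign u) * (if P (u ` J) then 1 else 0)) \<in> TL_functions n"
proof (rule TL_functionsI)
  fix T and a b :: "nat \<Rightarrow> nat"
  assume T: "T \<subseteq> {1..n}" "card T = 3" and a: "a permutes {1..n}" and b: "b permutes {1..n}"
  define h :: "(nat \<Rightarrow> nat) \<Rightarrow> complex"
    where "h = (\<lambda>v. of_int (sign (a \<circ> v \<circ> b)) * (if P ((a \<circ> v \<circ> b) ` J) then 1 else 0))"
  obtain p q r where pqr: "T = {p, q, r}" "p \<noteq> q" "q \<noteq> r" "p \<noteq> r"
    using T(2) by (auto simp: card_3_iff)
  have "\<exists>x\<in>T. \<exists>y\<in>T. x \<noteq> y \<and> (x \<in> b ` J \<longleftrightarrow> y \<in> b ` J)"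
    using pqr by blast
  then obtain x y where xy: "x \<in> T" "y \<in> T" "x \<noteq> y" "x \<in> b ` J \<longleftrightarrow> y \<in> b ` J" by blast
  define t where "t = transpose x y"
  have t: "t permutes T" using xy(1,2) unfolding t_def by (rule permutes_swap_id)
  have tn: "t permutes {1..n}" using permutes_subset[OF t T(1)] .
  have img: "t ` (b ` J) = b ` J"
  proof -
    show ?thesis unfolding t_def by (rule transpose_image_eq[OF xy(4)])
  qed
  have neg: "h (v \<circ> t) = - h v" if v: "v permutes T" for v
  proof -
    have vn: "v permutes {1..n}" using permutes_subset[OF v T(1)] .
    have perm: "permutation a" "permutation b" "permutation v" "permutation t"
      by (rule permutes_imp_permutation[OF finite_atLeastAtMost], fact)+
    have "sign (a \<circ> (v \<circ> t) \<circ> b) = - sign (a \<circ> v \<circ> b)"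
      using perm xy(3) by (simp add: sign_compose permutation_compose t_def sign_swap_id)
    moreover have "(a \<circ> (v \<circ> t) \<circ> b) ` J = (a \<circ> v \<circ> b) ` J"
      unfolding image_comp[symmetric] img ..
    ultimately show ?thesis unfolding h_def by simp
  qed
  have "sum h {v. v permutes T} = (\<Sum>v | v permutes T. h (v \<circ> t))"
    by (rule sum_permutations_compose_right[OF t])
  also have "\<dots> = - sum h {v. v permutes T}"
    by (simp add: neg sum_negf)
  finally have "sum h {v. v permutes T} = 0" by simp
  then show "(\<Sum>v | v permutes T. of_int (sign (a \<circ> v \<circ> b)) * (if P ((a \<circ> v \<circ> b) ` J) then 1 else 0)) = (0::complex)"
    unfolding h_def .
qed

lemma sum_permutes_three:
  fixes f :: "(nat \<Rightarrow> nat) \<Rightarrow> 'a::comm_monoid_add"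
  assumes "x \<noteq> y" "y \<noteq> z" "x \<noteq> z"
  shows "(\<Sum>v | v permutes {x, y, z}. f v) =
    f id + f (transpose y z) + (f (transpose x y) + f (transpose x y \<circ> transpose y z)
      + (f (transpose x z) + f (transpose x z \<circ> transpose y z)))"
proof -
  have 1: "(\<Sum>v | v permutes {z}. h v) = h id" for h :: "(nat \<Rightarrow> nat) \<Rightarrow> 'a"
    by simp
  have 2: "(\<Sum>v | v permutes {y, z}. h v) = h id + h (transpose y z)" for h :: "(nat \<Rightarrow> nat) \<Rightarrow> 'a"
    using assms by (subst sum_over_permutations_insert) (simp_all add: 1)
  show ?thesis
    using assms by (subst sum_over_permutations_insert) (simp_all add: 2)
qed

text \<open>Expanding (1 + s_i)(1 + s_j)(1 + s_i) and subtracting 1 + s_i leaves exactly the six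
  permutations of the three letters moved by s_i and s_j.\<close>

lemma TL_functions_relation:
  assumes "g \<in> TL_functions n" "i \<in> {1..n-1}" "j \<in> {1..n-1}" "\<bar>int i - int j\<bar> = 1"
  shows "word_eval g [i, j, i] = word_eval g [i]"
proof -
  have *: "word_eval g [i, j, i] = word_eval g [i]"
    if ij: "i = k \<and> j = Suc k \<or> i = Suc k \<and> j = k" and k: "k \<ge> 1" "Suc (Suc k) \<le> n" for k
  proof -
    have sub: "{k, Suc k, Suc (Suc k)} \<subseteq> {1..n}" using k by auto
    have "0 = (\<Sum>v | v permutes {k, Suc k, Suc (Suc k)}. g (id \<circ> v \<circ> id))"
      by (rule TL_functionsD[OF assms(1) sub _ permutes_id permutes_id, symmetric]) simp
    also have "\<dots> = g id + g (simple_refl (Suc k)) + (g (simple_refl k) + g (simple_refl k \<circ> simple_refl (Suc k))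
        + (g (transpose k (Suc (Suc k))) + g (transpose k (Suc (Suc k)) \<circ> simple_refl (Suc k))))"
      by (subst sum_permutes_three) (simp_all add: simple_refl_def)
    also have "transpose k (Suc (Suc k)) = simple_refl k \<circ> (simple_refl (Suc k) \<circ> simple_refl k)"
      by (auto simp: fun_eq_iff simple_refl_def transpose_def)
    also have "simple_refl k \<circ> (simple_refl (Suc k) \<circ> simple_refl k) \<circ> simple_refl (Suc k)
        = simple_refl (Suc k) \<circ> simple_refl k"
      by (auto simp: fun_eq_iff simple_refl_def transpose_def)
    finally have sum: "g id + g (simple_refl (Suc k)) + (g (simple_refl k) + g (simple_refl k \<circ> simple_refl (Suc k))
        + (g (simple_refl k \<circ> (simple_refl (Suc k) \<circ> simple_refl k)) + g (simple_refl (Suc k) \<circ> simple_refl k))) = 0" ..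
    have braid: "simple_refl k \<circ> (simple_refl (Suc k) \<circ> simple_refl k) = simple_refl (Suc k) \<circ> (simple_refl k \<circ> simple_refl (Suc k))"
      using simple_refl_braid[of k "Suc k"] by (simp add: comp_assoc)
    from ij consider "i = k" "j = Suc k" | "i = Suc k" "j = k" by blast
    then show ?thesis
    proof cases
      case 1
      then show ?thesis using sum by (simp add: word_eval_Cons algebra_simps)
    next
      case 2
      then show ?thesis using sum unfolding braid by (simp add: word_eval_Cons algebra_simps)
    qed
  qed
  have "j = Suc i \<or> i = Suc j" using assms(4) by linarith
  then consider "j = Suc i" | "i = Suc j" by blast
  then show ?thesis
  proof cases
    case 1
    show ?thesis by (rule *[of i]) (use 1 assms(2,3) in auto)
  next
    case 2
    show ?thesis by (rule *[of j]) (use 2 assms(2,3) in auto)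
  qed
qed

section \<open>Linear functionals on the free algebra and their common kernel\<close>

definition free_eval :: "((nat \<Rightarrow> nat) \<Rightarrow> complex) \<Rightarrow> free_elt \<Rightarrow> complex" where
  "free_eval g x = (\<Sum>m\<in>Poly_Mapping.keys x. Poly_Mapping.lookup x m * word_eval g (letters m))"

lemma free_eval_superset:
  assumes "finite A" "Poly_Mapping.keys x \<subseteq> A"
  shows "free_eval g x = (\<Sum>m\<in>A. Poly_Mapping.lookup x m * word_eval g (letters m))"
  unfolding free_eval_def
  by (rule sum.mono_neutral_left[OF assms]) (simp add: in_keys_iff)

lemma free_eval_zero [simp]: "free_eval g 0 = 0"
  by (simp add: free_eval_def)

lemma free_eval_add: "free_eval g (x + y) = free_eval g x + free_eval g y"
proof -
  define A where "A = Poly_Mapping.keys x \<union> Poly_Mapping.keys y"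
  have A: "finite A" "Poly_Mapping.keys x \<subseteq> A" "Poly_Mapping.keys y \<subseteq> A" "Poly_Mapping.keys (x + y) \<subseteq> A"
    using keys_add[of x y] unfolding A_def by auto
  show ?thesis
    unfolding free_eval_superset[OF A(1,2)] free_eval_superset[OF A(1,3)] free_eval_superset[OF A(1,4)]
    by (simp add: lookup_add distrib_right sum.distrib)
qed

lemma free_eval_uminus: "free_eval g (- x) = - free_eval g x"
  using free_eval_add[of g x "- x"] by (simp add: eq_neg_iff_add_eq_0 add.commute)

lemma free_eval_diff: "free_eval g (x - y) = free_eval g x - free_eval g y"
  using free_eval_add[of g x "- y"] by (simp add: free_eval_uminus)

lemma free_eval_sum: "free_eval g (sum f A) = (\<Sum>a\<in>A. free_eval g (f a))"
  by (induction A rule: infinite_finite_induct) (simp_all add: free_eval_add)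

lemma free_eval_scaled_word [simp]: "free_eval g (scaled_word c is) = c * word_eval g is"
  by (simp add: free_eval_def)

lemma free_algebra_induct [consumes 1, case_names word add zero]:
  assumes "x \<in> carrier (free_algebra S)"
    and word: "\<And>is c. set is \<subseteq> S \<Longrightarrow> P (scaled_word c is)"
    and add: "\<And>x y. P x \<Longrightarrow> P y \<Longrightarrow> P (x + y)" and zero: "P 0"
  shows "P x"
proof -
  have eq: "x = (\<Sum>m\<in>Poly_Mapping.keys x. Poly_Mapping.single m (Poly_Mapping.lookup x m))"
  proof (rule poly_mapping_eqI)
    fix k
    show "Poly_Mapping.lookup x k = Poly_Mapping.lookup (\<Sum>m\<in>Poly_Mapping.keys x. Poly_Mapping.single m (Poly_Mapping.lookup x m)) k"
      by (cases "k \<in> Poly_Mapping.keys x")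
        (simp_all add: lookup_sum lookup_single when_def in_keys_iff sum.delta)
  qed
  have "P (\<Sum>m\<in>A. Poly_Mapping.single m (Poly_Mapping.lookup x m))" if "finite A" "A \<subseteq> Poly_Mapping.keys x" for A
    using that
  proof (induction A)
    case (insert m A)
    have "set (letters m) \<subseteq> S" using insert(4) assms(1) unfolding mem_free_algebra by blast
    then have "P (Poly_Mapping.single m (Poly_Mapping.lookup x m))" using word[of "letters m" "Poly_Mapping.lookup x m"] by simp
    then show ?case using insert add by simp
  qed (simp add: zero)
  from this[OF finite_keys order_refl] show ?thesis using eq by simp
qed

lemma mem_free_algebra_UNIV [simp]: "x \<in> carrier (free_algebra UNIV)"
  by (simp add: mem_free_algebra)

lemma free_eval_word_mult_left:
  "free_eval g (scaled_word c is * x) = c * free_eval (left_smear is g) x"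
proof -
  have "x \<in> carrier (free_algebra UNIV)" by simp
  then show ?thesis
  proof (induction x rule: free_algebra_induct)
    case (word js d)
    then show ?case by (simp add: scaled_word_mult word_eval_append_left)
  qed (simp_all add: free_eval_add distrib_left)
qed

lemma free_eval_word_mult_right:
  "free_eval g (x * scaled_word c is) = c * free_eval (right_smear is g) x"
proof -
  have "x \<in> carrier (free_algebra UNIV)" by simp
  then show ?thesis
  proof (induction x rule: free_algebra_induct)
    case (word js d)
    then show ?case by (simp add: scaled_word_mult word_eval_append_right)
  qed (simp_all add: free_eval_add distrib_left distrib_right)
qed

lemma left_smear_Nil [simp]: "left_smear [] g = g"
  by (simp add: left_smear_def)

lemma free_eval_const_mult: "free_eval g (Poly_Mapping.single 0 c * x) = c * free_eval g x"
  using free_eval_word_mult_left[of g "[]" c x] by (simp add: zero_free_mon_def)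

definition TL_annihilator :: "nat \<Rightarrow> free_elt set" where
  "TL_annihilator n = {x \<in> carrier (free_algebra {1..n-1}). \<forall>g\<in>TL_functions n. free_eval g x = 0}"

text \<open>Multiplication by a word on either side amounts to smearing the function, and
  \<open>TL_functions\<close> is closed under both kinds of smearing.\<close>

lemma TL_annihilator_closed:
  assumes "a \<in> TL_annihilator n" "x \<in> carrier (free_algebra {1..n-1})"
  shows "x * a \<in> TL_annihilator n" "a * x \<in> TL_annihilator n"
proof -
  have a: "a \<in> carrier (free_algebra {1..n-1})" "\<And>g. g \<in> TL_functions n \<Longrightarrow> free_eval g a = 0"
    using assms(1) unfolding TL_annihilator_def by blast+
  from assms(2) have "\<forall>g\<in>TL_functions n. free_eval g (x * a) = 0"
  proof (induction x rule: free_algebra_induct)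
    case (word "is" c)
    then show ?case using a(2) by (simp add: free_eval_word_mult_left left_smear_TL_functions)
  qed (simp_all add: free_eval_add distrib_right)
  moreover from assms(2) have "\<forall>g\<in>TL_functions n. free_eval g (a * x) = 0"
  proof (induction x rule: free_algebra_induct)
    case (word "is" c)
    then show ?case using a(2) by (simp add: free_eval_word_mult_right right_smear_TL_functions)
  qed (simp_all add: free_eval_add distrib_left)
  ultimately show "x * a \<in> TL_annihilator n" "a * x \<in> TL_annihilator n"
    using free_algebra_closed(2)[OF a(1) assms(2)] free_algebra_closed(2)[OF assms(2) a(1)]
    unfolding TL_annihilator_def by blast+
qed

lemma ideal_TL_annihilator: "ideal (TL_annihilator n) (free_algebra {1..n-1})"
proof (rule idealI)
  show "subgroup (TL_annihilator n) (add_monoid (free_algebra {1..n-1}))"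
  proof (rule subgroup.intro)
    fix x assume x: "x \<in> TL_annihilator n"
    then have "x \<in> carrier (free_algebra {1..n-1})" unfolding TL_annihilator_def by blast
    from a_inv_free_algebra[OF this] x free_algebra_closed(3)[OF this this]
    show "m_inv (add_monoid (free_algebra {1..n-1})) x \<in> TL_annihilator n"
      by (simp add: a_inv_def TL_annihilator_def free_eval_uminus)
  qed (auto simp: TL_annihilator_def free_eval_add free_algebra_closed)
qed (simp_all add: ring_free_algebra TL_annihilator_closed)

lemma TL_relations_annihilated: "TL_relations n \<subseteq> TL_annihilator n"
proof
  fix x assume x: "x \<in> TL_relations n"
  have "free_eval g x = 0" if g: "g \<in> TL_functions n" for g
  proof -
    consider (sq) i where "i \<in> {1..n-1}" "x = free_gen i * free_gen i - 2 * free_gen i"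
      | (comm) i j where "i \<in> {1..n-1}" "j \<in> {1..n-1}" "\<bar>int i - int j\<bar> \<ge> 2"
          "x = free_gen i * free_gen j - free_gen j * free_gen i"
      | (braid) i j where "i \<in> {1..n-1}" "j \<in> {1..n-1}" "\<bar>int i - int j\<bar> = 1"
          "x = free_gen i * free_gen j * free_gen i - free_gen i"
      using x unfolding TL_relations_def by blast
    then show ?thesis
    proof cases
      case sq
      have "2 * free_gen i = scaled_word 2 [i]"
        using const_mult_scaled_word[of 2 "[i]" 1] by (simp add: free_gen_def)
      then have "x = scaled_word 1 [i, i] - scaled_word 2 [i]"
        using sq(2) by (simp add: free_gen_def scaled_word_mult)
      then show ?thesis by (simp add: free_eval_diff word_eval_Cons)
    next
      case comm
      have "x = scaled_word 1 [i, j] - scaled_word 1 [j, i]"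
        using comm(4) by (simp add: free_gen_def scaled_word_mult)
      then show ?thesis
        using simple_refl_commute[OF comm(3)] by (simp add: free_eval_diff word_eval_Cons)
    next
      case braid
      have "x = scaled_word 1 [i, j, i] - scaled_word 1 [i]"
        using braid(4) by (simp add: free_gen_def scaled_word_mult)
      then show ?thesis
        using TL_functions_relation[OF g braid(1-3)] by (simp add: free_eval_diff)
    qed
  qed
  then show "x \<in> TL_annihilator n"
    using TL_relations_subset[of n] x unfolding TL_annihilator_def by blast
qed

lemma TL_ideal_subset_annihilator: "TL_ideal n \<subseteq> TL_annihilator n"
  unfolding TL_ideal_def
  by (rule ring.genideal_minimal[OF ring_free_algebra ideal_TL_annihilator TL_relations_annihilated])

lemma word_eval_cong:
  assumes "word_cong n is c js" "g \<in> TL_functions n"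
  shows "word_eval g is = c * word_eval g js"
  using assms TL_ideal_subset_annihilator[of n] unfolding word_cong_def TL_annihilator_def
  by (auto simp: free_eval_diff dest!: subsetD)

section \<open>Triangularity\<close>

text \<open>Entrywise comparison of these numbers is the Bruhat order.\<close>

definition rank :: "(nat \<Rightarrow> nat) \<Rightarrow> nat \<Rightarrow> nat \<Rightarrow> nat" where
  "rank u p k = card {a \<in> {1..p}. k < u a}"

definition hits :: "(nat \<Rightarrow> nat) \<Rightarrow> nat \<Rightarrow> nat \<Rightarrow> nat" where
  "hits u p x = card {a \<in> {1..p}. u a = x}"

lemma rank_Suc: "rank u p k = rank u p (Suc k) + hits u p (Suc k)"
proof -
  have "{a \<in> {1..p}. k < u a} = {a \<in> {1..p}. Suc k < u a} \<union> {a \<in> {1..p}. u a = Suc k}" by auto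
  then show ?thesis unfolding rank_def hits_def
    by (simp only:) (rule card_Un_disjoint, auto)
qed

lemma hits_if:
  assumes "u permutes S"
  shows "hits u p x = (if 1 \<le> inv u x \<and> inv u x \<le> p then 1 else 0)"
proof -
  have "{a \<in> {1..p}. u a = x} = {a \<in> {1..p}. a = inv u x}"
    using permutes_inverses[OF assms] by (metis (no_types, lifting))
  also have "\<dots> = (if 1 \<le> inv u x \<and> inv u x \<le> p then {inv u x} else {})" by auto
  finally show ?thesis unfolding hits_def by simp
qed

lemma rank_simple_refl_neq:
  assumes "k \<noteq> i"
  shows "rank (simple_refl i \<circ> u) p k = rank u p k"
proof -
  have "k < simple_refl i x \<longleftrightarrow> k < x" for x
    using assms by (auto simp: simple_refl_def transpose_def)
  then show ?thesis by (simp add: rank_def)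
qed

lemma rank_simple_refl_eq: "rank (simple_refl i \<circ> u) p i = rank u p (Suc i) + hits u p i"
proof -
  have "{a \<in> {1..p}. i < (simple_refl i \<circ> u) a} = {a \<in> {1..p}. Suc i < u a} \<union> {a \<in> {1..p}. u a = i}"
    by (auto simp: simple_refl_def transpose_def)
  then show ?thesis unfolding rank_def hits_def
    by (simp only:) (rule card_Un_disjoint, auto)
qed

text \<open>The easy half of the tableau criterion for the Bruhat order.\<close>

lemma rank_subseq_le:
  assumes "reduced_word n v is" "r \<in> set (subseqs is)"
  shows "rank (word_perm r) p k \<le> rank v p k"
  using assms
proof (induction "is" arbitrary: v r k)
  case Nil
  then show ?case using reduced_wordD(2)[OF Nil(1)] by simp
next
  case (Cons i "is")
  define v' where "v' = simple_refl i \<circ> v"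
  have v: "v permutes {1..n}" using reduced_wordD(3)[OF Cons(2)] .
  have i: "i \<in> {1..n-1}" and desc: "inv v (Suc i) < inv v i" and red: "reduced_word n v' is"
    using Cons(2) unfolding reduced_word_Cons_iff[OF v] v'_def by blast+
  have v': "v' permutes {1..n}" using reduced_wordD(3)[OF red] .
  have v_eq: "v = simple_refl i \<circ> v'" by (simp add: v'_def)
  have asc: "inv v' i < inv v' (Suc i)"
    unfolding v'_def inv_simple_refl_comp_apply[OF v] by (rule desc)
  obtain h where h: "i = Suc h" using i by (cases i) auto
  have pos: "1 \<le> inv v' i"
    using i permutes_in_image[OF permutes_inv[OF v'], of i] by auto
  have hits_v': "hits v' p (Suc i) \<le> hits v' p i"
    unfolding hits_if[OF v'] using asc pos by simp
  have rank_v: "rank v p i = rank v' p (Suc i) + hits v' p i"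
    unfolding v_eq by (rule rank_simple_refl_eq)
  have le_v: "rank v' p k \<le> rank v p k" for k
  proof (cases "k = i")
    case True
    then show ?thesis using rank_v rank_Suc[of v' p i] hits_v' by simp
  next
    case False
    then show ?thesis unfolding v_eq by (simp add: rank_simple_refl_neq)
  qed
  have "r \<in> set (subseqs is) \<or> (\<exists>r'\<in>set (subseqs is). r = i # r')"
    using Cons(3) by (auto simp: Let_def)
  then consider "r \<in> set (subseqs is)" | r' where "r' \<in> set (subseqs is)" "r = i # r'" by blast
  then show ?case
  proof cases
    case 1
    from Cons(1)[OF red 1] show ?thesis using le_v order.trans by blast
  next
    case 2
    define u where "u = word_perm r'"
    have IH: "rank u p k \<le> rank v' p k" for k unfolding u_def by (rule Cons(1)[OF red 2(1)])
    have "u permutes {1..n}"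
      unfolding u_def using word_perm_subseqs_permutes[OF reduced_wordD(1)[OF red] 2(1)] .
    then have hits_u: "hits u p i \<le> 1" by (simp add: hits_if)
    have "rank (simple_refl i \<circ> u) p k \<le> rank v p k"
    proof (cases "k = i")
      case False
      then show ?thesis unfolding v_eq by (simp add: rank_simple_refl_neq IH)
    next
      case True
      have "rank u p (Suc i) + hits u p i \<le> rank v' p (Suc i) + hits v' p i"
      \<comment> \<open>If the value i is not taken by v' on {1..p}, neither is i + 1, so the ranks
        of v' at i - 1 and i + 1 agree and the induction hypothesis is used at \<open>h\<close> = i
        - 1. If it is taken, the induction hypothesis at i + 1 suffices.\<close>
      proof (cases "hits v' p i = 0")
        case True
        then have "rank v' p h = rank v' p (Suc i)"
          using hits_v' rank_Suc[of v' p h] rank_Suc[of v' p i] h by simp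
        moreover have "rank u p (Suc i) + hits u p i \<le> rank u p h"
          using rank_Suc[of u p h] rank_Suc[of u p i] h by simp
        ultimately show ?thesis using IH[of h] by simp
      next
        case False
        then show ?thesis using hits_u IH[of "Suc i"] by simp
      qed
      then show ?thesis using True rank_v by (simp add: rank_simple_refl_eq)
    qed
    then show ?thesis unfolding 2(2) u_def word_perm_Cons .
  qed
qed

section \<open>A numerical refinement of the Bruhat order\<close>

definition prefix_sum :: "(nat \<Rightarrow> nat) \<Rightarrow> nat \<Rightarrow> nat" where
  "prefix_sum u p = (\<Sum>a\<in>{1..p}. u a)"

text \<open>By \<open>prefix_sum_eq_rank\<close> this is the total of the rank numbers, so it can
  only grow with them, and a natural number takes the place of the partial order.\<close>

definition weight :: "nat \<Rightarrow> (nat \<Rightarrow> nat) \<Rightarrow> nat" where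
  "weight n u = (\<Sum>p\<in>{1..n}. prefix_sum u p)"

text \<open>Each value \<open>u a\<close> counts the k below it; exchange the two
  summations.\<close>

lemma prefix_sum_eq_rank:
  assumes "u permutes {1..n}" "p \<le> n"
  shows "prefix_sum u p = (\<Sum>k<n. rank u p k)"
proof -
  have "rank u p k = (\<Sum>a\<in>{1..p}. if k < u a then 1 else 0)" for k
    unfolding rank_def card_eq_sum by (rule sum.inter_filter) simp
  then have "(\<Sum>k<n. rank u p k) = (\<Sum>k<n. \<Sum>a\<in>{1..p}. if k < u a then 1 else 0)" by simp
  also have "\<dots> = (\<Sum>a\<in>{1..p}. \<Sum>k<n. if k < u a then 1 else 0)" by (rule sum.swap)
  also have "\<dots> = (\<Sum>a\<in>{1..p}. u a)"
  proof (rule sum.cong[OF refl])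
    fix a assume "a \<in> {1..p}"
    then have "u a \<le> n" using permutes_in_image[OF assms(1), of a] assms(2) by auto
    then have *: "{k \<in> {..<n}. k < u a} = {..<u a}" by auto
    have "(\<Sum>k<n. if k < u a then 1 else 0) = (\<Sum>k\<in>{k \<in> {..<n}. k < u a}. 1 :: nat)"
      by (rule sum.inter_filter[symmetric]) simp
    then show "(\<Sum>k<n. if k < u a then 1 else 0) = u a" unfolding * by simp
  qed
  finally show ?thesis unfolding prefix_sum_def ..
qed

text \<open>Larger ranks give larger prefix sums. If the totals nevertheless agree, all prefix sums
  agree, and their differences are the values of the permutation.\<close>

lemma weight_le_if_rank_le:
  assumes u: "u permutes {1..n}" and v: "v permutes {1..n}"
    and le: "\<And>p k. p \<le> n \<Longrightarrow> rank u p k \<le> rank v p k"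
  shows "weight n u < weight n v \<or> u = v"
proof -
  have ple: "prefix_sum u p \<le> prefix_sum v p" if "p \<le> n" for p
    unfolding prefix_sum_eq_rank[OF u that] prefix_sum_eq_rank[OF v that]
    by (rule sum_mono) (rule le[OF that])
  then have wle: "weight n u \<le> weight n v" unfolding weight_def by (intro sum_mono) simp
  show ?thesis
  proof (cases "weight n u = weight n v")
    case True
    have eq: "prefix_sum u p = prefix_sum v p" if "p \<le> n" for p
    proof (cases "p = 0")
      case False
      then have p: "p \<in> {1..n}" using that by simp
      show ?thesis
      proof (rule ccontr)
        assume "prefix_sum u p \<noteq> prefix_sum v p"
        then have "prefix_sum u p < prefix_sum v p" using ple[OF that] by simp
        then have "weight n u < weight n v"
          unfolding weight_def using p ple by (intro sum_strict_mono_ex1) auto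
        with True show False by simp
      qed
    qed (simp add: prefix_sum_def)
    have "u a = v a" for a
    proof (cases "a \<in> {1..n}")
      case a: True
      then obtain b where b: "a = Suc b" by (cases a) auto
      have "prefix_sum x (Suc b) = prefix_sum x b + x (Suc b)" for x :: "nat \<Rightarrow> nat"
        by (simp add: prefix_sum_def)
      then show ?thesis using eq[of b] eq[of "Suc b"] a b by simp
    next
      case False
      then show ?thesis using permutes_not_in[OF u False] permutes_not_in[OF v False] by simp
    qed
    then show ?thesis by blast
  qed (use wle in simp)
qed

lemma prefix_sum_swap:
  assumes ab: "a < b" "1 \<le> a"
  shows "p < a \<or> b \<le> p \<Longrightarrow> prefix_sum (u \<circ> transpose a b) p = prefix_sum u p"
    and "a \<le> p \<Longrightarrow> p < b \<Longrightarrow> prefix_sum (u \<circ> transpose a b) p + u a = prefix_sum u p + u b"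
proof -
  assume p: "p < a \<or> b \<le> p"
  show "prefix_sum (u \<circ> transpose a b) p = prefix_sum u p"
  proof (cases "p < a")
    case True
    then show ?thesis unfolding prefix_sum_def using ab by (intro sum.cong) (auto simp: transpose_def)
  next
    case False
    then have "transpose a b permutes {1..p}" using p ab by (intro permutes_swap_id) auto
    from sum.permute[OF this, of u] show ?thesis unfolding prefix_sum_def by simp
  qed
next
  assume p: "a \<le> p" "p < b"
  have a: "a \<in> {1..p}" using p ab by simp
  have "(\<Sum>c\<in>{1..p} - {a}. (u \<circ> transpose a b) c) = (\<Sum>c\<in>{1..p} - {a}. u c)"
    using p by (intro sum.cong) (auto simp: transpose_def)
  then show "prefix_sum (u \<circ> transpose a b) p + u a = prefix_sum u p + u b"
    unfolding prefix_sum_def sum.remove[OF finite_atLeastAtMost a] by simp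
qed

lemma weight_swap_less:
  assumes "(a, b) \<in> inversions n u"
  shows "weight n (u \<circ> transpose a b) < weight n u"
proof -
  have ab: "a \<in> {1..n}" "b \<in> {1..n}" "a < b" "u b < u a" "1 \<le> a"
    using assms by (auto simp: inversions_def)
  have "prefix_sum (u \<circ> transpose a b) p \<le> prefix_sum u p" for p
    using prefix_sum_swap[OF ab(3,5), of p u] ab(4) by linarith
  moreover have "prefix_sum (u \<circ> transpose a b) a < prefix_sum u a"
    using prefix_sum_swap(2)[OF ab(3,5), of a u] ab(3,4) by linarith
  ultimately show ?thesis
    unfolding weight_def using ab(1) by (intro sum_strict_mono_ex1) auto
qed

text \<open>Undoing an inversion inside \<open>J\<close> or inside its complement keeps the image of
  \<open>J\<close> and lowers the weight. This can only stop at the permutation increasing on both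
  parts, which is \<open>w\<close>.\<close>

lemma weight_less_if_image_eq:
  assumes w: "w permutes {1..n}" and J: "J \<subseteq> {1..n}"
    and mono: "strict_mono_on J w" "strict_mono_on ({1..n} - J) w"
    and u: "u permutes {1..n}" and img: "u ` J = w ` J"
  shows "u = w \<or> weight n w < weight n u"
  using u img
proof (induction "weight n u" arbitrary: u rule: less_induct)
  case less
  have compl: "x ` ({1..n} - J) = {1..n} - x ` J" if "x permutes {1..n}" for x
    using image_set_diff[OF permutes_inj[OF that], of "{1..n}" J] permutes_image[OF that] by simp
  show ?case
  proof (cases "strict_mono_on J u \<and> strict_mono_on ({1..n} - J) u")
    case True
    have "u x = w x" for x
    proof -
      consider "x \<in> J" | "x \<in> {1..n} - J" | "x \<notin> {1..n}" using J by blast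
      then show ?thesis
      proof cases
        case 1
        show ?thesis
          by (rule eq_on_if_strict_mono_on[OF finite_subset[OF J] _ mono(1) less(3) 1]) (use True in simp_all)
      next
        case 2
        show ?thesis
          by (rule eq_on_if_strict_mono_on[OF _ _ mono(2) _ 2])
            (use True compl[OF less(2)] compl[OF w] less(3) in simp_all)
      next
        case 3
        show ?thesis using permutes_not_in[OF less(2) 3] permutes_not_in[OF w 3] by simp
      qed
    qed
    then show ?thesis by blast
  next
    case False
    obtain a b where ab: "(a, b) \<in> inversions n u" "a \<in> J \<longleftrightarrow> b \<in> J"
    proof -
      from False consider "\<not> strict_mono_on J u" | "\<not> strict_mono_on ({1..n} - J) u" by blast
      then show thesis
      proof cases
        case 1
        with strict_mono_on_if_no_inversion[OF less(2) _ J] that show thesis by blast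
      next
        case 2
        with strict_mono_on_if_no_inversion[OF less(2), of "{1..n} - J"] that show thesis by blast
      qed
    qed
    define t where "t = transpose a b"
    have ab': "a \<in> {1..n}" "b \<in> {1..n}" using ab(1) by (auto simp: inversions_def)
    have t: "t permutes {1..n}" unfolding t_def by (rule permutes_swap_id[OF ab'])
    have less_u: "weight n (u \<circ> t) < weight n u" unfolding t_def by (rule weight_swap_less[OF ab(1)])
    have "t ` J = J" unfolding t_def by (rule transpose_image_eq[OF ab(2)])
    then have "(u \<circ> t) ` J = w ` J" using less(3) unfolding image_comp[symmetric] by simp
    from less(1)[OF less_u permutes_compose[OF t less(2)] this] less_u
    show ?thesis by auto
  qed
qed

lemma subseqs_eq_Cons: "\<exists>L. subseqs xs = xs # L \<and> (\<forall>r\<in>set L. length r < length xs)"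
proof (induction xs)
  case (Cons x xs)
  then obtain L where "subseqs xs = xs # L" "\<forall>r\<in>set L. length r < length xs" by blast
  then show ?case by (intro exI[of _ "map (Cons x) L @ subseqs xs"]) (auto simp: Let_def)
qed simp

text \<open>Only the full word contributes: a proper subword is too short to represent
  \<open>v\<close>, so its product has dominated ranks and strictly smaller weight. The premise on
  \<open>g\<close> offers both facts, because some applications argue by weight and others by
  ranks.\<close>

lemma word_eval_reduced_word:
  assumes "reduced_word n v is"
    and "\<And>u. u permutes {1..n} \<Longrightarrow> u \<noteq> v \<Longrightarrow> weight n u < weight n v \<Longrightarrow>
      (\<And>p k. p \<le> n \<Longrightarrow> rank u p k \<le> rank v p k) \<Longrightarrow> g u = 0"
  shows "word_eval g is = g v"
proof -
  have v: "v permutes {1..n}" using reduced_wordD(3)[OF assms(1)] .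
  obtain L where L: "subseqs is = is # L" "\<And>r. r \<in> set L \<Longrightarrow> length r < length is"
    using subseqs_eq_Cons[of "is"] by blast
  have "g (word_perm r) = 0" if r: "r \<in> set L" for r
  proof -
    have sub: "r \<in> set (subseqs is)" using L(1) r by simp
    have perm: "word_perm r permutes {1..n}"
      using word_perm_subseqs_permutes[OF reduced_wordD(1)[OF assms(1)] sub] .
    have le: "rank (word_perm r) p k \<le> rank v p k" for p k
      by (rule rank_subseq_le[OF assms(1) sub])
    have "set r \<subseteq> {1..n-1}"
      using reduced_wordD(1)[OF assms(1)] set_subseqs_subset[OF sub] by blast
    then have neq: "word_perm r \<noteq> v"
      using assms(1) L(2)[OF r] unfolding reduced_word_def by (meson not_le)
    then have "weight n (word_perm r) < weight n v"
      using weight_le_if_rank_le[OF perm v le] by blast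
    then show ?thesis using assms(2)[OF perm neq _ le] by blast
  qed
  then have "(\<Sum>r\<leftarrow>L. g (word_perm r)) = 0" by (induction L) simp_all
  then show ?thesis
    unfolding word_eval_def L(1) using reduced_wordD(2)[OF assms(1)] by simp
qed

section \<open>Left-to-right maxima and linear independence\<close>

definition lr_maxima :: "nat \<Rightarrow> (nat \<Rightarrow> nat) \<Rightarrow> nat set" where
  "lr_maxima n w = {b \<in> {1..n}. \<forall>a. (a, b) \<notin> inversions n w}"

lemma strict_mono_on_lr_maxima:
  assumes "w permutes {1..n}"
  shows "strict_mono_on (lr_maxima n w) w"
  by (rule strict_mono_on_if_no_inversion[OF assms]) (auto simp: lr_maxima_def)

text \<open>A position that is not a left-to-right maximum ends an inversion; an inversion starting
  there as well would complete a pattern 321.\<close>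

lemma strict_mono_on_compl_lr_maxima:
  assumes "w permutes {1..n}" "\<not> has_321 n w"
  shows "strict_mono_on ({1..n} - lr_maxima n w) w"
proof (rule strict_mono_on_if_no_inversion[OF assms(1)])
  fix a b assume "a \<in> {1..n} - lr_maxima n w"
  then obtain c where "(c, a) \<in> inversions n w" unfolding lr_maxima_def by blast
  then show "(a, b) \<notin> inversions n w" using assms(2) unfolding has_321_def by blast
qed blast

definition lr_function :: "nat \<Rightarrow> (nat \<Rightarrow> nat) \<Rightarrow> (nat \<Rightarrow> nat) \<Rightarrow> complex" where
  "lr_function n w = (\<lambda>u. of_int (sign u) * (if u ` lr_maxima n w = w ` lr_maxima n w then 1 else 0))"

lemma lr_function_TL_functions: "lr_function n w \<in> TL_functions n"
  unfolding lr_function_def by (rule sign_coloured_TL_functions)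

lemma lr_function_nonzero:
  assumes "w permutes {1..n}" "\<not> has_321 n w" "u permutes {1..n}" "lr_function n w u \<noteq> 0"
  shows "u = w \<or> weight n w < weight n u"
proof (rule weight_less_if_image_eq[OF assms(1) _ strict_mono_on_lr_maxima[OF assms(1)]
      strict_mono_on_compl_lr_maxima[OF assms(1,2)] assms(3)])
  show "lr_maxima n w \<subseteq> {1..n}" by (auto simp: lr_maxima_def)
  show "u ` lr_maxima n w = w ` lr_maxima n w"
    using assms(4) unfolding lr_function_def by (auto split: if_splits)
qed

lemma lr_function_self: "lr_function n w w = of_int (sign w)"
  by (simp add: lr_function_def)

text \<open>On \<beta>(v) only \<open>v\<close> and lighter permutations are seen, whereas
  \<open>lr_function n w\<close> is supported on \<open>w\<close> and heavier ones.\<close>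

lemma word_eval_lr_function:
  assumes w: "w permutes {1..n}" "\<not> has_321 n w" and red: "reduced_word n v is"
    and le: "weight n v \<le> weight n w"
  shows "word_eval (lr_function n w) is = (if v = w then of_int (sign w) else 0)"
proof -
  have v: "v permutes {1..n}" using reduced_wordD(3)[OF red] .
  have "word_eval (lr_function n w) is = lr_function n w v"
  proof (rule word_eval_reduced_word[OF red])
    fix u assume "u permutes {1..n}" "weight n u < weight n v"
    then show "lr_function n w u = 0"
      using lr_function_nonzero[OF w, of u] le by (cases "u = w") auto
  qed
  moreover have "lr_function n w v = 0" if "v \<noteq> w"
    using lr_function_nonzero[OF w v] that le by auto
  ultimately show ?thesis by (simp add: lr_function_self)
qed

abbreviation avoiders :: "nat \<Rightarrow> (nat \<Rightarrow> nat) set" where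
  "avoiders n \<equiv> {w. w permutes {1..n} \<and> \<not> has_321 n w}"

lemma finite_avoiders [simp]: "finite (avoiders n)"
  by (rule finite_subset[OF _ finite_permutations[of "{1..n}"]]) auto

text \<open>Linear independence of the \<beta>(w), phrased through functionals. Among the indices
  with nonzero coefficient take \<open>v\<close> of largest weight; \<open>lr_function n v\<close>
  then annihilates all terms but that of \<open>v\<close>.\<close>

lemma coefficients_unique:
  assumes rw: "\<And>w. w \<in> avoiders n \<Longrightarrow> reduced_word n w (rw w)"
    and zero: "\<And>g. g \<in> TL_functions n \<Longrightarrow> (\<Sum>w\<in>avoiders n. c w * word_eval g (rw w)) = 0"
    and w: "w \<in> avoiders n"
  shows "c w = 0"
proof (rule ccontr)
  define A where "A = {v \<in> avoiders n. c v \<noteq> 0}"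
  assume "c w \<noteq> 0"
  then have "A \<noteq> {}" using w unfolding A_def by blast
  have "finite A" unfolding A_def by (rule finite_subset[OF _ finite_avoiders]) blast
  define M where "M = Max (weight n ` A)"
  have "M \<in> weight n ` A" unfolding M_def using \<open>A \<noteq> {}\<close> \<open>finite A\<close> by (intro Max_in) auto
  then obtain v where v: "v \<in> A" "M = weight n v" by blast
  have max: "weight n x \<le> weight n v" if "x \<in> A" for x
    using that \<open>finite A\<close> unfolding v(2)[symmetric] M_def by (intro Max_ge) auto
  have v': "v \<in> avoiders n" "v permutes {1..n}" "\<not> has_321 n v" "c v \<noteq> 0"
    using v(1) unfolding A_def by blast+
  have "c x * word_eval (lr_function n v) (rw x) = (if x = v then c v * of_int (sign v) else 0)"
    if x: "x \<in> avoiders n" for x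
  proof (cases "x \<in> A")
    case True
    from word_eval_lr_function[OF v'(2,3) rw[OF x] max[OF True]] show ?thesis by simp
  next
    case False
    then have "c x = 0" "x \<noteq> v" using x v(1) unfolding A_def by blast+
    then show ?thesis by simp
  qed
  then have "(\<Sum>x\<in>avoiders n. c x * word_eval (lr_function n v) (rw x))
      = (\<Sum>x\<in>avoiders n. if x = v then c v * of_int (sign v) else 0)"
    by (intro sum.cong refl)
  also have "\<dots> = c v * of_int (sign v)"
    using v'(1) by (subst sum.delta[OF finite_avoiders]) (simp only: if_True)
  finally have "(\<Sum>x\<in>avoiders n. c x * word_eval (lr_function n v) (rw x)) = c v * of_int (sign v)" .
  then show False using zero[OF lr_function_TL_functions] v'(4) by (simp add: sign_def split: if_splits)
qed

lemma spanning:
  assumes rw: "\<And>w. w \<in> avoiders n \<Longrightarrow> reduced_word n w (rw w)"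
    and "x \<in> carrier (free_algebra {1..n-1})"
  shows "\<exists>c. x - (\<Sum>w\<in>avoiders n. scaled_word (c w) (rw w)) \<in> TL_ideal n"
  using assms(2)
proof (induction x rule: free_algebra_induct)
  case (word "is" d)
  obtain c w js where w: "\<not> has_321 n w" "reduced_word n w js" "word_cong n is c js"
    using word_cong_321_avoiding[OF word] by blast
  then have wn: "w \<in> avoiders n" using reduced_wordD(3)[OF w(2)] by blast
  have "word_cong n is c (rw w)"
    using word_cong_trans[OF w(3) word_cong_reduced_words[OF w(2) rw[OF wn] w(1)]] by simp
  then have "Poly_Mapping.single 0 d * (scaled_word 1 is - scaled_word c (rw w)) \<in> TL_ideal n"
    unfolding word_cong_def by (rule TL_ideal_mult_left) simp
  moreover have "(\<Sum>v\<in>avoiders n. scaled_word (if v = w then d * c else 0) (rw v)) = scaled_word (d * c) (rw w)"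
    using wn by (simp add: if_distrib[of "Poly_Mapping.single _"] sum.delta cong: if_cong)
  ultimately show ?case
    by (intro exI[of _ "\<lambda>v. if v = w then d * c else 0"])
      (simp add: right_diff_distrib const_mult_scaled_word)
next
  case (add x y)
  then obtain c d where cd: "x - (\<Sum>w\<in>avoiders n. scaled_word (c w) (rw w)) \<in> TL_ideal n"
    "y - (\<Sum>w\<in>avoiders n. scaled_word (d w) (rw w)) \<in> TL_ideal n" by blast
  have "x + y - (\<Sum>w\<in>avoiders n. scaled_word (c w + d w) (rw w)) =
      (x - (\<Sum>w\<in>avoiders n. scaled_word (c w) (rw w))) + (y - (\<Sum>w\<in>avoiders n. scaled_word (d w) (rw w)))"
    by (simp add: single_add sum.distrib)
  then show ?case using TL_ideal_add[OF cd] by (intro exI[of _ "\<lambda>w. c w + d w"]) (simp only:)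
next
  case zero
  then show ?case by (intro exI[of _ "\<lambda>_. 0"]) simp
qed

text \<open>For the converse inclusion, an element killed by all functionals is congruent to a
  combination of the \<beta>(w), and independence makes its coefficients vanish.\<close>

lemma TL_ideal_eq_annihilator: "TL_ideal n = TL_annihilator n"
proof
  show "TL_ideal n \<subseteq> TL_annihilator n" by (rule TL_ideal_subset_annihilator)
  show "TL_annihilator n \<subseteq> TL_ideal n"
  proof
    fix x assume "x \<in> TL_annihilator n"
    then have x: "x \<in> carrier (free_algebra {1..n-1})" "\<And>g. g \<in> TL_functions n \<Longrightarrow> free_eval g x = 0"
      unfolding TL_annihilator_def by blast+
    define rw where "rw w = (SOME is. reduced_word n w is)" for w
    have rw: "reduced_word n w (rw w)" if "w \<in> avoiders n" for w
      unfolding rw_def by (rule someI_ex[OF exists_reduced_word]) (use that in blast)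
    obtain c where c: "x - (\<Sum>w\<in>avoiders n. scaled_word (c w) (rw w)) \<in> TL_ideal n"
      using spanning[OF rw x(1)] by blast
    have "(\<Sum>w\<in>avoiders n. c w * word_eval g (rw w)) = 0" if g: "g \<in> TL_functions n" for g
    proof -
      have "free_eval g (x - (\<Sum>w\<in>avoiders n. scaled_word (c w) (rw w))) = 0"
        using c TL_ideal_subset_annihilator[of n] g unfolding TL_annihilator_def by blast
      then show ?thesis using x(2)[OF g] by (simp add: free_eval_diff free_eval_sum)
    qed
    then have "c w = 0" if "w \<in> avoiders n" for w
      using coefficients_unique[OF rw _ that, where c = c] by blast
    then show "x \<in> TL_ideal n" using c by simp
  qed
qed

section \<open>The quotient algebra and the homomorphism \<open>\<theta>\<close>\<close>

definition TL_class :: "nat \<Rightarrow> free_elt \<Rightarrow> free_elt set" where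
  "TL_class n x = TL_ideal n +>\<^bsub>free_algebra {1..n-1}\<^esub> x"

text \<open>The test for equality in the quotient by which \<theta> and the coordinates are computed
  below.\<close>

lemma TL_class_eq_iff:
  assumes "x \<in> carrier (free_algebra {1..n-1})" "y \<in> carrier (free_algebra {1..n-1})"
  shows "TL_class n x = TL_class n y \<longleftrightarrow> (\<forall>g\<in>TL_functions n. free_eval g x = free_eval g y)"
proof -
  have "TL_class n x = TL_class n y \<longleftrightarrow> x - y \<in> TL_ideal n"
    using ring.quotient_eq_iff_same_a_r_cos[OF ring_free_algebra ideal_TL_ideal assms]
    unfolding TL_class_def a_minus_free_algebra[OF assms(2)] by blast
  also have "\<dots> \<longleftrightarrow> (\<forall>g\<in>TL_functions n. free_eval g x = free_eval g y)"
    unfolding TL_ideal_eq_annihilator TL_annihilator_def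
    using free_algebra_closed(4)[OF assms] by (simp add: free_eval_diff)
  finally show ?thesis .
qed

lemma carrier_TL: "carrier (TL n) = TL_class n ` carrier (free_algebra {1..n-1})"
  by (auto simp: TL_def Let_def FactRing_def A_RCOSETS_def' TL_class_def)

lemma TL_class_mem [simp]: "x \<in> carrier (free_algebra {1..n-1}) \<Longrightarrow> TL_class n x \<in> carrier (TL n)"
  unfolding carrier_TL by blast

lemma TL_mult:
  "x \<in> carrier (free_algebra {1..n-1}) \<Longrightarrow> y \<in> carrier (free_algebra {1..n-1}) \<Longrightarrow>
    TL_class n x \<otimes>\<^bsub>TL n\<^esub> TL_class n y = TL_class n (x * y)"
  using ideal.rcoset_mult_add[OF ideal_TL_ideal, of x n y]
  by (simp add: TL_def Let_def FactRing_def TL_class_def)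

lemma TL_add:
  assumes "x \<in> carrier (free_algebra {1..n-1})" "y \<in> carrier (free_algebra {1..n-1})"
  shows "TL_class n x \<oplus>\<^bsub>TL n\<^esub> TL_class n y = TL_class n (x + y)"
proof -
  interpret ideal "TL_ideal n" "free_algebra {1..n-1}" by (rule ideal_TL_ideal)
  show ?thesis using a_rcos_sum[OF assms]
    by (simp add: TL_def Let_def FactRing_def TL_class_def)
qed

lemma TL_one: "\<one>\<^bsub>TL n\<^esub> = TL_class n 1"
  by (simp add: TL_def Let_def FactRing_def TL_class_def)

lemma TL_zero: "\<zero>\<^bsub>TL n\<^esub> = TL_class n 0"
proof -
  interpret ideal "TL_ideal n" "free_algebra {1..n-1}" by (rule ideal_TL_ideal)
  have "TL_ideal n +>\<^bsub>free_algebra {1..n-1}\<^esub> 0 = TL_ideal n"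
    by (rule a_rcos_const) simp
  then show ?thesis by (simp add: TL_def Let_def FactRing_def TL_class_def)
qed

lemma TL_smult:
  "x \<in> carrier (free_algebra {1..n-1}) \<Longrightarrow>
    c \<odot>\<^bsub>TL n\<^esub> TL_class n x = TL_class n (Poly_Mapping.single 0 c * x)"
  using ideal.rcoset_mult_add[OF ideal_TL_ideal, of "Poly_Mapping.single 0 c" n x]
  by (simp add: TL_def Let_def FactRing_def TL_class_def)

lemma TL_carrierE:
  assumes "X \<in> carrier (TL n)"
  obtains x where "X = TL_class n x" "x \<in> carrier (free_algebra {1..n-1})"
  using assms unfolding carrier_TL by blast

lemma abelian_group_TL: "abelian_group (TL n)"
proof (rule abelian_groupI)
  fix X Y assume "X \<in> carrier (TL n)" "Y \<in> carrier (TL n)"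
  then show "X \<oplus>\<^bsub>TL n\<^esub> Y \<in> carrier (TL n)" "X \<oplus>\<^bsub>TL n\<^esub> Y = Y \<oplus>\<^bsub>TL n\<^esub> X"
    by (auto elim!: TL_carrierE simp: TL_add free_algebra_closed add.commute)
next
  fix X Y Z assume "X \<in> carrier (TL n)" "Y \<in> carrier (TL n)" "Z \<in> carrier (TL n)"
  then show "X \<oplus>\<^bsub>TL n\<^esub> Y \<oplus>\<^bsub>TL n\<^esub> Z = X \<oplus>\<^bsub>TL n\<^esub> (Y \<oplus>\<^bsub>TL n\<^esub> Z)"
    by (auto elim!: TL_carrierE simp: TL_add free_algebra_closed add.assoc)
next
  fix X assume "X \<in> carrier (TL n)"
  then obtain x where x: "X = TL_class n x" "x \<in> carrier (free_algebra {1..n-1})" by (rule TL_carrierE)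
  show "\<zero>\<^bsub>TL n\<^esub> \<oplus>\<^bsub>TL n\<^esub> X = X" using x by (simp add: TL_zero TL_add)
  show "\<exists>Y\<in>carrier (TL n). Y \<oplus>\<^bsub>TL n\<^esub> X = \<zero>\<^bsub>TL n\<^esub>"
    using x free_algebra_closed(3)[OF x(2) x(2)]
    by (intro bexI[of _ "TL_class n (- x)"]) (simp_all add: TL_zero TL_add)
qed (simp add: TL_zero)

lemma TL_minus:
  assumes "x \<in> carrier (free_algebra {1..n-1})" "y \<in> carrier (free_algebra {1..n-1})"
  shows "TL_class n x \<ominus>\<^bsub>TL n\<^esub> TL_class n y = TL_class n (x - y)"
proof -
  interpret abelian_group "TL n" by (rule abelian_group_TL)
  have ny: "- y \<in> carrier (free_algebra {1..n-1})" by (rule free_algebra_closed(3)[OF assms(2) assms(2)])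
  have "\<ominus>\<^bsub>TL n\<^esub> TL_class n y = TL_class n (- y)"
    by (rule minus_equality) (use assms ny in \<open>simp_all add: TL_add TL_zero\<close>)
  then show ?thesis using TL_add[OF assms(1) ny] by (simp add: a_minus_def)
qed

lemma free_algebra_sum:
  "(\<And>a. a \<in> A \<Longrightarrow> f a \<in> carrier (free_algebra S)) \<Longrightarrow> sum f A \<in> carrier (free_algebra S)"
  by (induction A rule: infinite_finite_induct) (simp_all add: free_algebra_closed)

lemma TL_finsum:
  assumes "finite A" "\<And>a. a \<in> A \<Longrightarrow> x a \<in> carrier (free_algebra {1..n-1})"
  shows "(\<Oplus>\<^bsub>TL n\<^esub>a\<in>A. f a \<odot>\<^bsub>TL n\<^esub> TL_class n (x a)) = TL_class n (\<Sum>a\<in>A. Poly_Mapping.single 0 (f a) * x a)"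
proof -
  interpret abelian_group "TL n" by (rule abelian_group_TL)
  show ?thesis
    using assms
  proof (induction A)
    case empty
    then show ?case by (simp add: TL_zero)
  next
    case (insert a A)
    have mem: "Poly_Mapping.single 0 (f b) * x b \<in> carrier (free_algebra {1..n-1})" if "b \<in> insert a A" for b
      using insert(4)[OF that] by (simp add: free_algebra_closed)
    have "f b \<odot>\<^bsub>TL n\<^esub> TL_class n (x b) \<in> carrier (TL n)" if "b \<in> insert a A" for b
      using TL_smult[OF insert(4)[OF that]] mem[OF that] by simp
    then have "(\<Oplus>\<^bsub>TL n\<^esub>b\<in>insert a A. f b \<odot>\<^bsub>TL n\<^esub> TL_class n (x b))
        = f a \<odot>\<^bsub>TL n\<^esub> TL_class n (x a) \<oplus>\<^bsub>TL n\<^esub> (\<Oplus>\<^bsub>TL n\<^esub>b\<in>A. f b \<odot>\<^bsub>TL n\<^esub> TL_class n (x b))"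
      using insert(1,2) by (intro finsum_insert) auto
    also have "\<dots> = TL_class n (Poly_Mapping.single 0 (f a) * x a)
        \<oplus>\<^bsub>TL n\<^esub> TL_class n (\<Sum>b\<in>A. Poly_Mapping.single 0 (f b) * x b)"
      using insert(3)[OF insert(4)] TL_smult[OF insert(4)] by simp
    also have "\<dots> = TL_class n (\<Sum>b\<in>insert a A. Poly_Mapping.single 0 (f b) * x b)"
      using TL_add[OF mem free_algebra_sum[OF mem], of a A] insert(1,2) by simp
    finally show ?case .
  qed
qed

lemma TL_gen_eq: "TL_gen n i = TL_class n (free_gen i)"
  by (simp add: TL_gen_def TL_class_def)

lemma TL_word_eq: "set is \<subseteq> {1..n-1} \<Longrightarrow> TL_word n is = TL_class n (scaled_word 1 is)"
proof (induction "is")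
  case Nil
  then show ?case by (simp add: TL_word_def TL_one flip: zero_free_mon_def)
next
  case (Cons i "is")
  then have "i \<in> {1..n-1}" "set is \<subseteq> {1..n-1}" by simp_all
  then show ?case
    using Cons TL_mult[OF free_gen_mem_free_algebra scaled_word_mem_free_algebra[where c = 1], of i n "is"]
    by (simp add: TL_word_def TL_gen_eq free_gen_mult_scaled_word)
qed

definition canonical_word :: "nat \<Rightarrow> (nat \<Rightarrow> nat) \<Rightarrow> nat list" where
  "canonical_word n w = (SOME is. reduced_word n w is)"

lemma reduced_canonical_word: "w permutes {1..n} \<Longrightarrow> reduced_word n w (canonical_word n w)"
  unfolding canonical_word_def by (rule someI_ex[OF exists_reduced_word])

lemma TL_basis_eq: "w permutes {1..n} \<Longrightarrow> TL_basis n w = TL_class n (scaled_word 1 (canonical_word n w))"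
  using TL_word_eq[OF reduced_wordD(1)[OF reduced_canonical_word]]
  by (simp add: TL_basis_def canonical_word_def)

section \<open>The homomorphism lifted to the free algebra\<close>

definition theta_word :: "nat list \<Rightarrow> free_elt" where
  "theta_word is = foldr (\<lambda>i x. (free_gen i - 1) * x) is 1"

lemma theta_word_Nil [simp]: "theta_word [] = 1"
  by (simp add: theta_word_def)

lemma theta_word_Cons: "theta_word (i # is) = (free_gen i - 1) * theta_word is"
  by (simp add: theta_word_def)

lemma theta_word_append: "theta_word (is @ js) = theta_word is * theta_word js"
  by (induction "is") (simp_all add: theta_word_Cons mult.assoc)

lemma theta_word_mem: "set is \<subseteq> S \<Longrightarrow> theta_word is \<in> carrier (free_algebra S)"
proof (induction "is")
  case (Cons i "is")
  then have "free_gen i - 1 \<in> carrier (free_algebra S)"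
    using free_algebra_closed(4)[OF free_gen_mem_free_algebra free_algebra_one_zero(1)] by simp
  then show ?case using Cons free_algebra_closed(2) by (simp add: theta_word_Cons)
qed simp

lemma free_eval_add_fun: "free_eval (\<lambda>u. g u + h u) x = free_eval g x + free_eval h x"
  by (simp add: free_eval_def word_eval_def sum_list_addf distrib_left sum.distrib)

text \<open>The factor t_i - 1 undoes the smearing by 1 + s_i up to a translation by s_i. So
  functionals see only the product of the word, and words with equal product have the same
  class.\<close>

lemma free_eval_theta_word: "free_eval g (theta_word is) = g (word_perm is)"
proof (induction "is" arbitrary: g)
  case Nil
  show ?case
    using free_eval_scaled_word[of g "[]" 1, folded zero_free_mon_def]
    unfolding theta_word_Nil word_perm_Nil by (simp only: single_one word_eval_Nil mult_1_left)
next
  case (Cons i "is")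
  let ?h = "\<lambda>u. g (simple_refl i \<circ> u)" and ?x = "theta_word is"
  have "left_smear [i] g u = ?h u + g u" for u
    by (simp add: left_smear_def Let_def word_perm_Cons)
  then have smear: "left_smear [i] g = (\<lambda>u. ?h u + g u)" by (rule ext)
  have "free_eval g (free_gen i * ?x) = free_eval ?h ?x + free_eval g ?x"
    unfolding free_gen_def free_eval_word_mult_left smear free_eval_add_fun by (rule mult_1_left)
  then have "free_eval g (theta_word (i # is)) = free_eval ?h ?x"
    unfolding theta_word_Cons left_diff_distrib free_eval_diff mult_1_left by (simp only: add_diff_cancel_right')
  also have "\<dots> = g (simple_refl i \<circ> word_perm is)" by (rule Cons)
  finally show ?case unfolding word_perm_Cons .
qed

definition theta_elt :: "nat \<Rightarrow> (nat \<Rightarrow> nat) \<Rightarrow> free_elt" where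
  "theta_elt n u = theta_word (canonical_word n u)"

lemma theta_elt_mem: "u permutes {1..n} \<Longrightarrow> theta_elt n u \<in> carrier (free_algebra {1..n-1})"
  unfolding theta_elt_def by (rule theta_word_mem[OF reduced_wordD(1)[OF reduced_canonical_word]])

lemma free_eval_theta_elt: "u permutes {1..n} \<Longrightarrow> free_eval g (theta_elt n u) = g u"
  unfolding theta_elt_def free_eval_theta_word
  using reduced_wordD(2)[OF reduced_canonical_word[of u n]] by simp

lemma free_eval_theta_elt_mult:
  assumes "u permutes {1..n}" "v permutes {1..n}"
  shows "free_eval g (theta_elt n u * theta_elt n v) = g (u \<circ> v)"
  unfolding theta_elt_def theta_word_append[symmetric] free_eval_theta_word word_perm_append
  using reduced_wordD(2)[OF reduced_canonical_word[OF assms(1)]]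
    reduced_wordD(2)[OF reduced_canonical_word[OF assms(2)]] by simp

lemma const_commutes: "(x :: free_elt) * Poly_Mapping.single 0 c = Poly_Mapping.single 0 c * x"
proof -
  have "x \<in> carrier (free_algebra UNIV)" by simp
  then show ?thesis
    by (induction x rule: free_algebra_induct)
      (simp_all add: mult_single distrib_left distrib_right mult.commute)
qed

text \<open>Taken in the free algebra so that functionals can be evaluated on it directly; in
  general it is multiplicative only modulo \<open>TL_ideal\<close>.\<close>

definition theta_lift :: "nat \<Rightarrow> ((nat \<Rightarrow> nat) \<Rightarrow> complex) \<Rightarrow> free_elt" where
  "theta_lift n a = (\<Sum>u | u permutes {1..n}. Poly_Mapping.single 0 (a u) * theta_elt n u)"

lemma theta_lift_mem [simp]: "theta_lift n a \<in> carrier (free_algebra {1..n-1})"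
  unfolding theta_lift_def
  by (rule free_algebra_sum) (simp add: free_algebra_closed theta_elt_mem)

lemma free_eval_theta_lift:
  "free_eval g (theta_lift n a) = (\<Sum>u | u permutes {1..n}. a u * g u)"
  unfolding theta_lift_def free_eval_sum
  by (rule sum.cong) (simp_all add: free_eval_const_mult free_eval_theta_elt)

lemma free_eval_theta_lift_mult:
  "free_eval g (theta_lift n a * theta_lift n b)
    = (\<Sum>u | u permutes {1..n}. \<Sum>v | v permutes {1..n}. a u * b v * g (u \<circ> v))"
proof -
  have "theta_lift n a * theta_lift n b = (\<Sum>u | u permutes {1..n}. \<Sum>v | v permutes {1..n}.
      (Poly_Mapping.single 0 (a u) * theta_elt n u) * (Poly_Mapping.single 0 (b v) * theta_elt n v))"
    unfolding theta_lift_def sum_product ..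
  also have "\<dots> = (\<Sum>u | u permutes {1..n}. \<Sum>v | v permutes {1..n}.
      Poly_Mapping.single 0 (a u) * (Poly_Mapping.single 0 (b v) * (theta_elt n u * theta_elt n v)))"
    by (intro sum.cong refl) (metis const_commutes mult.assoc)
  finally have "free_eval g (theta_lift n a * theta_lift n b) = (\<Sum>u | u permutes {1..n}. \<Sum>v | v permutes {1..n}.
      a u * (b v * free_eval g (theta_elt n u * theta_elt n v)))"
    by (simp add: free_eval_sum free_eval_const_mult)
  also have "\<dots> = (\<Sum>u | u permutes {1..n}. \<Sum>v | v permutes {1..n}. a u * b v * g (u \<circ> v))"
    by (intro sum.cong refl) (simp add: free_eval_theta_elt_mult)
  finally show ?thesis .
qed

definition theta_hom :: "nat \<Rightarrow> ((nat \<Rightarrow> nat) \<Rightarrow> complex) \<Rightarrow> free_elt set" where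
  "theta_hom n = restrict (\<lambda>a. TL_class n (theta_lift n a)) (carrier (perm_algebra n))"

lemma theta_lift_perm_elt:
  "u permutes {1..n} \<Longrightarrow> free_eval g (theta_lift n (perm_elt u)) = g u"
  by (simp add: free_eval_theta_lift perm_elt_def if_distribR[of _ "(*)"] finite_permutations
      sum.delta if_distrib[of "\<lambda>x. x * _"] cong: if_cong)

lemma perm_elt_mem: "u permutes {1..n} \<Longrightarrow> perm_elt u \<in> carrier (perm_algebra n)"
  by (auto simp: perm_algebra_def perm_elt_def)

lemma perm_algebra_mult_mem:
  "a \<otimes>\<^bsub>perm_algebra n\<^esub> b \<in> carrier (perm_algebra n)"
proof -
  have "(a \<otimes>\<^bsub>perm_algebra n\<^esub> b) u = 0" if u: "\<not> u permutes {1..n}" for u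
  proof -
    have "{(v, w). v permutes {1..n} \<and> w permutes {1..n} \<and> v \<circ> w = u} = {}"
      using u permutes_compose by fastforce
    then show ?thesis by (simp only: perm_algebra_def monoid.simps sum.empty)
  qed
  then show ?thesis by (simp add: perm_algebra_def)
qed

lemma sum_perm_algebra_mult:
  fixes g :: "(nat \<Rightarrow> nat) \<Rightarrow> complex"
  shows "(\<Sum>u | u permutes {1..n}. (a \<otimes>\<^bsub>perm_algebra n\<^esub> b) u * g u)
    = (\<Sum>u | u permutes {1..n}. \<Sum>v | v permutes {1..n}. a u * b v * g (u \<circ> v))"
proof -
  define P where "P = {u. u permutes {1..n}}"
  have P: "finite P" by (simp add: P_def finite_permutations)
  have "(\<Sum>u\<in>P. (a \<otimes>\<^bsub>perm_algebra n\<^esub> b) u * g u)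
      = (\<Sum>u\<in>P. \<Sum>x\<in>{x \<in> P \<times> P. fst x \<circ> snd x = u}. a (fst x) * b (snd x) * g (fst x \<circ> snd x))"
  proof (rule sum.cong[OF refl])
    fix u
    have "{(v, w). v permutes {1..n} \<and> w permutes {1..n} \<and> v \<circ> w = u} = {x \<in> P \<times> P. fst x \<circ> snd x = u}"
      by (auto simp: P_def)
    then show "(a \<otimes>\<^bsub>perm_algebra n\<^esub> b) u * g u
        = (\<Sum>x\<in>{x \<in> P \<times> P. fst x \<circ> snd x = u}. a (fst x) * b (snd x) * g (fst x \<circ> snd x))"
      by (simp add: perm_algebra_def sum_distrib_right case_prod_beta)
  qed
  also have "\<dots> = (\<Sum>x\<in>P \<times> P. a (fst x) * b (snd x) * g (fst x \<circ> snd x))"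
  proof (rule sum.group)
    show "(\<lambda>x. fst x \<circ> snd x) ` (P \<times> P) \<subseteq> P"
      by (auto simp: P_def intro: permutes_compose)
  qed (use P in auto)
  also have "\<dots> = (\<Sum>u\<in>P. \<Sum>v\<in>P. a u * b v * g (u \<circ> v))"
    by (simp add: sum.cartesian_product case_prod_beta)
  finally show ?thesis unfolding P_def .
qed

text \<open>By \<open>TL_class_eq_iff\<close> each law becomes an identity between sums of values of
  an arbitrary \<open>g\<close>; for products both sides are the sum of
  \<open>a u * b v * g (u \<circ> v)\<close>.\<close>

lemma theta_hom_alg_hom: "theta_hom n \<in> alg_hom (perm_algebra n) (TL n)"
proof -
  note iff = TL_class_eq_iff[OF theta_lift_mem]
  have mult: "TL_class n (theta_lift n (a \<otimes>\<^bsub>perm_algebra n\<^esub> b))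
      = TL_class n (theta_lift n a) \<otimes>\<^bsub>TL n\<^esub> TL_class n (theta_lift n b)" for a b
    by (simp add: TL_mult iff free_algebra_closed free_eval_theta_lift_mult free_eval_theta_lift
        sum_perm_algebra_mult del: comp_apply)
  have add: "TL_class n (theta_lift n (a \<oplus>\<^bsub>perm_algebra n\<^esub> b))
      = TL_class n (theta_lift n a) \<oplus>\<^bsub>TL n\<^esub> TL_class n (theta_lift n b)" for a b
    by (simp add: TL_add iff free_algebra_closed free_eval_add free_eval_theta_lift)
      (simp add: perm_algebra_def distrib_right sum.distrib)
  have one_eq: "\<one>\<^bsub>perm_algebra n\<^esub> = perm_elt id"
    by (simp add: perm_algebra_def perm_elt_def)
  have "free_eval g 1 = g id" for g using free_eval_theta_word[of g "[]"] by simp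
  then have one: "TL_class n (theta_lift n \<one>\<^bsub>perm_algebra n\<^esub>) = \<one>\<^bsub>TL n\<^esub>"
    unfolding one_eq TL_one iff[OF free_algebra_one_zero(1)]
    by (simp add: theta_lift_perm_elt[OF permutes_id])
  have smult: "TL_class n (theta_lift n (c \<odot>\<^bsub>perm_algebra n\<^esub> a)) = c \<odot>\<^bsub>TL n\<^esub> TL_class n (theta_lift n a)" for c a
    by (simp add: TL_smult iff free_algebra_closed free_eval_const_mult free_eval_theta_lift)
      (simp add: perm_algebra_def sum_distrib_left mult.assoc)
  have mem: "a \<oplus>\<^bsub>perm_algebra n\<^esub> b \<in> carrier (perm_algebra n)" "c \<odot>\<^bsub>perm_algebra n\<^esub> a \<in> carrier (perm_algebra n)"
    if "a \<in> carrier (perm_algebra n)" "b \<in> carrier (perm_algebra n)" for a b c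
    using that by (simp_all add: perm_algebra_def)
  have "\<one>\<^bsub>perm_algebra n\<^esub> \<in> carrier (perm_algebra n)"
    unfolding one_eq by (rule perm_elt_mem[OF permutes_id])
  then show ?thesis
    unfolding alg_hom_def theta_hom_def
    by (auto intro!: ring_hom_memI simp: perm_algebra_mult_mem mem mult add one smult)
qed

lemma perm_elt_mult:
  assumes "u permutes {1..n}" "v permutes {1..n}"
  shows "perm_elt u \<otimes>\<^bsub>perm_algebra n\<^esub> perm_elt v = perm_elt (u \<circ> v)"
proof
  fix x
  have "(perm_elt u \<otimes>\<^bsub>perm_algebra n\<^esub> perm_elt v) x =
      (\<Sum>p\<in>{(a, b). a permutes {1..n} \<and> b permutes {1..n} \<and> a \<circ> b = x}. if p = (u, v) then 1 else 0)"
    by (simp add: perm_algebra_def perm_elt_def) (rule sum.cong, auto split: if_splits)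
  also have "\<dots> = (if x = u \<circ> v then 1 else 0)"
  proof -
    have "finite {(a, b). a permutes {1..n} \<and> b permutes {1..n} \<and> a \<circ> b = x}"
      by (rule finite_subset[of _ "{a. a permutes {1..n}} \<times> {b. b permutes {1..n}}"])
        (auto simp: finite_permutations)
    then show ?thesis using assms by (subst sum.delta) auto
  qed
  finally show "(perm_elt u \<otimes>\<^bsub>perm_algebra n\<^esub> perm_elt v) x = perm_elt (u \<circ> v) x"
    by (simp add: perm_elt_def)
qed

text \<open>Products of simple reflections exhaust the group, and \<open>a\<close> is a finite
  combination of permutations. The truncations \<open>cut A\<close> assemble \<open>a\<close> from
  one permutation at a time.\<close>

lemma alg_hom_unique:
  assumes h: "h \<in> alg_hom (perm_algebra n) (TL n)" and k: "k \<in> alg_hom (perm_algebra n) (TL n)"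
    and gens: "\<And>i. i \<in> {1..n-1} \<Longrightarrow> h (perm_elt (simple_refl i)) = k (perm_elt (simple_refl i))"
    and a: "a \<in> carrier (perm_algebra n)"
  shows "h a = k a"
proof -
  have hr: "h \<in> ring_hom (perm_algebra n) (TL n)" and kr: "k \<in> ring_hom (perm_algebra n) (TL n)"
    and hs: "\<And>c a. a \<in> carrier (perm_algebra n) \<Longrightarrow> h (c \<odot>\<^bsub>perm_algebra n\<^esub> a) = c \<odot>\<^bsub>TL n\<^esub> h a"
    and ks: "\<And>c a. a \<in> carrier (perm_algebra n) \<Longrightarrow> k (c \<odot>\<^bsub>perm_algebra n\<^esub> a) = c \<odot>\<^bsub>TL n\<^esub> k a"
    using h k unfolding alg_hom_def by blast+
  have words: "h (perm_elt (word_perm is)) = k (perm_elt (word_perm is))" if "set is \<subseteq> {1..n-1}" for "is"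
    using that
  proof (induction "is")
    case Nil
    have "perm_elt id = \<one>\<^bsub>perm_algebra n\<^esub>" by (simp add: perm_algebra_def perm_elt_def)
    then show ?case unfolding word_perm_Nil by (simp only: ring_hom_one[OF hr] ring_hom_one[OF kr])
  next
    case (Cons i "is")
    then have i: "i \<in> {1..n-1}" and set: "set is \<subseteq> {1..n-1}" by simp_all
    have mem: "perm_elt (simple_refl i) \<in> carrier (perm_algebra n)"
        "perm_elt (word_perm is) \<in> carrier (perm_algebra n)"
      using perm_elt_mem[OF simple_refl_permutes[OF i]] perm_elt_mem[OF word_perm_permutes[OF set]] .
    have "perm_elt (word_perm (i # is)) = perm_elt (simple_refl i) \<otimes>\<^bsub>perm_algebra n\<^esub> perm_elt (word_perm is)"
      using perm_elt_mult[OF simple_refl_permutes[OF i] word_perm_permutes[OF set]]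
      by (simp add: word_perm_Cons)
    then show ?case
      using ring_hom_mult[OF hr mem] ring_hom_mult[OF kr mem] gens[OF i] Cons(1)[OF set] by simp
  qed
  have perms: "h (perm_elt u) = k (perm_elt u)" if "u permutes {1..n}" for u
    using words[OF reduced_wordD(1)[OF reduced_canonical_word[OF that]]]
      reduced_wordD(2)[OF reduced_canonical_word[OF that]] by simp
  define cut where "cut A = (\<lambda>u. if u \<in> A then a u else 0)" for A
  have cut_mem: "cut A \<in> carrier (perm_algebra n)" for A
    using a by (auto simp: cut_def perm_algebra_def)
  have "h (cut A) = k (cut A)" if "finite A" "A \<subseteq> {u. u permutes {1..n}}" for A
    using that
  proof (induction A)
    case empty
    \<comment> \<open>\<open>ring_hom\<close> does not list preservation of zero; it comes from the
      scalar action.\<close>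
    have "cut {} = 0 \<odot>\<^bsub>perm_algebra n\<^esub> perm_elt id" by (simp add: cut_def perm_algebra_def)
    then show ?case
      using hs[OF perm_elt_mem[OF permutes_id]] ks[OF perm_elt_mem[OF permutes_id]]
        perms[OF permutes_id] by simp
  next
    case (insert u A)
    have u: "u permutes {1..n}" using insert(4) by blast
    have smult_mem: "a u \<odot>\<^bsub>perm_algebra n\<^esub> perm_elt u \<in> carrier (perm_algebra n)"
      using u by (auto simp: perm_algebra_def perm_elt_def)
    have "cut (insert u A) = cut A \<oplus>\<^bsub>perm_algebra n\<^esub> (a u \<odot>\<^bsub>perm_algebra n\<^esub> perm_elt u)"
      using insert(2) by (intro ext) (auto simp: cut_def perm_algebra_def perm_elt_def)
    then show ?case
      using ring_hom_add[OF hr cut_mem smult_mem] ring_hom_add[OF kr cut_mem smult_mem]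
        hs[OF perm_elt_mem[OF u]] ks[OF perm_elt_mem[OF u]] perms[OF u] insert by simp
  qed
  from this[OF finite_permutations[OF finite_atLeastAtMost] order_refl]
  have "h (cut {u. u permutes {1..n}}) = k (cut {u. u permutes {1..n}})" .
  moreover have "cut {u. u permutes {1..n}} = a" using a by (auto simp: cut_def perm_algebra_def)
  ultimately show ?thesis by simp
qed

lemma theta_hom_gen:
  assumes "i \<in> {1..n-1}"
  shows "theta_hom n (perm_elt (simple_refl i)) = TL_gen n i \<ominus>\<^bsub>TL n\<^esub> \<one>\<^bsub>TL n\<^esub>"
proof -
  have gen: "free_gen i \<in> carrier (free_algebra {1..n-1})" by (rule free_gen_mem_free_algebra[OF assms])
  have diff: "free_gen i - 1 \<in> carrier (free_algebra {1..n-1})"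
    using free_algebra_closed(4)[OF gen free_algebra_one_zero(1)] .
  have "free_eval g (free_gen i - 1) = g (simple_refl i)" for g
    using free_eval_theta_word[of g "[i]"] by (simp add: theta_word_Cons word_perm_Cons)
  then have "TL_class n (theta_lift n (perm_elt (simple_refl i))) = TL_class n (free_gen i - 1)"
    unfolding TL_class_eq_iff[OF theta_lift_mem diff]
    by (simp add: theta_lift_perm_elt[OF simple_refl_permutes[OF assms]])
  then show ?thesis
    using perm_elt_mem[OF simple_refl_permutes[OF assms]] TL_minus[OF gen free_algebra_one_zero(1)]
    by (simp add: theta_hom_def TL_gen_eq TL_one)
qed

lemma theta_eq: "theta n = theta_hom n"
  unfolding theta_def
proof (rule the_equality)
  show "theta_hom n \<in> extensional (carrier (perm_algebra n)) \<and>
      theta_hom n \<in> alg_hom (perm_algebra n) (TL n) \<and>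
      (\<forall>i\<in>{1..n-1}. theta_hom n (perm_elt (simple_refl i)) = TL_gen n i \<ominus>\<^bsub>TL n\<^esub> \<one>\<^bsub>TL n\<^esub>)"
    using theta_hom_alg_hom theta_hom_gen by (simp add: theta_hom_def)
next
  fix h assume h: "h \<in> extensional (carrier (perm_algebra n)) \<and>
      h \<in> alg_hom (perm_algebra n) (TL n) \<and>
      (\<forall>i\<in>{1..n-1}. h (perm_elt (simple_refl i)) = TL_gen n i \<ominus>\<^bsub>TL n\<^esub> \<one>\<^bsub>TL n\<^esub>)"
  show "h = theta_hom n"
  proof (rule extensionalityI)
    show "h \<in> extensional (carrier (perm_algebra n))" using h by blast
    show "theta_hom n \<in> extensional (carrier (perm_algebra n))" by (simp add: theta_hom_def)
    fix a assume a: "a \<in> carrier (perm_algebra n)"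
    show "h a = theta_hom n a"
    proof (rule alg_hom_unique[OF _ theta_hom_alg_hom])
      show "h (perm_elt (simple_refl i)) = theta_hom n (perm_elt (simple_refl i))" if "i \<in> {1..n-1}" for i
        unfolding theta_hom_gen[OF that] using h that by blast
    qed (use h a in blast)+
  qed
qed

lemma theta_perm_elt:
  assumes "u permutes {1..n}"
  shows "theta n (perm_elt u) = TL_class n (theta_elt n u)"
proof -
  have "TL_class n (theta_lift n (perm_elt u)) = TL_class n (theta_elt n u)"
    unfolding TL_class_eq_iff[OF theta_lift_mem theta_elt_mem[OF assms]]
    by (simp add: theta_lift_perm_elt[OF assms] free_eval_theta_elt[OF assms])
  then show ?thesis using perm_elt_mem[OF assms] by (simp add: theta_eq theta_hom_def)
qed

section \<open>Patterns\<close>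

lemma one_line_permutes:
  assumes "distinct xs" "set xs = {1..length xs}"
  shows "one_line xs permutes {1..length xs}"
proof (rule bij_imp_permutes)
  have "bij_betw (\<lambda>i. i - 1) {1..length xs} {..<length xs}"
    by (rule bij_betw_byWitness[where f' = Suc]) auto
  moreover have "bij_betw ((!) xs) {..<length xs} {1..length xs}"
    using bij_betw_nth[OF assms(1) refl assms(2)[symmetric]] .
  ultimately have "bij_betw ((!) xs \<circ> (\<lambda>i. i - 1)) {1..length xs} {1..length xs}"
    by (rule bij_betw_trans)
  then show "bij_betw (one_line xs) {1..length xs} {1..length xs}"
    by (rule bij_betw_cong[THEN iffD1, rotated]) (simp add: one_line_def)
qed (auto simp: one_line_def)

lemma nth_sorted_list_less:
  assumes "x < length (sorted_list_of_set A)" "y < length (sorted_list_of_set A)"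
  shows "sorted_list_of_set A ! x < sorted_list_of_set A ! y \<longleftrightarrow> x < (y::nat)"
proof -
  have "sorted_wrt (<) (sorted_list_of_set A)" by simp
  then have "sorted_list_of_set A ! i < sorted_list_of_set A ! j" if "i < j" "j < length (sorted_list_of_set A)" for i j
    using that by (rule sorted_wrt_nth_less)
  from this[of x y] this[of y x] assms show ?thesis by (cases x y rule: linorder_cases) auto
qed

text \<open>Replaces \<open>kth_smallest\<close> by a list of positions. Values are entries of the
  sorted image, so comparing them amounts to comparing indices, which are the entries of the pattern
  minus one.\<close>

lemma pattern_occurrence:
  assumes "inj w" "I \<subseteq> {1..n}" "card I = length xs" "restricts_to w I (one_line xs)"
    and xs: "set xs = {1..length xs}"
  obtains ps where "length ps = length xs" "sorted_wrt (<) ps" "set ps \<subseteq> {1..n}"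
    "\<And>i j. i < length xs \<Longrightarrow> j < length xs \<Longrightarrow> w (ps ! i) < w (ps ! j) \<longleftrightarrow> xs ! i < xs ! j"
proof -
  have fin: "finite I" using assms(2) finite_subset by blast
  define ps where "ps = sorted_list_of_set I"
  have card_img: "card (w ` I) = length xs"
    using card_image[OF inj_on_subset[OF assms(1)], of I] assms(3) by simp
  have len: "length ps = length xs" "length (sorted_list_of_set (w ` I)) = length xs"
    unfolding ps_def using fin assms(3) card_img by simp_all
  have val: "w (ps ! i) = sorted_list_of_set (w ` I) ! (xs ! i - 1)" if "i < length xs" for i
  proof -
    have "Suc i \<in> {1..card I}" using that assms(3) by simp
    then have "w (kth_smallest I (Suc i)) = kth_smallest (w ` I) (one_line xs (Suc i))"
      using assms(4) unfolding restricts_to_def by blast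
    then show ?thesis using that by (simp add: kth_smallest_def one_line_def ps_def)
  qed
  have range: "xs ! i \<in> {1..length xs}" if "i < length xs" for i
    using xs nth_mem[OF that] by blast
  have "w (ps ! i) < w (ps ! j) \<longleftrightarrow> xs ! i < xs ! j" if "i < length xs" "j < length xs" for i j
  proof -
    have "xs ! i - 1 < length (sorted_list_of_set (w ` I))" "xs ! j - 1 < length (sorted_list_of_set (w ` I))"
      using range[OF that(1)] range[OF that(2)] len(2) by auto
    from nth_sorted_list_less[OF this] show ?thesis
      unfolding val[OF that(1)] val[OF that(2)] using range[OF that(1)] range[OF that(2)] by auto
  qed
  then show thesis using len(1) fin assms(2) by (intro that[of ps]) (simp_all add: ps_def)
qed

text \<open>The way back: \<open>ps\<close> and \<open>qs\<close> list the positions and the values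
  of an occurrence, each in increasing order.\<close>

lemma restricts_toI:
  assumes "set xs = {1..length xs}" "distinct xs" "length ps = length xs" "length qs = length xs"
    "sorted_wrt (<) ps" "sorted_wrt (<) qs" and "w ` set ps = set qs"
    and val: "\<And>i. i < length xs \<Longrightarrow> w (ps ! i) = qs ! (xs ! i - 1)"
  shows "card (set ps) = length xs \<and> restricts_to w (set ps) (one_line xs)"
proof -
  have dist: "distinct ps" "distinct qs" and sorted: "sorted ps" "sorted qs"
    using assms(5,6) by (simp_all add: strict_sorted_iff)
  have eq: "sorted_list_of_set (set ps) = ps" "sorted_list_of_set (set qs) = qs"
    using sorted_list_of_set.idem_if_sorted_distinct[OF sorted(1) dist(1)]
      sorted_list_of_set.idem_if_sorted_distinct[OF sorted(2) dist(2)] .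
  have card: "card (set ps) = length xs" using distinct_card[OF dist(1)] assms(3) by simp
  have "w (kth_smallest (set ps) i) = kth_smallest (w ` set ps) (one_line xs i)"
    if i: "i \<in> {1..card (set ps)}" for i
  proof -
    have "i - 1 < length xs" "i \<in> {1..length xs}" using i card by auto
    then show ?thesis
      using val[of "i - 1"] by (simp add: kth_smallest_def assms(7) eq one_line_def)
  qed
  then show ?thesis
    unfolding restricts_to_def using card one_line_permutes[OF assms(2,1)] by simp
qed

lemma avoids_321_iff:
  assumes w: "w permutes {1..n}"
  shows "avoids n w [3, 2, 1] \<longleftrightarrow> \<not> has_321 n w"
proof -
  have set: "set [3, 2, 1::nat] = {1..length [3, 2, 1::nat]}" by auto
  have "has_321 n w" if I: "I \<subseteq> {1..n}" "card I = length [3, 2, 1::nat]" "restricts_to w I (one_line [3, 2, 1])" for I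
  proof -
    obtain ps where ps: "length ps = length [3, 2, 1::nat]" "sorted_wrt (<) ps" "set ps \<subseteq> {1..n}"
      and lt: "\<And>i j. i < length [3, 2, 1::nat] \<Longrightarrow> j < length [3, 2, 1::nat] \<Longrightarrow>
        w (ps ! i) < w (ps ! j) \<longleftrightarrow> [3, 2, 1::nat] ! i < [3, 2, 1::nat] ! j"
      using pattern_occurrence[OF permutes_inj[OF w] I set] by blast
    obtain a b c where abc: "ps = [a, b, c]"
      using ps(1) by (auto simp: length_Suc_conv numeral_eq_Suc)
    have "w c < w b" "w b < w a"
      using lt[of 2 1] lt[of 1 0] unfolding abc by (simp_all add: numeral_eq_Suc)
    then have "(a, b) \<in> inversions n w" "(b, c) \<in> inversions n w"
      using ps unfolding abc by (simp_all add: inversions_def)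
    then show ?thesis unfolding has_321_def by blast
  qed
  moreover have "\<exists>I. I \<subseteq> {1..n} \<and> card I = length [3, 2, 1::nat] \<and> restricts_to w I (one_line [3, 2, 1])"
    if has: "has_321 n w"
  proof -
    obtain a b c where "(a, b) \<in> inversions n w" "(b, c) \<in> inversions n w"
      using has unfolding has_321_def by blast
    then have abc: "a < b" "b < c" "w c < w b" "w b < w a" "{a, b, c} \<subseteq> {1..n}"
      by (auto simp: inversions_def)
    have "card (set [a, b, c]) = length [3, 2, 1::nat] \<and> restricts_to w (set [a, b, c]) (one_line [3, 2, 1])"
    proof (rule restricts_toI[OF set, where qs = "[w c, w b, w a]"])
      fix i assume "i < length [3, 2, 1::nat]"
      then have "i = 0 \<or> i = 1 \<or> i = 2" by auto
      then show "w ([a, b, c] ! i) = [w c, w b, w a] ! ([3, 2, 1] ! i - 1)"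
        by (elim disjE) (simp_all add: numeral_eq_Suc)
    qed (use abc in auto)
    then show ?thesis using abc(5) by (intro exI[of _ "{a, b, c}"]) simp
  qed
  ultimately show ?thesis unfolding avoids_def by blast
qed

text \<open>The conditional lets a single proof serve both patterns of length four.\<close>

lemma avoids_four_iff:
  assumes w: "w permutes {1..n}" and xs: "xs = [1, 3, 2, 4] \<or> xs = [2, 1, 4, 3]"
  shows "avoids n w xs \<longleftrightarrow> \<not> (\<exists>a b c d. a < b \<and> b < c \<and> c < d \<and> {a, b, c, d} \<subseteq> {1..n} \<and>
    (if xs = [1, 3, 2, 4] then w a < w c \<and> w c < w b \<and> w b < w d
     else w b < w a \<and> w a < w d \<and> w d < w c))" (is "_ \<longleftrightarrow> \<not> ?occ")
proof -
  have set: "set xs = {1..length xs}" "distinct xs" "length xs = 4" using xs by auto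
  have fwd: "?occ" if I: "I \<subseteq> {1..n}" "card I = length xs" "restricts_to w I (one_line xs)" for I
  proof -
    obtain ps where ps: "length ps = length xs" "sorted_wrt (<) ps" "set ps \<subseteq> {1..n}"
      and lt: "\<And>i j. i < length xs \<Longrightarrow> j < length xs \<Longrightarrow> w (ps ! i) < w (ps ! j) \<longleftrightarrow> xs ! i < xs ! j"
      using pattern_occurrence[OF permutes_inj[OF w] I set(1)] by blast
    obtain a b c d where abcd: "ps = [a, b, c, d]"
      using ps(1) set(3) by (auto simp: length_Suc_conv numeral_eq_Suc)
    have "if xs = [1, 3, 2, 4] then w a < w c \<and> w c < w b \<and> w b < w d
       else w b < w a \<and> w a < w d \<and> w d < w c"
      using lt[of 0 2] lt[of 2 1] lt[of 1 3] lt[of 1 0] lt[of 0 3] lt[of 3 2] xs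
      unfolding abcd by (auto simp: numeral_eq_Suc)
    then show ?thesis using ps unfolding abcd by (intro exI[of _ a] exI[of _ b] exI[of _ c] exI[of _ d]) simp
  qed
  have bwd: "\<exists>I. I \<subseteq> {1..n} \<and> card I = length xs \<and> restricts_to w I (one_line xs)" if occ: ?occ
  proof -
    obtain a b c d where abcd: "a < b" "b < c" "c < d" "{a, b, c, d} \<subseteq> {1..n}"
      and ord: "if xs = [1, 3, 2, 4] then w a < w c \<and> w c < w b \<and> w b < w d
        else w b < w a \<and> w a < w d \<and> w d < w c" using occ by blast
    define qs where "qs = (if xs = [1, 3, 2, 4] then [w a, w c, w b, w d] else [w b, w a, w d, w c])"
    have "card (set [a, b, c, d]) = length xs \<and> restricts_to w (set [a, b, c, d]) (one_line xs)"
    proof (rule restricts_toI[OF set(1,2), where qs = qs])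
      fix i assume "i < length xs"
      then have "i = 0 \<or> i = 1 \<or> i = 2 \<or> i = 3" using set(3) by auto
      then show "w ([a, b, c, d] ! i) = qs ! (xs ! i - 1)"
        using xs by (elim disjE) (simp_all add: qs_def numeral_eq_Suc)
    qed (use abcd ord set(3) in \<open>auto simp: qs_def split: if_splits\<close>)
    then show ?thesis using abcd(4) by (intro exI[of _ "{a, b, c, d}"]) simp
  qed
  have "(\<exists>I. I \<subseteq> {1..n} \<and> card I = length xs \<and> restricts_to w I (one_line xs)) \<longleftrightarrow> ?occ"
    by (rule iffI, elim exE conjE, rule fwd, assumption+, rule bwd)
  then show ?thesis unfolding avoids_def by (rule arg_cong)
qed

definition has_1324 :: "nat \<Rightarrow> (nat \<Rightarrow> nat) \<Rightarrow> bool" where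
  "has_1324 n w \<longleftrightarrow> (\<exists>a b c d. a < b \<and> b < c \<and> c < d \<and> {a, b, c, d} \<subseteq> {1..n} \<and>
    w a < w c \<and> w c < w b \<and> w b < w d)"

definition has_2143 :: "nat \<Rightarrow> (nat \<Rightarrow> nat) \<Rightarrow> bool" where
  "has_2143 n w \<longleftrightarrow> (\<exists>a b c d. a < b \<and> b < c \<and> c < d \<and> {a, b, c, d} \<subseteq> {1..n} \<and>
    w b < w a \<and> w a < w d \<and> w d < w c)"

lemma avoids_1324_iff: "w permutes {1..n} \<Longrightarrow> avoids n w [1, 3, 2, 4] \<longleftrightarrow> \<not> has_1324 n w"
  using avoids_four_iff[of w n "[1, 3, 2, 4]"] by (simp add: has_1324_def)

lemma avoids_2143_iff: "w permutes {1..n} \<Longrightarrow> avoids n w [2, 1, 4, 3] \<longleftrightarrow> \<not> has_2143 n w"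
  using avoids_four_iff[of w n "[2, 1, 4, 3]"] by (simp add: has_2143_def)

lemma perms_avoiding_321_eq: "perms_avoiding_321 n = avoiders n"
  unfolding perms_avoiding_321_def using avoids_321_iff by blast

section \<open>Coefficients of Temperley-Lieb immanants\<close>

lemma reduced_canonical_word_avoiders: "w \<in> avoiders n \<Longrightarrow> reduced_word n w (canonical_word n w)"
  by (rule reduced_canonical_word) blast

lemma TL_combination:
  "(\<Oplus>\<^bsub>TL n\<^esub>w\<in>perms_avoiding_321 n. f w \<odot>\<^bsub>TL n\<^esub> TL_basis n w)
    = TL_class n (\<Sum>w\<in>avoiders n. scaled_word (f w) (canonical_word n w))"
proof -
  interpret abelian_group "TL n" by (rule abelian_group_TL)
  have mem: "scaled_word c (canonical_word n w) \<in> carrier (free_algebra {1..n-1})" if "w \<in> avoiders n" for w c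
    by (rule scaled_word_mem_free_algebra[OF reduced_wordD(1)[OF reduced_canonical_word_avoiders[OF that]]])
  have "(\<Oplus>\<^bsub>TL n\<^esub>w\<in>perms_avoiding_321 n. f w \<odot>\<^bsub>TL n\<^esub> TL_basis n w)
      = (\<Oplus>\<^bsub>TL n\<^esub>w\<in>avoiders n. f w \<odot>\<^bsub>TL n\<^esub> TL_class n (scaled_word 1 (canonical_word n w)))"
  proof (rule finsum_cong'[OF perms_avoiding_321_eq])
    fix w assume w: "w \<in> avoiders n"
    then show "f w \<odot>\<^bsub>TL n\<^esub> TL_basis n w = f w \<odot>\<^bsub>TL n\<^esub> TL_class n (scaled_word 1 (canonical_word n w))"
      using TL_basis_eq[of w n] by simp
  next
    show "(\<lambda>w. f w \<odot>\<^bsub>TL n\<^esub> TL_class n (scaled_word 1 (canonical_word n w))) \<in> avoiders n \<rightarrow> carrier (TL n)"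
    proof (rule Pi_I)
      fix w assume w: "w \<in> avoiders n"
      show "f w \<odot>\<^bsub>TL n\<^esub> TL_class n (scaled_word 1 (canonical_word n w)) \<in> carrier (TL n)"
        unfolding TL_smult[OF mem[OF w]]
        by (rule TL_class_mem[OF free_algebra_closed(2)[OF const_mem_free_algebra mem[OF w]]])
    qed
  qed
  also have "\<dots> = TL_class n (\<Sum>w\<in>avoiders n. Poly_Mapping.single 0 (f w) * scaled_word 1 (canonical_word n w))"
    by (rule TL_finsum[OF finite_avoiders mem])
  finally show ?thesis by (simp add: const_mult_scaled_word)
qed

text \<open>Spanning gives existence and independence gives uniqueness, so the definite description
  denotes the coordinates. They are recorded in the form in which functionals see them.\<close>

lemma TL_coords:
  assumes x: "x \<in> carrier (free_algebra {1..n-1})" and g: "g \<in> TL_functions n"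
  shows "free_eval g x = (\<Sum>w\<in>avoiders n. TL_coords n (TL_class n x) w * word_eval g (canonical_word n w))"
proof -
  let ?P = "\<lambda>f. f \<in> extensional (perms_avoiding_321 n) \<and>
     TL_class n x = (\<Oplus>\<^bsub>TL n\<^esub>w\<in>perms_avoiding_321 n. f w \<odot>\<^bsub>TL n\<^esub> TL_basis n w)"
  have mem: "(\<Sum>w\<in>avoiders n. scaled_word (f w) (canonical_word n w)) \<in> carrier (free_algebra {1..n-1})" for f
    by (rule free_algebra_sum)
      (rule scaled_word_mem_free_algebra[OF reduced_wordD(1)[OF reduced_canonical_word_avoiders]])
  have P_iff: "?P f \<longleftrightarrow> f \<in> extensional (avoiders n) \<and>
      (\<forall>g\<in>TL_functions n. free_eval g x = (\<Sum>w\<in>avoiders n. f w * word_eval g (canonical_word n w)))" for f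
    unfolding TL_combination unfolding TL_class_eq_iff[OF x mem] perms_avoiding_321_eq
    by (simp add: free_eval_sum)
  have "\<exists>!f. ?P f"
  proof (rule ex_ex1I)
    obtain c where c: "x - (\<Sum>w\<in>avoiders n. scaled_word (c w) (canonical_word n w)) \<in> TL_ideal n"
      using spanning[OF reduced_canonical_word_avoiders x] by blast
    have "free_eval h x = (\<Sum>w\<in>avoiders n. c w * word_eval h (canonical_word n w))"
      if "h \<in> TL_functions n" for h
    proof -
      have "free_eval h (x - (\<Sum>w\<in>avoiders n. scaled_word (c w) (canonical_word n w))) = 0"
        using c that unfolding TL_ideal_eq_annihilator TL_annihilator_def by blast
      then show ?thesis by (simp add: free_eval_diff free_eval_sum)
    qed
    moreover have "(\<Sum>w\<in>avoiders n. restrict c (avoiders n) w * word_eval h (canonical_word n w))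
        = (\<Sum>w\<in>avoiders n. c w * word_eval h (canonical_word n w))" for h
      by (rule sum.cong[OF refl]) (simp only: restrict_apply')
    ultimately have "restrict c (avoiders n) \<in> extensional (avoiders n) \<and>
      (\<forall>g\<in>TL_functions n. free_eval g x
        = (\<Sum>w\<in>avoiders n. restrict c (avoiders n) w * word_eval g (canonical_word n w)))"
      by (simp only: restrict_extensional) blast
    from P_iff[THEN iffD2, OF this] show "\<exists>f. ?P f" by (rule exI[of ?P])
  next
    fix f f' assume "?P f" "?P f'"
    note f = this[unfolded P_iff]
    have ext: "f \<in> extensional (avoiders n)" "f' \<in> extensional (avoiders n)"
      using f by blast+
    have eq: "(\<Sum>w\<in>avoiders n. f w * word_eval h (canonical_word n w))
        = (\<Sum>w\<in>avoiders n. f' w * word_eval h (canonical_word n w))" if "h \<in> TL_functions n" for h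
      using bspec[OF conjunct2[OF f(1)] that] bspec[OF conjunct2[OF f(2)] that] by (rule trans[OF sym])
    show "f = f'"
    proof (rule extensionalityI[OF ext])
      fix w assume w: "w \<in> avoiders n"
      have "f w - f' w = 0"
      proof (rule coefficients_unique[OF reduced_canonical_word_avoiders _ w, where c = "\<lambda>w. f w - f' w"])
        fix h assume "h \<in> TL_functions n"
        from eq[OF this] show "(\<Sum>w\<in>avoiders n. (f w - f' w) * word_eval h (canonical_word n w)) = 0"
          by (simp add: left_diff_distrib sum_subtractf)
      qed
      then show "f w = f' w" by simp
    qed
  qed
  from theI'[OF this] have "?P (TL_coords n (TL_class n x))" unfolding TL_coords_def .
  from bspec[OF conjunct2[OF this[unfolded P_iff]] g] show ?thesis .
qed

text \<open>A functional applied to the expansion of \<theta>(u). What follows about the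
  coefficients comes from suitable choices of \<open>g\<close>.\<close>

lemma TL_coeff_expansion:
  assumes "u permutes {1..n}" "g \<in> TL_functions n"
  shows "g u = (\<Sum>w\<in>avoiders n. TL_coeff n w u * word_eval g (canonical_word n w))"
  using TL_coords[OF theta_elt_mem[OF assms(1)] assms(2)]
  by (simp add: TL_coeff_def theta_perm_elt[OF assms(1)] free_eval_theta_elt[OF assms(1)])

text \<open>Summing the expansion of an arbitrary \<open>g\<close> over a symmetrizer gives zero;
  independence then makes the sum of each single coefficient function vanish.\<close>

lemma TL_coeff_TL_functions:
  assumes w: "w \<in> avoiders n"
  shows "TL_coeff n w \<in> TL_functions n"
proof (rule TL_functionsI)
  fix T and a b :: "nat \<Rightarrow> nat"
  assume T: "T \<subseteq> {1..n}" "card T = 3" and ab: "a permutes {1..n}" "b permutes {1..n}"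
  show "(\<Sum>v | v permutes T. TL_coeff n w (a \<circ> v \<circ> b)) = 0"
  proof (rule coefficients_unique[OF reduced_canonical_word_avoiders _ w,
        where c = "\<lambda>x. \<Sum>v | v permutes T. TL_coeff n x (a \<circ> v \<circ> b)"])
    fix g assume g: "g \<in> TL_functions n"
    have "(\<Sum>x\<in>avoiders n. (\<Sum>v | v permutes T. TL_coeff n x (a \<circ> v \<circ> b)) * word_eval g (canonical_word n x))
        = (\<Sum>v | v permutes T. \<Sum>x\<in>avoiders n. TL_coeff n x (a \<circ> v \<circ> b) * word_eval g (canonical_word n x))"
      unfolding sum_distrib_right by (rule sum.swap)
    also have "\<dots> = (\<Sum>v | v permutes T. g (a \<circ> v \<circ> b))"
    proof (rule sum.cong[OF refl])
      fix v assume "v \<in> {v. v permutes T}"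
      then have "v permutes {1..n}" using permutes_subset[OF _ T(1)] by blast
      then have "a \<circ> v \<circ> b permutes {1..n}" by (intro permutes_compose ab)
      from TL_coeff_expansion[OF this g]
      show "(\<Sum>x\<in>avoiders n. TL_coeff n x (a \<circ> v \<circ> b) * word_eval g (canonical_word n x)) = g (a \<circ> v \<circ> b)" ..
    qed
    also have "\<dots> = 0" by (rule TL_functionsD[OF g T ab])
    finally show "(\<Sum>x\<in>avoiders n. (\<Sum>v | v permutes T. TL_coeff n x (a \<circ> v \<circ> b)) * word_eval g (canonical_word n x)) = 0" .
  qed
qed

text \<open>Terms not heavier than \<open>v\<close> are settled by triangularity and the heavier
  ones by \<open>zero\<close>, so the expansion collapses to one coefficient.\<close>

lemma sum_lr_function:
  assumes v: "v \<in> avoiders n" and u: "u permutes {1..n}"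
    and zero: "\<And>x. x \<in> avoiders n \<Longrightarrow> weight n v < weight n x \<Longrightarrow> TL_coeff n x u = 0"
  shows "lr_function n v u = TL_coeff n v u * of_int (sign v)"
proof -
  have "TL_coeff n x u * word_eval (lr_function n v) (canonical_word n x)
      = (if x = v then TL_coeff n v u * of_int (sign v) else 0)" if x: "x \<in> avoiders n" for x
  proof (cases "weight n x \<le> weight n v")
    case True
    have "word_eval (lr_function n v) (canonical_word n x) = (if x = v then of_int (sign v) else 0)"
      by (rule word_eval_lr_function[OF _ _ reduced_canonical_word_avoiders[OF x] True]) (use v in blast)+
    then show ?thesis by simp
  next
    case False
    then have "x \<noteq> v" "TL_coeff n x u = 0" using zero[OF x] by auto
    then show ?thesis by simp
  qed
  then have "lr_function n v u = (\<Sum>x\<in>avoiders n. if x = v then TL_coeff n v u * of_int (sign v) else 0)"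
    unfolding TL_coeff_expansion[OF u lr_function_TL_functions] by (intro sum.cong refl)
  also have "\<dots> = TL_coeff n v u * of_int (sign v)"
    using v by (subst sum.delta[OF finite_avoiders]) (simp only: if_True)
  finally show ?thesis .
qed

text \<open>A counterexample \<open>v\<close> of largest weight is isolated by
  \<open>sum_lr_function\<close>, but \<open>lr_function n v\<close> vanishes at \<open>u\<close>,
  which differs from \<open>v\<close> and is not heavier.\<close>

lemma TL_coeff_eq_0:
  assumes u: "u permutes {1..n}" and w: "w \<in> avoiders n" "w \<noteq> u" "weight n u \<le> weight n w"
  shows "TL_coeff n w u = 0"
proof (rule ccontr)
  define A where "A = {v \<in> avoiders n. v \<noteq> u \<and> weight n u \<le> weight n v \<and> TL_coeff n v u \<noteq> 0}"
  assume "TL_coeff n w u \<noteq> 0"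
  then have "A \<noteq> {}" using w unfolding A_def by blast
  have "finite A" unfolding A_def by (rule finite_subset[OF _ finite_avoiders]) blast
  define M where "M = Max (weight n ` A)"
  have "M \<in> weight n ` A" unfolding M_def using \<open>A \<noteq> {}\<close> \<open>finite A\<close> by (intro Max_in) auto
  then obtain v where v: "v \<in> A" "M = weight n v" by blast
  have max: "weight n x \<le> weight n v" if "x \<in> A" for x
    using that \<open>finite A\<close> unfolding v(2)[symmetric] M_def by (intro Max_ge) auto
  have v': "v \<in> avoiders n" "v permutes {1..n}" "\<not> has_321 n v" "v \<noteq> u" "weight n u \<le> weight n v"
    "TL_coeff n v u \<noteq> 0"
    using v(1) unfolding A_def by blast+
  have "lr_function n v u = TL_coeff n v u * of_int (sign v)"
  proof (rule sum_lr_function[OF v'(1) u])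
    fix x assume x: "x \<in> avoiders n" "weight n v < weight n x"
    then have "x \<notin> A" "x \<noteq> u" "weight n u \<le> weight n x" using max[of x] v'(5) by auto
    then show "TL_coeff n x u = 0" using x(1) unfolding A_def by blast
  qed
  moreover have "lr_function n v u = 0"
    using lr_function_nonzero[OF v'(2,3) u] v'(4,5) by auto
  ultimately show False using v'(6) by (simp add: sign_def split: if_splits)
qed

lemma TL_coeff_self:
  assumes w: "w \<in> avoiders n"
  shows "TL_coeff n w w = 1"
proof -
  have wp: "w permutes {1..n}" using w by blast
  have "lr_function n w w = TL_coeff n w w * of_int (sign w)"
  proof (rule sum_lr_function[OF w wp])
    fix x assume "x \<in> avoiders n" "weight n w < weight n x"
    then show "TL_coeff n x w = 0" by (intro TL_coeff_eq_0[OF wp]) auto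
  qed
  then show ?thesis by (simp add: lr_function_self sign_def split: if_splits)
qed

text \<open>How an immanant is identified: exhibit a function whose functional is a multiple of the
  coordinate of \<beta>(w).\<close>

lemma TL_coeff_eq_dual:
  assumes g: "g \<in> TL_functions n" and w: "w \<in> avoiders n" and u: "u permutes {1..n}"
    and dual: "\<And>v. v \<in> avoiders n \<Longrightarrow> word_eval g (canonical_word n v) = (if v = w then e else 0)"
  shows "g u = TL_coeff n w u * e"
proof -
  have "g u = (\<Sum>v\<in>avoiders n. if v = w then TL_coeff n w u * e else 0)"
    unfolding TL_coeff_expansion[OF u g] by (intro sum.cong refl) (simp add: dual)
  also have "\<dots> = TL_coeff n w u * e"
    using w by (subst sum.delta[OF finite_avoiders]) (simp only: if_True)
  finally show ?thesis .
qed

section \<open>Comparing immanants\<close>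

definition perm_exponent :: "nat \<Rightarrow> (nat \<Rightarrow> nat) \<Rightarrow> (nat \<times> nat) \<Rightarrow>\<^sub>0 nat" where
  "perm_exponent n u = (\<Sum>i\<in>{1..n}. Poly_Mapping.single (i, u i) 1)"

lemma perm_monom_eq: "perm_monom n u = Poly_Mapping.single (perm_exponent n u) 1"
proof -
  have "(\<Prod>i\<in>A. var i (u i)) = Poly_Mapping.single (\<Sum>i\<in>A. Poly_Mapping.single (i, u i) 1) 1"
    if "finite A" for A
    using that
  proof (induction A)
    case (insert i A)
    then show ?case by (simp add: var_def mult_single)
  qed simp
  then show ?thesis by (simp add: perm_monom_def perm_exponent_def)
qed

lemma perm_exponent_inj:
  assumes "u permutes {1..n}" "v permutes {1..n}" "perm_exponent n u = perm_exponent n v"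
  shows "u = v"
proof
  fix i
  have lookup: "Poly_Mapping.lookup (perm_exponent n x) (i, u i) = (if i \<in> {1..n} \<and> x i = u i then 1 else 0)" for x
  proof -
    have "Poly_Mapping.lookup (perm_exponent n x) (i, u i)
        = (\<Sum>j\<in>{1..n}. if j = i then (if x i = u i then 1 else 0) else 0)"
      unfolding perm_exponent_def lookup_sum
      by (rule sum.cong[OF refl]) (auto simp: lookup_single when_def)
    also have "\<dots> = (if i \<in> {1..n} \<and> x i = u i then 1 else 0)" by (subst sum.delta) simp_all
    finally show ?thesis .
  qed
  show "u i = v i"
  proof (cases "i \<in> {1..n}")
    case True
    then show ?thesis using lookup[of u] lookup[of v] assms(3) by (simp split: if_splits)
  next
    case False
    then show ?thesis using permutes_not_in[OF assms(1)] permutes_not_in[OF assms(2)] by simp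
  qed
qed

text \<open>The common form of both kinds of immanants. Distinct permutations have distinct
  exponents, so coefficient functions can be recovered from it on permutations.\<close>

definition perm_poly :: "nat \<Rightarrow> ((nat \<Rightarrow> nat) \<Rightarrow> complex) \<Rightarrow> matrix_poly" where
  "perm_poly n a = (\<Sum>u | u permutes {1..n}. Poly_Mapping.single (perm_exponent n u) (a u))"

lemma lookup_perm_poly:
  assumes "v permutes {1..n}"
  shows "Poly_Mapping.lookup (perm_poly n a) (perm_exponent n v) = a v"
proof -
  have "Poly_Mapping.lookup (perm_poly n a) (perm_exponent n v)
      = (\<Sum>u | u permutes {1..n}. if u = v then a v else 0)"
    unfolding perm_poly_def lookup_sum
  proof (rule sum.cong[OF refl])
    fix u assume "u \<in> {u. u permutes {1..n}}"
    then show "Poly_Mapping.lookup (Poly_Mapping.single (perm_exponent n u) (a u)) (perm_exponent n v)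
        = (if u = v then a v else 0)"
      using perm_exponent_inj[OF _ assms, of u] by (auto simp: lookup_single when_def)
  qed
  also have "\<dots> = a v" using assms by (subst sum.delta) (simp_all add: finite_permutations)
  finally show ?thesis .
qed

lemma perm_poly_cong:
  "(\<And>u. u permutes {1..n} \<Longrightarrow> a u = b u) \<Longrightarrow> perm_poly n a = perm_poly n b"
  unfolding perm_poly_def by (rule sum.cong) simp_all

lemma of_int_mult_perm_poly: "of_int k * perm_poly n a = perm_poly n (\<lambda>u. of_int k * a u)"
proof -
  have "(of_int k :: matrix_poly) = Poly_Mapping.single 0 (of_int k)" by simp
  then show ?thesis unfolding perm_poly_def sum_distrib_left by (simp only: mult_single add_0)
qed

lemma uminus_perm_poly: "- perm_poly n a = perm_poly n (\<lambda>u. - a u)"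
  using of_int_mult_perm_poly[of "-1" n a] by simp

lemma TL_immanant_eq: "TL_immanant n w = perm_poly n (TL_coeff n w)"
  by (simp add: TL_immanant_def perm_poly_def const_poly_def perm_monom_eq mult_single)

lemma percent_immanant_eq:
  "percent_immanant n la mu = perm_poly n (\<lambda>u. if lies_in n u la mu then of_int (sign u) else 0)"
proof -
  have "of_int k * perm_monom n u = Poly_Mapping.single (perm_exponent n u) (of_int k)" for k u
  proof -
    have "(of_int k :: matrix_poly) = Poly_Mapping.single 0 (of_int k)" by simp
    then show ?thesis by (simp only: perm_monom_eq mult_single add_0 mult_1_right)
  qed
  then have "percent_immanant n la mu = (\<Sum>u\<in>{u \<in> {u. u permutes {1..n}}. lies_in n u la mu}.
      Poly_Mapping.single (perm_exponent n u) (of_int (sign u)))"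
    by (simp add: percent_immanant_def)
  also have "\<dots> = (\<Sum>u | u permutes {1..n}. if lies_in n u la mu
      then Poly_Mapping.single (perm_exponent n u) (of_int (sign u)) else 0)"
    by (rule sum.inter_filter) (simp add: finite_permutations)
  also have "\<dots> = perm_poly n (\<lambda>u. if lies_in n u la mu then of_int (sign u) else 0)"
    unfolding perm_poly_def by (rule sum.cong[OF refl]) simp
  finally show ?thesis .
qed

section \<open>Permutations containing 1324 or 2143\<close>

lemma skew_shape_antimono:
  assumes "skew_shape n la mu" "a \<in> {1..n}" "b \<in> {1..n}" "a \<le> b"
  shows "la b \<le> la a" "mu b \<le> mu a"
  using assms unfolding skew_shape_def monotone_on_def by blast+

lemma lies_inD:
  assumes "lies_in n u la mu" "i \<in> {1..n}"
  shows "mu i < u i" "u i \<le> la i"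
  using assms unfolding lies_in_def by blast+

lemma lies_in_swap:
  assumes "lies_in n w la mu" "mu a < w b" "w b \<le> la a" "mu b < w a" "w a \<le> la b"
  shows "lies_in n (w \<circ> transpose a b) la mu"
  unfolding lies_in_def
proof
  fix i assume "i \<in> {1..n}"
  then show "mu i < (w \<circ> transpose a b) i \<and> (w \<circ> transpose a b) i \<le> la i"
    using assms(2-) lies_inD[OF assms(1)] by (cases "i = a"; cases "i = b") simp_all
qed

text \<open>\<open>e\<close> stands for the sign. As f_w(w) = 1, \<open>w\<close> lies in the shape;
  as f_w vanishes at lighter permutations, undoing an inversion of \<open>w\<close> must leave the
  shape. These two facts locate the corners of the shape relative to a pattern.\<close>

lemma percent_immanant_avoids:
  assumes w: "w \<in> avoiders n" and shape: "skew_shape n la mu" and e: "e \<noteq> 0"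
    and coeff: "\<And>u. u permutes {1..n} \<Longrightarrow>
      TL_coeff n w u = e * (if lies_in n u la mu then of_int (sign u) else 0)"
  shows "\<not> has_1324 n w \<and> \<not> has_2143 n w"
proof -
  have wp: "w permutes {1..n}" using w by blast
  note la = skew_shape_antimono(1)[OF shape] and mu = skew_shape_antimono(2)[OF shape]
  have w_in: "lies_in n w la mu"
    using coeff[OF wp] TL_coeff_self[OF w] by (simp split: if_splits)
  note low = lies_inD(1)[OF w_in] and upp = lies_inD(2)[OF w_in]
  have no_swap: "\<not> lies_in n (w \<circ> transpose a b) la mu" if ab: "(a, b) \<in> inversions n w" for a b
  proof -
    have "a \<in> {1..n}" "b \<in> {1..n}" using ab by (auto simp: inversions_def)
    then have perm: "w \<circ> transpose a b permutes {1..n}"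
      by (intro permutes_compose[OF permutes_swap_id wp])
    have less: "weight n (w \<circ> transpose a b) < weight n w" by (rule weight_swap_less[OF ab])
    then have "TL_coeff n w (w \<circ> transpose a b) = 0"
      by (intro TL_coeff_eq_0[OF perm w]) auto
    then show ?thesis using coeff[OF perm] e by (simp add: sign_def split: if_splits)
  qed
  txt \<open>Exchanging the middle entries of a pattern 1324 stays in the shape.\<close>
  have "\<not> has_1324 n w"
  proof
    assume "has_1324 n w"
    then obtain a b c d where abcd: "a < b" "b < c" "c < d" "{a, b, c, d} \<subseteq> {1..n}"
      "w a < w c" "w c < w b" "w b < w d" unfolding has_1324_def by blast
    then have mem: "a \<in> {1..n}" "b \<in> {1..n}" "c \<in> {1..n}" "d \<in> {1..n}" by blast+
    have inv: "(b, c) \<in> inversions n w" using abcd mem by (simp add: inversions_def)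
    have "lies_in n (w \<circ> transpose b c) la mu"
    proof (rule lies_in_swap[OF w_in])
      show "mu b < w c" using mu[OF mem(1,2)] low[OF mem(1)] abcd by simp
      show "w c \<le> la b" using upp[OF mem(2)] abcd by simp
      show "mu c < w b" using low[OF mem(3)] abcd by simp
      show "w b \<le> la c" using la[OF mem(3,4)] upp[OF mem(4)] abcd by simp
    qed
    with no_swap[OF inv] show False by blast
  qed
  txt \<open>For a pattern 2143, the rows \<open>a\<close>, \<open>b\<close>, \<open>d\<close> of the 0/1 matrix of the shape, in the columns
    \<open>w b\<close>, \<open>w a\<close>, \<open>w c\<close>, are 011, 111, 110. This minor is nonzero, but it should vanish
    by the defining property of \<^const>\<open>TL_functions\<close>.\<close>
  moreover have "\<not> has_2143 n w"
  proof
    assume "has_2143 n w"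
    then obtain a b c d where abcd: "a < b" "b < c" "c < d" "{a, b, c, d} \<subseteq> {1..n}"
      "w b < w a" "w a < w d" "w d < w c" unfolding has_2143_def by blast
    then have mem: "a \<in> {1..n}" "b \<in> {1..n}" "c \<in> {1..n}" "d \<in> {1..n}" by blast+
    have ord: "la b \<le> la a" "la c \<le> la b" "la d \<le> la c" "mu b \<le> mu a" "mu c \<le> mu b" "mu d \<le> mu c"
      using la[OF mem(1,2)] la[OF mem(2,3)] la[OF mem(3,4)] mu[OF mem(1,2)] mu[OF mem(2,3)] mu[OF mem(3,4)]
        abcd by simp_all
    have lw: "mu a < w a" "mu b < w b" "mu c < w c" "mu d < w d"
      using low[OF mem(1)] low[OF mem(2)] low[OF mem(3)] low[OF mem(4)] by simp_all
    have up: "w a \<le> la a" "w b \<le> la b" "w c \<le> la c" "w d \<le> la d"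
      using upp[OF mem(1)] upp[OF mem(2)] upp[OF mem(3)] upp[OF mem(4)] by simp_all
    have "(a, b) \<in> inversions n w" "(c, d) \<in> inversions n w"
      using abcd mem by (simp_all add: inversions_def)
    note no = no_swap[OF this(1)] no_swap[OF this(2)]
    \<comment> \<open>Of the four inequalities that would keep the exchange of a and b inside the
      shape, only \<open>mu a < w b\<close> can fail; in \<open>corner_d\<close> it is
      \<open>w c \<le> la d\<close>.\<close>
    have corner_a: "w b \<le> mu a"
      using no(1) lies_in_swap[OF w_in, of a b] ord lw up abcd by (meson le_trans less_le_trans less_trans not_le order.strict_implies_order)
    have corner_d: "la d < w c"
      using no(2) lies_in_swap[OF w_in, of c d] ord lw up abcd by (meson le_trans le_less_trans less_trans not_le order.strict_implies_order)
    \<comment> \<open>Moving the value w c to position d makes the symmetrizer on a, b, d run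
      through the minor. Position c receives w d, which stays within the shape.\<close>
    define x where "x = w \<circ> transpose c d"
    have xp: "x permutes {1..n}"
      unfolding x_def by (rule permutes_compose[OF permutes_swap_id[OF mem(3,4)] wp])
    have x: "x a = w a" "x b = w b" "x c = w d" "x d = w c"
      using abcd(1-3) by (simp_all add: x_def)
    have x_other: "x i = w i" if "i \<noteq> c" "i \<noteq> d" for i using that by (simp add: x_def)
    have perm: "permutation w" "permutation x"
      using permutes_imp_permutation[OF finite_atLeastAtMost wp] permutes_imp_permutation[OF finite_atLeastAtMost xp] .
    have sign_x: "sign x = - sign w"
      using abcd(3) perm(1) by (simp add: x_def sign_compose permutation_swap_id sign_swap_id)
    have sign_tr: "sign (x \<circ> transpose i j) = sign w" if "i \<noteq> j" for i j
      using that perm(2) by (simp add: sign_compose permutation_swap_id sign_swap_id sign_x)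
    have sign_tr2: "sign (x \<circ> (transpose i j \<circ> transpose k l)) = - sign w" if "i \<noteq> j" "k \<noteq> l" for i j k l
      using that perm(2) by (simp add: sign_compose permutation_swap_id permutation_compose sign_swap_id sign_x)
    have in_iff: "lies_in n (x \<circ> v) la mu \<longleftrightarrow>
        mu a < x (v a) \<and> x (v a) \<le> la a \<and> mu b < x (v b) \<and> x (v b) \<le> la b \<and>
        mu d < x (v d) \<and> x (v d) \<le> la d"
      if fixed: "\<And>i. i \<noteq> a \<Longrightarrow> i \<noteq> b \<Longrightarrow> i \<noteq> d \<Longrightarrow> v i = i" for v
    proof -
      have vc: "v c = c" by (rule fixed) (use abcd in simp_all)
      have "mu i < x (v i) \<and> x (v i) \<le> la i" if "i \<in> {1..n}" "i \<noteq> a" "i \<noteq> b" "i \<noteq> d" for i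
      proof (cases "i = c")
        case True
        then show ?thesis using vc x(3) ord lw up abcd by simp
      next
        case False
        then show ?thesis using fixed[OF that(2-4)] x_other[OF False that(4)] low[OF that(1)] upp[OF that(1)] by simp
      qed
      then show ?thesis unfolding lies_in_def comp_apply using mem by blast
    qed
    have out: "\<not> lies_in n (x \<circ> id) la mu" "\<not> lies_in n (x \<circ> transpose a b) la mu"
      "\<not> lies_in n (x \<circ> (transpose a b \<circ> transpose b d)) la mu"
      using abcd x corner_a corner_d by (subst in_iff; simp)+
    have ins: "lies_in n (x \<circ> transpose b d) la mu" "lies_in n (x \<circ> transpose a d) la mu"
      "lies_in n (x \<circ> (transpose a d \<circ> transpose b d)) la mu"
      using abcd x ord lw up by (subst in_iff; simp)+
    have T: "{a, b, d} \<subseteq> {1..n}" "card {a, b, d} = 3" using abcd by auto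
    have eval_at: "TL_coeff n w (x \<circ> v) = e * (if lies_in n (x \<circ> v) la mu then of_int (sign (x \<circ> v)) else 0)"
      if "v permutes {1..n}" for v
      by (rule coeff[OF permutes_compose[OF that xp]])
    have tp: "transpose a b permutes {1..n}" "transpose b d permutes {1..n}" "transpose a d permutes {1..n}"
      using mem by (simp_all add: permutes_swap_id)
    \<comment> \<open>Three of the six permutations lie in the shape; their signs are
      \<open>sign w\<close>, \<open>sign w\<close> and \<open>- sign w\<close>, so the sum is a
      single nonzero term.\<close>
    have "0 = (\<Sum>v | v permutes {a, b, d}. TL_coeff n w (x \<circ> v))"
      using TL_functionsD[OF TL_coeff_TL_functions[OF w] T xp permutes_id] by simp
    also have "\<dots> = e * of_int (sign w)"
      using abcd(1-3)
      by (subst sum_permutes_three)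
        (simp_all add: eval_at tp permutes_compose permutes_id out ins sign_tr sign_tr2 del: comp_id)
    finally show False using e by (simp add: sign_def split: if_splits)
  qed
  ultimately show ?thesis by blast
qed

section \<open>Grassmannian permutations\<close>

lemma word_eval_cong_perms:
  assumes "set is \<subseteq> {1..n-1}" "\<And>u. u permutes {1..n} \<Longrightarrow> g u = h u"
  shows "word_eval g is = word_eval h is"
proof -
  have "map (\<lambda>r. g (word_perm r)) (subseqs is) = map (\<lambda>r. h (word_perm r)) (subseqs is)"
    by (rule map_cong[OF refl]) (rule assms(2)[OF word_perm_subseqs_permutes[OF assms(1)]])
  then show ?thesis unfolding word_eval_def by (rule arg_cong)
qed

lemma word_eval_zero:
  assumes "set is \<subseteq> {1..n-1}" "\<And>u. u permutes {1..n} \<Longrightarrow> g u = 0"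
  shows "word_eval g is = 0"
proof -
  have "word_eval g is = word_eval (\<lambda>_. 0) is"
    by (rule word_eval_cong_perms[OF assms])
  then show ?thesis by (simp add: word_eval_def)
qed

text \<open>Inverting a product of simple reflections reverses its word, hence all of its
  subwords.\<close>

lemma word_eval_inv:
  assumes "set is \<subseteq> {1..n-1}"
  shows "word_eval (\<lambda>u. g (inv u)) is = word_eval g (rev is)"
  using assms
proof (induction "is" arbitrary: g)
  case Nil
  then show ?case by (simp add: inv_id)
next
  case (Cons i "is")
  then have set: "set is \<subseteq> {1..n-1}" by simp
  have "word_eval g (rev (i # is)) = word_eval (right_smear [i] g) (rev is)"
    by (simp add: word_eval_append_right)
  also have "\<dots> = word_eval (\<lambda>u. right_smear [i] g (inv u)) is" by (rule Cons(1)[OF set, symmetric])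
  also have "\<dots> = word_eval (\<lambda>u. g (inv u) + g (inv (simple_refl i \<circ> u))) is"
  proof (rule word_eval_cong_perms[OF set])
    fix u assume u: "u permutes {1..n}"
    show "right_smear [i] g (inv u) = g (inv u) + g (inv (simple_refl i \<circ> u))"
      unfolding inv_simple_refl_comp[OF u]
      by (simp add: right_smear_def Let_def word_perm_Cons)
  qed
  also have "\<dots> = word_eval (\<lambda>u. g (inv u)) (i # is)" by (simp add: word_eval_Cons)
  finally show ?case ..
qed

text \<open>The permutations in the shape of a Grassmannian permutation turn out to be those mapping
  \<open>{1..p}\<close> to a set \<open>X\<close> with \<open>between n q q' X\<close>.\<close>

definition between :: "nat \<Rightarrow> nat \<Rightarrow> nat \<Rightarrow> nat set \<Rightarrow> bool" where
  "between n q q' X \<longleftrightarrow> {Suc q'..n} \<subseteq> X \<and> X \<subseteq> {Suc q..n}"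

definition initial_in :: "nat \<Rightarrow> nat \<Rightarrow> nat set \<Rightarrow> bool" where
  "initial_in q q' X \<longleftrightarrow> (\<forall>y y'. q < y \<and> y < y' \<and> y' \<le> q' \<and> y' \<in> X \<longrightarrow> y \<in> X)"

text \<open>\<open>between\<close> fixes X outside {q + 1..q'} and \<open>initial_in\<close> makes
  the remainder an initial segment there, so X is determined by its cardinality.\<close>

lemma between_initial_eq:
  assumes X: "between n q q' X" "initial_in q q' X" and q: "q' \<le> n"
  shows "X = {Suc q..q + (card X - (n - q'))} \<union> {Suc q'..n}"
    and "q \<le> q' \<Longrightarrow> q + (card X - (n - q')) \<le> q'"
proof -
  define D where "D = X \<inter> {Suc q..q'}"
  have fin: "finite D" by (simp add: D_def)
  have D: "D = {Suc q..q + card D}"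
  proof (cases "D = {}")
    case False
    define m where "m = Max D"
    have m: "m \<in> D" unfolding m_def using fin False by (rule Max_in)
    have "y \<in> D \<longleftrightarrow> y \<in> {Suc q..m}" for y
    proof
      assume y: "y \<in> D"
      then have "y \<le> m" unfolding m_def using fin by (intro Max_ge)
      then show "y \<in> {Suc q..m}" using y by (simp add: D_def)
    next
      assume y: "y \<in> {Suc q..m}"
      show "y \<in> D"
      proof (cases "y = m")
        case False
        have "q < y \<and> y < m \<and> m \<le> q' \<and> m \<in> X" using y m False by (simp add: D_def)
        then have "y \<in> X" using X(2) unfolding initial_in_def by blast
        then show ?thesis using y m by (simp add: D_def)
      qed (use m in simp)
    qed
    then have D_eq: "D = {Suc q..m}" by blast
    then have "card D = m - q" by simp
    moreover have "q < m" using m by (simp add: D_def)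
    ultimately show ?thesis using D_eq by simp
  qed simp
  have X_eq: "X = D \<union> {Suc q'..n}" using X(1) unfolding between_def D_def by auto
  have "card X = card D + (n - q')"
    unfolding X_eq using fin by (subst card_Un_disjoint) (auto simp: D_def)
  then have card: "card D = card X - (n - q')" by simp
  show "X = {Suc q..q + (card X - (n - q'))} \<union> {Suc q'..n}"
    using X_eq D unfolding card by blast
  have "card D \<le> card {Suc q..q'}" unfolding D_def by (intro card_mono) auto
  then show "q + (card X - (n - q')) \<le> q'" if "q \<le> q'" using card that by simp
qed

lemma rank_eq_card_image:
  assumes "u permutes S"
  shows "rank u p k = card (u ` {1..p} \<inter> {k<..})"
proof -
  have "u ` {1..p} \<inter> {k<..} = u ` {a \<in> {1..p}. k < u a}" by auto
  then show ?thesis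
    unfolding rank_def using card_image[OF inj_on_subset[OF permutes_inj[OF assms]]] by simp
qed

lemma permutes_image_bounds:
  assumes u: "u permutes {1..n}" and p: "p \<le> n"
  shows "u ` {1..p} \<subseteq> {1..n}" "card (u ` {1..p}) = p"
proof -
  have "u ` {1..p} \<subseteq> u ` {1..n}" using p by (intro image_mono) simp
  then show "u ` {1..p} \<subseteq> {1..n}" using permutes_image[OF u] by simp
  show "card (u ` {1..p}) = p"
    using card_image[OF inj_on_subset[OF permutes_inj[OF u]], of "{1..p}"] by simp
qed

text \<open>Each inclusion in \<open>between\<close> says that a rank number attains its maximum, n
  - q' at q' or p at q, and so persists when ranks grow.\<close>

lemma between_mono:
  assumes u: "u permutes {1..n}" and v: "v permutes {1..n}" and p: "p \<le> n"
    and le: "\<And>k. rank u p k \<le> rank v p k" and bet: "between n q q' (u ` {1..p})"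
  shows "between n q q' (v ` {1..p})"
proof -
  let ?U = "u ` {1..p}" and ?V = "v ` {1..p}"
  have le': "card (?U \<inter> {k<..}) \<le> card (?V \<inter> {k<..})" for k
    using le[of k] unfolding rank_eq_card_image[OF u] rank_eq_card_image[OF v] .
  note U = permutes_image_bounds[OF u p] and V = permutes_image_bounds[OF v p]
  have "?U \<inter> {q'<..} = {Suc q'..n}" using bet U(1) unfolding between_def by auto
  moreover have "?V \<inter> {q'<..} \<subseteq> {Suc q'..n}" using V(1) by auto
  ultimately have "?V \<inter> {q'<..} = {Suc q'..n}" using le'[of q'] by (intro card_seteq) simp_all
  moreover have "?U \<inter> {q<..} = ?U" using bet unfolding between_def by auto
  then have "?V \<inter> {q<..} = ?V" using le'[of q] U(2) V(2) by (intro card_seteq) simp_all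
  moreover have "between n q q' X" if "X \<inter> {q'<..} = {Suc q'..n}" "X \<inter> {q<..} = X" "X \<subseteq> {1..n}" for X
  proof -
    have "X \<subseteq> {q<..}" using that(2) by blast
    then have "X \<subseteq> {Suc q..n}" using that(3) by (auto simp: subset_iff)
    then show ?thesis using that(1) unfolding between_def by blast
  qed
  ultimately show ?thesis using V(1) by blast
qed

text \<open>An interval {q + 1..n} is moved by s_i only if i = q.\<close>

lemma image_simple_refl_between:
  assumes "i \<noteq> q" "i \<noteq> q'" "i \<in> {1..n-1}"
  shows "between n q q' (simple_refl i ` X) \<longleftrightarrow> between n q q' X"
proof -
  have img: "simple_refl i ` A = A" if "i \<in> A \<longleftrightarrow> Suc i \<in> A" for A
    unfolding simple_refl_def by (rule transpose_image_eq[OF that])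
  have hi: "simple_refl i ` {Suc q'..n} = {Suc q'..n}"
    by (rule img) (use assms in auto)
  have lo: "simple_refl i ` {Suc q..n} = {Suc q..n}"
    by (rule img) (use assms in auto)
  have inj: "inj (simple_refl i)" unfolding simple_refl_def by simp
  show ?thesis
    unfolding between_def
    using inj_image_subset_iff[OF inj, of "{Suc q'..n}" X] inj_image_subset_iff[OF inj, of X "{Suc q..n}"]
    unfolding hi lo by blast
qed

definition shape_function :: "nat \<Rightarrow> nat \<Rightarrow> nat \<Rightarrow> nat \<Rightarrow> (nat \<Rightarrow> nat) \<Rightarrow> complex" where
  "shape_function n p q q' = (\<lambda>u. of_int (sign u) * (if between n q q' (u ` {1..p}) then 1 else 0))"

lemma strict_mono_on_no_descent:
  fixes f :: "nat \<Rightarrow> nat"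
  assumes "inj f" "\<And>j. a \<le> j \<Longrightarrow> j < b \<Longrightarrow> \<not> f (Suc j) < f j"
  shows "strict_mono_on {a..b} f"
proof (rule strict_mono_onI)
  fix x y assume xy: "x \<in> {a..b}" "y \<in> {a..b}" "x < y"
  have "\<not> f y < f x"
  proof
    assume "f y < f x"
    then obtain j where "x \<le> j" "j < y" "f (Suc j) < f j" using exists_descent[OF xy(3)] by blast
    then show False using assms(2)[of j] xy by simp
  qed
  moreover have "f x \<noteq> f y" using inj_eq[OF assms(1), of x y] xy(3) by simp
  ultimately show "f x < f y" by simp
qed

lemma sign_comp_simple_refl:
  assumes "w permutes {1..n}"
  shows "sign (w \<circ> simple_refl i) = - sign w"
proof -
  have "permutation w" using permutes_imp_permutation[OF finite_atLeastAtMost assms] .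
  then show ?thesis
    unfolding simple_refl_def by (simp add: sign_compose permutation_swap_id sign_swap_id)
qed

section \<open>The functional of a Grassmannian shape\<close>

context
  fixes n p q q' :: nat and w :: "nat \<Rightarrow> nat"
  assumes w: "w permutes {1..n}" and p: "p \<le> n" and q: "q \<le> q'" "q' \<le> n"
    and mono: "strict_mono_on {1..p} w" "strict_mono_on {Suc p..n} w"
    and bet: "between n q q' (w ` {1..p})" and init: "initial_in q q' (w ` {1..p})"
begin

lemma shape_function_TL_functions: "shape_function n p q q' \<in> TL_functions n"
  unfolding shape_function_def by (rule sign_coloured_TL_functions)

lemma weight_less_if_prefix_image_eq:
  assumes x: "x permutes {1..n}" "strict_mono_on {1..p} x" "strict_mono_on {Suc p..n} x"
    and u: "u permutes {1..n}" "u ` {1..p} = x ` {1..p}"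
  shows "u = x \<or> weight n x < weight n u"
proof -
  have compl: "{1..n} - {1..p} = {Suc p..n}" by auto
  show ?thesis
    by (rule weight_less_if_image_eq[OF x(1) _ x(2) _ u]) (use p x(3) in \<open>simp_all add: compl\<close>)
qed

text \<open>The image of {1..p} under \<open>w\<close> is the lowest set that \<open>between\<close>
  allows. An allowed image with ranks no larger must be the same set, and \<open>w\<close>,
  increasing on both blocks, is the lightest permutation with this image.\<close>

lemma shape_function_minimal:
  assumes u: "u permutes {1..n}" "u \<noteq> w" "weight n u < weight n w"
    and le: "\<And>k. rank u p k \<le> rank w p k"
  shows "shape_function n p q q' u = 0"
proof (rule ccontr)
  let ?U = "u ` {1..p}" and ?W = "w ` {1..p}"
  assume "shape_function n p q q' u \<noteq> 0"
  then have bet_u: "between n q q' ?U" by (simp add: shape_function_def split: if_splits)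
  note U = permutes_image_bounds[OF u(1) p] and W = permutes_image_bounds[OF w p]
  \<comment> \<open>Of the p values on {1..p}, n - q' fill {q' + 1..n}; the other \<open>b\<close>
    start right above q.\<close>
  define b where "b = p - (n - q')"
  have W_eq: "?W = {Suc q..q + b} \<union> {Suc q'..n}" and qb: "q + b \<le> q'"
    using between_initial_eq[OF bet init q(2)] q(1) unfolding W(2) b_def by simp_all
  have "?W \<inter> {q + b<..} = {Suc q'..n}" unfolding W_eq using qb by auto
  moreover have "{Suc q'..n} \<subseteq> ?U \<inter> {q + b<..}"
    using bet_u qb unfolding between_def by auto
  moreover have "card (?U \<inter> {q + b<..}) \<le> card (?W \<inter> {q + b<..})"
    using le[of "q + b"] unfolding rank_eq_card_image[OF u(1)] rank_eq_card_image[OF w] .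
  ultimately have "{Suc q'..n} = ?U \<inter> {q + b<..}" by (intro card_seteq) simp_all
  then have "?U \<subseteq> ?W" unfolding W_eq using bet_u unfolding between_def by auto
  then have "?U = ?W" using U(2) W(2) by (intro card_seteq) simp_all
  from weight_less_if_prefix_image_eq[OF w mono u(1) this] u(2,3) show False by simp
qed

text \<open>The value is the same for all reduced words of \<open>v\<close>, so the word may be
  chosen to begin or end with any given descent. A letter that flips the sign but respects the set
  condition smears the function to zero; this restricts the descents.\<close>

lemma word_eval_shape_function:
  assumes red: "reduced_word n v is" and no: "\<not> has_321 n v"
  shows "word_eval (shape_function n p q q') is = (if v = w then of_int (sign w) else 0)"
proof -
  let ?g = "shape_function n p q q'"
  have v: "v permutes {1..n}" by (rule reduced_wordD(3)[OF red])
  have same: "word_eval ?g is = word_eval ?g js" if "reduced_word n v js" for js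
    using word_eval_cong[OF word_cong_reduced_words[OF red that no] shape_function_TL_functions] by simp
  show ?thesis
  proof (cases "v = w")
    case True
    have "word_eval ?g is = ?g w"
      using word_eval_reduced_word[OF red[unfolded True], of ?g] shape_function_minimal p by blast
    then show ?thesis using True bet by (simp add: shape_function_def)
  next
    case False
    have "word_eval ?g is = 0"
    proof (rule ccontr)
      assume nonzero: "word_eval ?g is \<noteq> 0"
      have left: "i = q \<or> i = q'" if i: "i \<in> {1..n-1}" "inv v (Suc i) < inv v i" for i
      proof (rule ccontr)
        assume neq: "\<not> (i = q \<or> i = q')"
        obtain as where as: "reduced_word n v (i # as)" using exists_reduced_word_Cons[OF v i] ..
        have "word_eval ?g (i # as) = 0"
          unfolding word_eval_Cons
        proof (rule word_eval_zero)
          show "set as \<subseteq> {1..n-1}" using reduced_wordD(1)[OF as] by simp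
          fix u assume u: "u permutes {1..n}"
          have "between n q q' ((simple_refl i \<circ> u) ` {1..p}) \<longleftrightarrow> between n q q' (u ` {1..p})"
            unfolding image_comp[symmetric] by (rule image_simple_refl_between) (use neq i in simp_all)
          then show "?g u + ?g (simple_refl i \<circ> u) = 0"
            unfolding shape_function_def sign_simple_refl_comp[OF u] by simp
        qed
        then show False using nonzero same[OF as] by simp
      qed
      have right: "i = p" if i: "i \<in> {1..n-1}" "v (Suc i) < v i" for i
      proof (rule ccontr)
        assume neq: "i \<noteq> p"
        obtain as where as: "reduced_word n v (as @ [i])" using exists_reduced_word_snoc[OF v i] ..
        have "word_eval ?g (as @ [i]) = 0"
          unfolding word_eval_append_right
        proof (rule word_eval_zero)
          show "set as \<subseteq> {1..n-1}" using reduced_wordD(1)[OF as] by simp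
          fix u assume u: "u permutes {1..n}"
          have "simple_refl i ` {1..p} = {1..p}"
            unfolding simple_refl_def by (rule transpose_image_eq) (use neq i in auto)
          then have "(u \<circ> simple_refl i) ` {1..p} = u ` {1..p}" unfolding image_comp[symmetric] by simp
          moreover have "right_smear [i] ?g u = ?g (u \<circ> simple_refl i) + ?g u"
            by (simp add: right_smear_def Let_def word_perm_Cons)
          ultimately show "right_smear [i] ?g u = 0"
            unfolding shape_function_def sign_comp_simple_refl[OF u] by simp
        qed
        then show False using nonzero same[OF as] by simp
      qed
      \<comment> \<open>If \<open>v\<close> violates the condition, so does everything below it by
        \<open>between_mono\<close>, and the functional vanishes.\<close>
      have bet_v: "between n q q' (v ` {1..p})"
      proof (rule ccontr)
        assume not: "\<not> between n q q' (v ` {1..p})"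
        have "word_eval ?g is = ?g v"
        proof (rule word_eval_reduced_word[OF red])
          fix u assume u: "u permutes {1..n}" and le: "\<And>p k. p \<le> n \<Longrightarrow> rank u p k \<le> rank v p k"
          have "\<not> between n q q' (u ` {1..p})"
            using between_mono[OF u v p le[OF p], of q q'] not by blast
          then show "?g u = 0" by (simp add: shape_function_def)
        qed
        then show False using nonzero not by (simp add: shape_function_def)
      qed
      have mono_v: "strict_mono_on {1..p} v" "strict_mono_on {Suc p..n} v"
      proof (rule_tac [!] strict_mono_on_no_descent[OF permutes_inj[OF v]])
        fix j
        show "\<not> v (Suc j) < v j" if j: "1 \<le> j" "j < p"
        proof -
          have "j \<in> {1..n-1}" using j p by simp
          then show ?thesis using right[of j] j by blast
        qed
        show "\<not> v (Suc j) < v j" if j: "Suc p \<le> j" "j < n"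
        proof -
          have "j \<in> {1..n-1}" using j by simp
          then show ?thesis using right[of j] j by fastforce
        qed
      qed
      \<comment> \<open>Without left descents strictly between q and q', the values q + 1, ..., q'
        occur in increasing order; those found in the first p positions form an initial
        segment.\<close>
      have mono_inv: "strict_mono_on {Suc q..q'} (inv v)"
      proof (rule strict_mono_on_no_descent[OF permutes_inj[OF permutes_inv[OF v]]])
        fix j assume j: "Suc q \<le> j" "j < q'"
        have "j \<in> {1..n-1}" using j q by simp
        then show "\<not> inv v (Suc j) < inv v j" using left[of j] j by fastforce
      qed
      have init_v: "initial_in q q' (v ` {1..p})"
        unfolding initial_in_def
      proof (intro allI impI)
        fix y y' assume y: "q < y \<and> y < y' \<and> y' \<le> q' \<and> y' \<in> v ` {1..p}"
        then have "inv v y < inv v y'" using strict_mono_onD[OF mono_inv, of y y'] by simp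
        moreover obtain a where a: "y' = v a" "a \<le> p" using y by auto
        then have "inv v y' = a" by (simp add: permutes_inverses(2)[OF v])
        moreover have "inv v y \<in> {1..n}"
          using y q permutes_in_image[OF permutes_inv[OF v], of y] by simp
        ultimately have "inv v y \<in> {1..p}" using a(2) by simp
        then have "v (inv v y) \<in> v ` {1..p}" by (rule imageI)
        then show "y \<in> v ` {1..p}" by (simp add: permutes_inverses(1)[OF v])
      qed
      have img: "v ` {1..p} = w ` {1..p}"
        using between_initial_eq(1)[OF bet_v init_v q(2)] between_initial_eq(1)[OF bet init q(2)]
        unfolding permutes_image_bounds(2)[OF v p] permutes_image_bounds(2)[OF w p] by simp
      \<comment> \<open>Both \<open>v\<close> and \<open>w\<close> are the lightest permutation with
        this image of {1..p}.\<close>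
      from weight_less_if_prefix_image_eq[OF w mono v img]
        weight_less_if_prefix_image_eq[OF v mono_v w img[symmetric]] False
      show False by auto
    qed
    then show ?thesis using False by simp
  qed
qed

end

section \<open>The shape of a 321-avoiding permutation\<close>

text \<open>For a 321-avoiding \<open>w\<close> the running minimum takes only the values w 1 and 1,
  and the maximum from the right only n and w n. The shape is thus the square with a possibly empty
  rectangle cut off at each of two opposite corners.\<close>

definition in_shape :: "nat \<Rightarrow> (nat \<Rightarrow> nat) \<Rightarrow> (nat \<Rightarrow> nat) \<Rightarrow> bool" where
  "in_shape n w u \<longleftrightarrow> (\<forall>i\<in>{1..n}. i < inv w 1 \<longrightarrow> w 1 \<le> u i) \<and> (\<forall>i\<in>{1..n}. inv w n < i \<longrightarrow> u i \<le> w n)"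

lemma permutes_bounds:
  assumes "u permutes {1..n}" "i \<in> {1..n}"
  shows "u i \<in> {1..n}" "1 \<le> u i" "u i \<le> n"
  using permutes_in_image[OF assms(1), of i] assms(2) by auto

lemma no_321:
  assumes "\<not> has_321 n w" "a < b" "b < c" "a \<in> {1..n}" "c \<in> {1..n}" "w c < w b" "w b < w a"
  shows False
proof -
  have "(a, b) \<in> inversions n w" "(b, c) \<in> inversions n w"
    using assms by (simp_all add: inversions_def)
  then show False using assms(1) unfolding has_321_def by blast
qed

lemma no_1324:
  assumes "\<not> has_1324 n w" "a < b" "b < c" "c < d" "a \<in> {1..n}" "d \<in> {1..n}"
    "w a < w c" "w c < w b" "w b < w d"
  shows False
proof -
  have "{a, b, c, d} \<subseteq> {1..n}" using assms by auto
  then show False using assms unfolding has_1324_def by blast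
qed

context
  fixes n :: nat and w :: "nat \<Rightarrow> nat"
  assumes w: "w permutes {1..n}" and no: "\<not> has_321 n w" and n: "1 \<le> n"
begin

lemma ends:
  "inv w 1 \<in> {1..n}" "inv w n \<in> {1..n}" "w (inv w 1) = 1" "w (inv w n) = n"
  using permutes_bounds(1)[OF permutes_inv[OF w], of 1] permutes_bounds(1)[OF permutes_inv[OF w], of n] n
  by (simp_all add: permutes_inverses(1)[OF w])

lemma eq_iff: "w i = w j \<longleftrightarrow> i = j"
  by (rule inj_eq[OF permutes_inj[OF w]])

text \<open>A value below w 1 to the left of the value 1 would be the middle of a pattern 321 with
  outer entries w 1 and 1.\<close>

lemma first_le:
  assumes j: "j \<in> {1..n}" "j < inv w 1"
  shows "w 1 \<le> w j"
proof (rule ccontr)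
  assume "\<not> w 1 \<le> w j"
  then have less: "w j < w 1" by simp
  then have "j \<noteq> 1" by auto
  then have "1 < j" using j(1) by simp
  moreover have "w (inv w 1) < w j"
    using ends(3) permutes_bounds(2)[OF w j(1)] eq_iff[of j "inv w 1"] j(2) by simp
  ultimately show False
    using no_321[OF no, of 1 j "inv w 1"] j(2) ends(1) n less by simp
qed

lemma le_last:
  assumes j: "j \<in> {1..n}" "inv w n < j"
  shows "w j \<le> w n"
proof (rule ccontr)
  assume "\<not> w j \<le> w n"
  then have less: "w n < w j" by simp
  then have "j \<noteq> n" by auto
  then have "j < n" using j(1) by simp
  moreover have "w j < w (inv w n)"
    using ends(4) permutes_bounds(3)[OF w j(1)] eq_iff[of j "inv w n"] j(2) by simp
  ultimately show False
    using no_321[OF no, of "inv w n" j n] j(2) ends(2) n less by simp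
qed

lemma Min_prefix:
  assumes i: "i \<in> {1..n}"
  shows "Min (w ` {1..i}) = (if i < inv w 1 then w 1 else 1)"
proof (rule Min_eqI)
  fix y assume "y \<in> w ` {1..i}"
  then obtain j where j: "y = w j" "j \<in> {1..i}" by blast
  then have jn: "j \<in> {1..n}" using i by auto
  show "(if i < inv w 1 then w 1 else 1) \<le> y"
    using first_le[OF jn] permutes_bounds(2)[OF w jn] j by simp
next
  show "(if i < inv w 1 then w 1 else 1) \<in> w ` {1..i}"
  proof (cases "i < inv w 1")
    case True
    then show ?thesis using i by simp
  next
    case False
    then have "inv w 1 \<in> {1..i}" using ends(1) by simp
    from imageI[OF this, of w] show ?thesis using False ends(3) by simp
  qed
qed simp

lemma Max_suffix:
  assumes i: "i \<in> {1..n}"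
  shows "Max (w ` {i..n}) = (if inv w n < i then w n else n)"
proof (rule Max_eqI)
  fix y assume "y \<in> w ` {i..n}"
  then obtain j where j: "y = w j" "j \<in> {i..n}" by blast
  then have jn: "j \<in> {1..n}" using i by auto
  show "y \<le> (if inv w n < i then w n else n)"
    using le_last[OF jn] permutes_bounds(3)[OF w jn] j by simp
next
  show "(if inv w n < i then w n else n) \<in> w ` {i..n}"
  proof (cases "inv w n < i")
    case True
    then show ?thesis using i by simp
  next
    case False
    then have "inv w n \<in> {i..n}" using ends(2) by simp
    from imageI[OF this, of w] show ?thesis using False ends(4) by simp
  qed
qed simp

lemma lies_in_iff_in_shape:
  assumes u: "u permutes {1..n}"
  shows "lies_in n u (\<lambda>i. Max (w ` {i..n})) (\<lambda>i. Min (w ` {1..i}) - 1) \<longleftrightarrow> in_shape n w u"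
proof -
  have "1 \<le> w 1" using permutes_bounds(2)[OF w, of 1] n by simp
  then have "Min (w ` {1..i}) - 1 < u i \<and> u i \<le> Max (w ` {i..n}) \<longleftrightarrow>
      (i < inv w 1 \<longrightarrow> w 1 \<le> u i) \<and> (inv w n < i \<longrightarrow> u i \<le> w n)" if i: "i \<in> {1..n}" for i
    using permutes_bounds(2,3)[OF u i] unfolding Min_prefix[OF i] Max_suffix[OF i] by auto
  then show ?thesis unfolding lies_in_def in_shape_def by blast
qed

text \<open>Let s and t be the positions of 1 and n. The block boundary is p = t if w 1 = 1, p = s -
  1 if w n = n, and p = t = s - 1 otherwise. Before s and after t, avoiding 321 makes
  \<open>w\<close> increase; on the remaining block an inversion would be the middle of a pattern
  1324 with outer entries 1 and n.\<close>

lemma grassmannian: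
  assumes no4: "\<not> has_1324 n w" and "w \<noteq> id"
    and cases: "w 1 = 1 \<or> w n = n \<or> inv w n < inv w 1"
  shows "\<exists>p<n. strict_mono_on {1..p} w \<and> strict_mono_on {Suc p..n} w \<and>
    initial_in (w 1 - 1) (w n) (w ` {1..p}) \<and>
    (\<forall>u. u permutes {1..n} \<longrightarrow> in_shape n w u \<longleftrightarrow> between n (w 1 - 1) (w n) (u ` {1..p}))"
proof -
  define s t where "s = inv w 1" and "t = inv w n"
  have st: "s \<in> {1..n}" "t \<in> {1..n}" "w s = 1" "w t = n" using ends unfolding s_def t_def .
  have pos: "1 \<le> w 1" "w n \<le> n" "1 \<le> w n"
    using permutes_bounds[OF w, of 1] permutes_bounds[OF w, of n] n by simp_all
  have s1: "w i = 1 \<longleftrightarrow> i = s" for i using eq_iff[of i s] st(3) by simp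
  have tn: "w i = n \<longleftrightarrow> i = t" for i using eq_iff[of i t] st(4) by simp
  have not_both: "\<not> (w 1 = 1 \<and> w n = n)"
  proof
    assume both: "w 1 = 1 \<and> w n = n"
    have "\<not> strict_mono_on {1..n} w" using strict_mono_permutes_eq_id[OF w] assms(2) by blast
    then obtain a b where ab: "a \<in> {1..n}" "b \<in> {1..n}" "(a, b) \<in> inversions n w"
      using strict_mono_on_if_no_inversion[OF w, of "{1..n}"] by blast
    then have lt: "a < b" "w b < w a" by (simp_all add: inversions_def)
    have "a \<noteq> 1" "b \<noteq> n"
      using lt both permutes_bounds[OF w ab(1)] permutes_bounds[OF w ab(2)] by auto
    then have "1 < a" "b < n" using ab by simp_all
    moreover have "w 1 < w b" "w a < w n"
      using both permutes_bounds[OF w ab(1)] permutes_bounds[OF w ab(2)] eq_iff[of 1 b] eq_iff[of a n]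
        \<open>1 < a\<close> \<open>b < n\<close> lt by simp_all
    ultimately show False using no_1324[OF no4, of 1 a b n] lt n by simp
  qed
  have mono_by: "strict_mono_on A w" if "A \<subseteq> {1..n}"
    "\<And>a b. a \<in> A \<Longrightarrow> b \<in> A \<Longrightarrow> a < b \<Longrightarrow> w b < w a \<Longrightarrow> False" for A
    by (rule strict_mono_on_if_no_inversion[OF w _ that(1)]) (use that(2) in \<open>auto simp: inversions_def\<close>)
  have after_t: "strict_mono_on {Suc t..n} w"
  proof (rule mono_by)
    fix a b assume ab: "a \<in> {Suc t..n}" "b \<in> {Suc t..n}" "a < b" "w b < w a"
    have "w a < w t" using st(4) tn[of a] permutes_bounds(3)[OF w, of a] ab(1) by auto
    then show False using no_321[OF no, of t a b] ab st(2) by simp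
  qed auto
  have before_s: "strict_mono_on {1..s - 1} w"
  proof (rule mono_by)
    fix a b assume ab: "a \<in> {1..s - 1}" "b \<in> {1..s - 1}" "a < b" "w b < w a"
    then have "a \<in> {1..n}" "b \<in> {1..n}" "b < s" using st(1) by auto
    moreover have "w s < w b" using st(3) s1[of b] permutes_bounds(2)[OF w, of b] calculation by auto
    ultimately show False using no_321[OF no, of a b s] ab st(1) by simp
  qed (use st(1) in auto)
  have image_low: "u ` {1..p} \<subseteq> {Suc q..n} \<longleftrightarrow> (\<forall>i\<in>{1..n}. i \<le> p \<longrightarrow> Suc q \<le> u i)"
    if u: "u permutes {1..n}" and p: "p < n" for u p q
  proof -
    have "u i \<le> n" if "i \<in> {1..p}" for i using permutes_bounds(3)[OF u, of i] that p by simp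
    then show ?thesis using p by (auto simp: image_subset_iff)
  qed
  have image_high: "{Suc q'..n} \<subseteq> u ` {1..p} \<longleftrightarrow> (\<forall>i\<in>{1..n}. p < i \<longrightarrow> u i \<le> q')"
    if u: "u permutes {1..n}" and p: "p < n" for u p q'
  proof
    assume sub: "{Suc q'..n} \<subseteq> u ` {1..p}"
    show "\<forall>i\<in>{1..n}. p < i \<longrightarrow> u i \<le> q'"
    proof (intro ballI impI, rule ccontr)
      fix i assume i: "i \<in> {1..n}" "p < i" "\<not> u i \<le> q'"
      then have "u i \<in> u ` {1..p}" using sub permutes_bounds(3)[OF u i(1)] by auto
      then obtain j where "u i = u j" "j \<le> p" by auto
      then show False using inj_eq[OF permutes_inj[OF u], of i j] i(2) by simp
    qed
  next
    assume *: "\<forall>i\<in>{1..n}. p < i \<longrightarrow> u i \<le> q'"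
    show "{Suc q'..n} \<subseteq> u ` {1..p}"
    proof
      fix y assume y: "y \<in> {Suc q'..n}"
      have uy: "u (inv u y) = y" by (rule permutes_inverses(1)[OF u])
      have mem: "inv u y \<in> {1..n}" using permutes_bounds(1)[OF permutes_inv[OF u], of y] y by simp
      have "\<not> p < inv u y" using * mem y uy by fastforce
      then have "inv u y \<in> {1..p}" using mem by simp
      from imageI[OF this, of u] show "y \<in> u ` {1..p}" unfolding uy .
    qed
  qed
  have between_iff: "between n (w 1 - 1) (w n) (u ` {1..p}) \<longleftrightarrow>
      (\<forall>i\<in>{1..n}. i \<le> p \<longrightarrow> w 1 \<le> u i) \<and> (\<forall>i\<in>{1..n}. p < i \<longrightarrow> u i \<le> w n)"
    if "u permutes {1..n}" "p < n" for u p
    unfolding between_def image_low[OF that] image_high[OF that] using pos(1) by auto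
  obtain p where p: "1 \<le> p" "p < n" and mono: "strict_mono_on {1..p} w" "strict_mono_on {Suc p..n} w"
    and shape: "\<And>u. u permutes {1..n} \<Longrightarrow> in_shape n w u \<longleftrightarrow> between n (w 1 - 1) (w n) (u ` {1..p})"
  proof -
    consider (A) "w 1 = 1" "w n \<noteq> n" | (B) "w 1 \<noteq> 1" "w n = n" | (C) "w 1 \<noteq> 1" "w n \<noteq> n" "t < s"
      using cases not_both unfolding s_def t_def by blast
    then show thesis
    proof cases
      case A
      have s: "s = 1" using A(1) s1[of 1] by simp
      have t: "t < n" using A(2) tn[of n] st(2) by (cases "t = n") auto
      show thesis
      proof (rule that[of t])
        show "1 \<le> t" "t < n" using st(2) t by simp_all
        show "strict_mono_on {1..t} w"
        proof (rule mono_by)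
          fix a b assume ab: "a \<in> {1..t}" "b \<in> {1..t}" "a < b" "w b < w a"
          have mem: "a \<in> {1..n}" "b \<in> {1..n}" using ab(1,2) st(2) by auto
          have "b \<noteq> t" using ab(4) st(4) permutes_bounds(3)[OF w mem(1)] by auto
          moreover have "a \<noteq> 1" using ab(4) A(1) permutes_bounds(2)[OF w mem(2)] by auto
          ultimately have lt: "1 < a" "b < t" using ab(1,2) by simp_all
          have "w 1 < w b" using A(1) s1[of b] s lt ab(3) permutes_bounds(2)[OF w mem(2)] by simp
          moreover have "w a < w t" using st(4) tn[of a] lt ab(3) permutes_bounds(3)[OF w mem(1)] by simp
          ultimately show False using no_1324[OF no4, of 1 a b t] lt ab(3,4) n st(2) by simp
        qed (use st(2) in auto)
        show "in_shape n w u \<longleftrightarrow> between n (w 1 - 1) (w n) (u ` {1..t})" if u: "u permutes {1..n}" for u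
          unfolding in_shape_def between_iff[OF u t] s_def[symmetric] t_def[symmetric]
          using s A(1) permutes_bounds(2)[OF u] by auto
      qed (rule after_t)
    next
      case B
      have t: "t = n" using B(2) tn[of n] by simp
      have s: "1 < s" using B(1) s1[of 1] st(1) by (cases "s = 1") auto
      have sn: "s - 1 < n" "Suc (s - 1) = s" using s st(1) by auto
      show thesis
      proof (rule that[of "s - 1"])
        show "1 \<le> s - 1" "s - 1 < n" using s sn by simp_all
        show "strict_mono_on {Suc (s - 1)..n} w"
        proof (rule mono_by)
          fix a b assume ab: "a \<in> {Suc (s - 1)..n}" "b \<in> {Suc (s - 1)..n}" "a < b" "w b < w a"
          have mem: "a \<in> {1..n}" "b \<in> {1..n}" using ab(1,2) sn by auto
          have "b \<noteq> n" using ab(4) B(2) permutes_bounds(3)[OF w mem(1)] by auto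
          moreover have "a \<noteq> s" using ab(4) st(3) permutes_bounds(2)[OF w mem(2)] by auto
          ultimately have lt: "s < a" "b < n" using ab(1,2) sn by simp_all
          have "w s < w b" using st(3) s1[of b] lt ab(3) permutes_bounds(2)[OF w mem(2)] by simp
          moreover have "w a < w n" using B(2) tn[of a] t lt ab(3) permutes_bounds(3)[OF w mem(1)] by simp
          ultimately show False using no_1324[OF no4, of s a b n] lt ab(3,4) n st(1) by simp
        qed (use sn in auto)
        show "in_shape n w u \<longleftrightarrow> between n (w 1 - 1) (w n) (u ` {1..s - 1})" if u: "u permutes {1..n}" for u
        proof -
          have "i < s \<longleftrightarrow> i \<le> s - 1" for i using s by auto
          then show ?thesis
            unfolding in_shape_def between_iff[OF u sn(1)] s_def[symmetric] t_def[symmetric]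
            using t B(2) permutes_bounds(3)[OF u] by auto
        qed
      qed (rule before_s)
    next
      case C
      \<comment> \<open>A position strictly between t and s would hold the middle of a pattern 321
        with outer entries n and 1.\<close>
      have "\<not> Suc t < s"
      proof
        assume lt: "Suc t < s"
        have mem: "Suc t \<in> {1..n}" using lt st(1) by simp
        have "w (Suc t) < w t" using st(4) tn[of "Suc t"] permutes_bounds(3)[OF w mem] by simp
        moreover have "w s < w (Suc t)" using st(3) s1[of "Suc t"] lt permutes_bounds(2)[OF w mem] by simp
        ultimately show False using no_321[OF no, of t "Suc t" s] lt st(1,2) by simp
      qed
      then have s: "s = Suc t" using C(3) by simp
      have t: "t < n" using s st(1) by simp
      show thesis
      proof (rule that[of t])
        show "1 \<le> t" "t < n" using st(2) t by simp_all
        show "strict_mono_on {1..t} w" using before_s s by simp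
        show "in_shape n w u \<longleftrightarrow> between n (w 1 - 1) (w n) (u ` {1..t})" if u: "u permutes {1..n}" for u
          unfolding in_shape_def between_iff[OF u t] s_def[symmetric] t_def[symmetric] s less_Suc_eq_le ..
      qed (rule after_t)
    qed
  qed
  \<comment> \<open>A violation y < y' would produce the pattern 1324 with entries w 1, y', y, w
    n.\<close>
  have "initial_in (w 1 - 1) (w n) (w ` {1..p})"
    unfolding initial_in_def
  proof (intro allI impI, rule ccontr)
    fix y y' assume y: "w 1 - 1 < y \<and> y < y' \<and> y' \<le> w n \<and> y' \<in> w ` {1..p}" and out: "y \<notin> w ` {1..p}"
    obtain b where b: "y' = w b" "b \<in> {1..p}" using y by blast
    define c where "c = inv w y"
    have wc: "w c = y" unfolding c_def by (rule permutes_inverses(1)[OF w])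
    have "y \<in> {1..n}" using y pos by auto
    then have cn: "c \<in> {1..n}" unfolding c_def by (rule permutes_bounds(1)[OF permutes_inv[OF w]])
    have "c \<notin> {1..p}" using out imageI[of c "{1..p}" w] wc by auto
    then have pc: "p < c" using cn by simp
    have "c \<noteq> 1" using pc p(1) by simp
    then have "w 1 \<noteq> w c" using eq_iff[of 1 c] by simp
    moreover have "w 1 - 1 < w c" using y wc by simp
    ultimately have "w 1 < w c" by linarith
    moreover have "b \<noteq> n" using b(2) p(2) by simp
    then have "w b < w n" using y b(1) eq_iff[of b n] by simp
    moreover have "b \<noteq> 1" using y b(1) wc calculation by auto
    then have "1 < b" using b(2) by simp
    moreover have "c \<noteq> n" using y wc by auto
    then have "c < n" using cn by simp
    ultimately show False using no_1324[OF no4, of 1 b c n] b pc y wc n by simp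
  qed
  then show ?thesis using p mono shape by blast
qed

end

section \<open>Temperley-Lieb immanants that are \%-immanants\<close>

text \<open>\<open>g\<close> is the signed indicator function of the shape of \<open>w\<close>, and the functional it induces on the
  Temperley-Lieb algebra is the sign of \<open>w\<close> times the coordinate of \<open>\<beta>(w)\<close>.\<close>

definition shape_dual :: "nat \<Rightarrow> (nat \<Rightarrow> nat) \<Rightarrow> ((nat \<Rightarrow> nat) \<Rightarrow> complex) \<Rightarrow> bool" where
  "shape_dual n w g \<longleftrightarrow> g \<in> TL_functions n \<and>
     (\<forall>u. u permutes {1..n} \<longrightarrow> g u = of_int (sign u) * (if in_shape n w u then 1 else 0)) \<and>
     (\<forall>v is. reduced_word n v is \<longrightarrow> \<not> has_321 n v \<longrightarrow>
       word_eval g is = (if v = w then of_int (sign w) else 0))"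

lemma shape_dual_grassmannian:
  assumes w: "w permutes {1..n}" "\<not> has_321 n w" and n: "1 \<le> n" and no4: "\<not> has_1324 n w"
    and cases: "w 1 = 1 \<or> w n = n \<or> inv w n < inv w 1"
  shows "\<exists>g. shape_dual n w g"
proof (cases "w = id")
  case True
  \<comment> \<open>The shape of the identity is the full square, and these parameters make
    \<open>between\<close> always true, so \<open>?g\<close> is the sign function.\<close>
  let ?g = "shape_function n 0 0 n"
  have empty: "{1..0::nat} = {}" by (rule atLeastatMost_empty) (rule zero_less_one)
  have bet: "between n 0 n (u ` {1..0})" for u :: "nat \<Rightarrow> nat" unfolding empty by (simp add: between_def)
  have "in_shape n id u" for u by (simp add: in_shape_def inv_id)
  moreover have "word_eval ?g is = (if v = id then of_int (sign (id :: nat \<Rightarrow> nat)) else 0)"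
    if "reduced_word n v is" "\<not> has_321 n v" for v "is"
    by (rule word_eval_shape_function[OF permutes_id _ _ _ _ _ bet _ that])
      (simp_all add: strict_mono_on_def initial_in_def empty)
  moreover have "?g \<in> TL_functions n"
    unfolding shape_function_def by (rule sign_coloured_TL_functions)
  ultimately have "shape_dual n id ?g"
    unfolding shape_dual_def using bet by (simp add: shape_function_def)
  then show ?thesis unfolding True by blast
next
  case False
  obtain p where p: "p < n" and mono: "strict_mono_on {1..p} w" "strict_mono_on {Suc p..n} w"
    and init: "initial_in (w 1 - 1) (w n) (w ` {1..p})"
    and shape: "\<And>u. u permutes {1..n} \<Longrightarrow> in_shape n w u \<longleftrightarrow> between n (w 1 - 1) (w n) (u ` {1..p})"
    using grassmannian[OF w n no4 False cases] by blast
  let ?g = "shape_function n p (w 1 - 1) (w n)"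
  have "in_shape n w w"
    using first_le[OF w n] le_last[OF w n] unfolding in_shape_def by blast
  then have bet: "between n (w 1 - 1) (w n) (w ` {1..p})" using shape[OF w(1)] by blast
  have bounds: "w 1 \<le> n" "w n \<le> n"
    using permutes_bounds(3)[OF w(1), of 1] permutes_bounds(3)[OF w(1), of n] n by simp_all
  have q: "w 1 - 1 \<le> w n"
  proof (cases "w n = n")
    case False
    then have "Suc (w n) \<in> {Suc (w n)..n}" using bounds(2) by simp
    then have "Suc (w n) \<in> {Suc (w 1 - 1)..n}" using bet unfolding between_def by blast
    then show ?thesis by simp
  qed (use bounds in simp)
  have "word_eval ?g is = (if v = w then of_int (sign w) else 0)"
    if "reduced_word n v is" "\<not> has_321 n v" for v "is"
    by (rule word_eval_shape_function[OF w(1) less_imp_le[OF p] q bounds(2) mono bet init that])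
  moreover have "?g \<in> TL_functions n"
    unfolding shape_function_def by (rule sign_coloured_TL_functions)
  ultimately have "shape_dual n w ?g"
    unfolding shape_dual_def using shape by (simp add: shape_function_def)
  then show ?thesis by blast
qed

text \<open>Inversion transposes the square: each implication for \<open>inv u\<close> at j = u i is
  the contrapositive of one for \<open>u\<close> at i.\<close>

lemma in_shape_inv:
  assumes w: "w permutes {1..n}" and u: "u permutes {1..n}"
  shows "in_shape n (inv w) (inv u) \<longleftrightarrow> in_shape n w u"
proof -
  have "in_shape n w u" if w: "w permutes {1..n}" and u: "u permutes {1..n}"
    and "in_shape n (inv w) (inv u)" for w u
    unfolding in_shape_def
  proof (intro conjI ballI impI; rule ccontr)
    have shape: "j < w 1 \<Longrightarrow> inv w 1 \<le> inv u j" "w n < j \<Longrightarrow> inv u j \<le> inv w n" if "j \<in> {1..n}" for j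
      using \<open>in_shape n (inv w) (inv u)\<close> that unfolding in_shape_def permutes_inv_inv[OF w] by blast+
    fix i assume i: "i \<in> {1..n}"
    note ui = shape[OF permutes_bounds(1)[OF u i]]
    show False if "i < inv w 1" "\<not> w 1 \<le> u i"
      using ui(1) that by (simp add: permutes_inverses(2)[OF u])
    show False if "inv w n < i" "\<not> u i \<le> w n"
      using ui(2) that by (simp add: permutes_inverses(2)[OF u])
  qed
  from this[OF w u] this[OF permutes_inv[OF w] permutes_inv[OF u]] show ?thesis
    unfolding permutes_inv_inv[OF w] permutes_inv_inv[OF u] by blast
qed

lemma has_1324_inv:
  assumes w: "w permutes {1..n}" and "has_1324 n (inv w)"
  shows "has_1324 n w"
proof -
  obtain a b c d where abcd: "a < b" "b < c" "c < d" "{a, b, c, d} \<subseteq> {1..n}"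
    "inv w a < inv w c" "inv w c < inv w b" "inv w b < inv w d"
    using assms(2) unfolding has_1324_def by blast
  have mem: "inv w x \<in> {1..n}" if "x \<in> {a, b, c, d}" for x
    using permutes_bounds(1)[OF permutes_inv[OF w], of x] that abcd(4) by blast
  have "{inv w a, inv w c, inv w b, inv w d} \<subseteq> {1..n}" using mem by blast
  then show ?thesis
    unfolding has_1324_def
    using abcd by (intro exI[of _ "inv w a"] exI[of _ "inv w c"] exI[of _ "inv w b"] exI[of _ "inv w d"])
      (simp add: permutes_inverses(1)[OF w])
qed

text \<open>Signs and \<open>TL_functions\<close> are invariant under inversion, shapes are
  transposed, and reduced words are reversed.\<close>

lemma shape_dual_inv:
  assumes w: "w permutes {1..n}" and g: "shape_dual n (inv w) g"
  shows "shape_dual n w (\<lambda>u. g (inv u))"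
proof -
  have sign_inv: "sign (inv u) = sign u" if "u permutes {1..n}" for u :: "nat \<Rightarrow> nat"
    by (rule sign_inverse[OF permutes_imp_permutation[OF finite_atLeastAtMost that]])
  have "g (inv u) = of_int (sign u) * (if in_shape n w u then 1 else 0)" if u: "u permutes {1..n}" for u
    using g permutes_inv[OF u] sign_inv[OF u] in_shape_inv[OF w u] unfolding shape_dual_def by simp
  moreover have "word_eval (\<lambda>u. g (inv u)) is = (if v = w then of_int (sign w) else 0)"
    if red: "reduced_word n v is" and no: "\<not> has_321 n v" for v "is"
  proof -
    have v: "v permutes {1..n}" by (rule reduced_wordD(3)[OF red])
    have "inv v = inv w \<longleftrightarrow> v = w"
      using permutes_inv_inv[OF v] permutes_inv_inv[OF w] by metis
    moreover have "word_eval g (rev is) = (if inv v = inv w then of_int (sign (inv w)) else 0)"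
      using g reduced_word_rev[OF red] no has_321_inv[OF v] unfolding shape_dual_def by blast
    ultimately show ?thesis
      unfolding word_eval_inv[OF reduced_wordD(1)[OF red]] by (simp add: sign_inv[OF w])
  qed
  moreover have "(\<lambda>u. g (inv u)) \<in> TL_functions n"
    using g TL_functions_inv unfolding shape_dual_def by blast
  ultimately show ?thesis unfolding shape_dual_def by blast
qed

text \<open>Otherwise 1 occurs before n and neither 1 nor n is fixed. The entries w 1, 1, n, w n
  would then form 2143 if w 1 < w n; hence w n < w 1, and this is the third alternative of the
  Grassmannian case for the inverse.\<close>

lemma exists_shape_dual:
  assumes w: "w permutes {1..n}" "\<not> has_321 n w" and n: "1 \<le> n"
    and no4: "\<not> has_1324 n w" "\<not> has_2143 n w"
  shows "\<exists>g. shape_dual n w g"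
proof (cases "w 1 = 1 \<or> w n = n \<or> inv w n < inv w 1")
  case True
  then show ?thesis by (rule shape_dual_grassmannian[OF w n no4(1)])
next
  case False
  note ends = ends[OF w n]
  have "n \<noteq> 1" using False permutes_bounds[OF w(1), of 1] by auto
  then have "inv w 1 \<noteq> inv w n" using ends(3,4) by auto
  then have lt: "inv w 1 < inv w n" using False by simp
  have "inv w 1 \<noteq> 1" "inv w n \<noteq> n" using False ends(3,4) by auto
  then have pos: "1 < inv w 1" "inv w n < n" using ends(1,2) by simp_all
  have "\<not> w 1 < w n"
  proof
    assume less: "w 1 < w n"
    have "{1, inv w 1, inv w n, n} \<subseteq> {1..n}" using ends(1,2) n by simp
    moreover have "w (inv w 1) < w 1" "w n < w (inv w n)"
      using False permutes_bounds[OF w(1), of 1] permutes_bounds[OF w(1), of n] n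
      unfolding ends(3,4) by simp_all
    ultimately have "has_2143 n w"
      unfolding has_2143_def using pos lt less by blast
    with no4(2) show False by blast
  qed
  moreover have "w 1 \<noteq> w n" using \<open>n \<noteq> 1\<close> inj_eq[OF permutes_inj[OF w(1)], of 1 n] by simp
  ultimately have "inv (inv w) n < inv (inv w) 1"
    unfolding permutes_inv_inv[OF w(1)] by simp
  then obtain g where "shape_dual n (inv w) g"
    using shape_dual_grassmannian[OF permutes_inv[OF w(1)] _ n] w has_321_inv[OF w(1)]
      has_1324_inv[OF w(1)] no4(1) by blast
  from shape_dual_inv[OF w(1) this] show ?thesis by blast
qed

lemma TL_coeff_eq_shape:
  assumes w: "w \<in> avoiders n" and no4: "\<not> has_1324 n w" "\<not> has_2143 n w" and u: "u permutes {1..n}"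
  shows "TL_coeff n w u = of_int (sign w) *
    (if lies_in n u (\<lambda>i. Max (w ` {i..n})) (\<lambda>i. Min (w ` {1..i}) - 1) then of_int (sign u) else 0)"
proof (cases "n = 0")
  \<comment> \<open>The description of the shape by w 1 and w n presupposes 1 \<le> n. For n = 0 the
    identity is the only permutation.\<close>
  case True
  then have "w = u" using w u by (simp add: permutes_empty)
  moreover have "lies_in n u la mu" for la mu using True by (simp add: lies_in_def)
  ultimately show ?thesis using TL_coeff_self[OF w] by (simp add: sign_def)
next
  case False
  then have n: "1 \<le> n" by simp
  have wp: "w permutes {1..n}" "\<not> has_321 n w" using w by blast+
  obtain g where g: "shape_dual n w g" using exists_shape_dual[OF wp n no4] ..
  have "g u = TL_coeff n w u * of_int (sign w)"
  proof (rule TL_coeff_eq_dual[OF _ w u])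
    show "g \<in> TL_functions n" using g unfolding shape_dual_def by blast
    fix v assume v: "v \<in> avoiders n"
    show "word_eval g (canonical_word n v) = (if v = w then of_int (sign w) else 0)"
      using g reduced_canonical_word_avoiders[OF v] v unfolding shape_dual_def by blast
  qed
  moreover have "g u = of_int (sign u) * (if in_shape n w u then 1 else 0)"
    using g u unfolding shape_dual_def by blast
  moreover have "of_int (sign w) * of_int (sign w) = (1 :: complex)" by (simp add: sign_def)
  ultimately have "TL_coeff n w u = of_int (sign w) * (of_int (sign u) * (if in_shape n w u then 1 else 0))"
    by (simp add: mult.left_commute[of "of_int (sign w)"])
  then show ?thesis unfolding lies_in_iff_in_shape[OF wp n u] by simp
qed

lemma TL_immanant_eq_percent_immanant_perm:
  assumes "w \<in> avoiders n" "\<not> has_1324 n w" "\<not> has_2143 n w"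
  shows "TL_immanant n w = of_int (sign w) * percent_immanant_perm n w"
  unfolding TL_immanant_eq percent_immanant_perm_def percent_immanant_eq of_int_mult_perm_poly
  by (rule perm_poly_cong) (rule TL_coeff_eq_shape[OF assms])

lemma skew_shape_perm:
  assumes w: "w permutes {1..n}"
  shows "skew_shape n (\<lambda>i. Max (w ` {i..n})) (\<lambda>i. Min (w ` {1..i}) - 1)"
  unfolding skew_shape_def
proof (intro conjI ballI)
  show "antimono_on {1..n} (\<lambda>i. Max (w ` {i..n}))"
    by (rule monotone_onI, rule Max_mono) auto
  show "antimono_on {1..n} (\<lambda>i. Min (w ` {1..i}) - 1)"
    by (rule monotone_onI, rule diff_le_mono, rule Min_antimono) auto
  fix i assume i: "i \<in> {1..n}"
  have "Min (w ` {1..i}) \<le> w i" "w i \<le> Max (w ` {i..n})" using i by auto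
  then show "Min (w ` {1..i}) - 1 \<le> Max (w ` {i..n})" by simp
  have "w j \<le> n" if "j \<in> {i..n}" for j using permutes_bounds(3)[OF w, of j] that i by simp
  then show "Max (w ` {i..n}) \<le> n" using i by (subst Max_le_iff) auto
qed

theorem theorem4p1:
  fixes n :: nat and w :: "nat \<Rightarrow> nat"
  assumes "w permutes {1..n}"
    and "avoids n w [3,2,1]"
  shows "(percent_immanant_up_to_sign n (TL_immanant n w) \<longleftrightarrow>
            avoids n w [1,3,2,4] \<and> avoids n w [2,1,4,3]) \<and>
         (avoids n w [1,3,2,4] \<and> avoids n w [2,1,4,3] \<longrightarrow>
            TL_immanant n w = of_int (sign w) * percent_immanant_perm n w)"
proof -
  have w: "w \<in> avoiders n" using assms avoids_321_iff[OF assms(1)] by blast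
  have eq: "TL_immanant n w = of_int (sign w) * percent_immanant_perm n w"
    if "\<not> has_1324 n w \<and> \<not> has_2143 n w"
    using TL_immanant_eq_percent_immanant_perm[OF w] that by blast
  have "percent_immanant_up_to_sign n (TL_immanant n w) \<longleftrightarrow> \<not> has_1324 n w \<and> \<not> has_2143 n w"
  proof
    assume "percent_immanant_up_to_sign n (TL_immanant n w)"
    then obtain la mu where shape: "skew_shape n la mu"
      and eq: "TL_immanant n w = percent_immanant n la mu \<or> TL_immanant n w = - percent_immanant n la mu"
      unfolding percent_immanant_up_to_sign_def by blast
    let ?s = "\<lambda>u. if lies_in n u la mu then of_int (sign u) else (0 :: complex)"
    from eq show "\<not> has_1324 n w \<and> \<not> has_2143 n w"
    proof
      assume "TL_immanant n w = percent_immanant n la mu"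
      then have "perm_poly n (TL_coeff n w) = perm_poly n ?s"
        unfolding TL_immanant_eq percent_immanant_eq .
      then have "TL_coeff n w u = 1 * ?s u" if "u permutes {1..n}" for u
        using lookup_perm_poly[OF that, of "TL_coeff n w"] lookup_perm_poly[OF that, of ?s] by simp
      then show ?thesis by (rule percent_immanant_avoids[OF w shape one_neq_zero])
    next
      assume "TL_immanant n w = - percent_immanant n la mu"
      then have "perm_poly n (TL_coeff n w) = perm_poly n (\<lambda>u. - ?s u)"
        unfolding TL_immanant_eq percent_immanant_eq uminus_perm_poly .
      then have "TL_coeff n w u = - 1 * ?s u" if "u permutes {1..n}" for u
        using lookup_perm_poly[OF that, of "TL_coeff n w"] lookup_perm_poly[OF that, of "\<lambda>u. - ?s u"] by simp
      then show ?thesis by (rule percent_immanant_avoids[OF w shape, rotated]) simp_all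
    qed
  next
    assume "\<not> has_1324 n w \<and> \<not> has_2143 n w"
    from eq[OF this] show "percent_immanant_up_to_sign n (TL_immanant n w)"
      unfolding percent_immanant_up_to_sign_def percent_immanant_perm_def
      using skew_shape_perm[OF assms(1)] by (auto simp: sign_def split: if_splits)
  qed
  then show ?thesis
    using eq unfolding avoids_1324_iff[OF assms(1)] avoids_2143_iff[OF assms(1)] by blast
qed

end
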